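(* Let $X=p_1+\cdots+p_n$ be a set of $n\ge 9$ evenly distributed smooth points on a reduced plane cubic $C$. Let $Z=mX$. The value $h_Z(t)=\dim\left(k[\mathbb{P}^2]/I(Z)\right)_t$ of the Hilbert function in degree $t$ is: (i) $\binom{t+2}{2}$ if $t<3m$; (ii) $n\binom{m+1}{2}-s(t,n,m)$ if $t\ge nm/3$; and (iii) $\binom{t+2}{2}-\binom{t-3r+2}{2}+n\binom{m-r+1}{2}-s(t-3r,n,m-r)$ if $n>9$ and $3m\le t<mn/3$, where $r=\lceil (mn-3t)/(n-9)\rceil$.
   Context: $\mathbb{P}^2$ is the projective plane over the ground field $k$, with homogeneous coordinate ring $k[\mathbb{P}^2]$. The points $p_1,\dots,p_n\in C\subset\mathbb{P}^2$ are distinct, $m$ is a positive integer, and degrees $t$ are non-negative integers. $Z=mX=m(p_1+\cdots+p_n)$ is the fat point subscheme of $\mathbb{P}^2$ defined by the ideal $I(Z)=\bigcap_{i=1}^n I(p_i)^m$. Smooth points means that each $p_i$ is a smooth point of $C$. For a component $D$ of $C$, let $n_D$ be the number of the points $p_i$ lying on $D$; the points are evenly distributed if $n_D=n\deg(D)/3$ for every reduced irreducible component $D$ of $C$. The integer $s(t,n,m)$ depends on the given points $p_1,\dots,p_n$ on $C$ (this dependence is suppressed in the notation) as well as on $t$ and $m$. It is defined only for $n\ge 9$ and $t\ge nm/3$, as follows, where $L$ is a general line in the plane (so $\mathcal{O}_C(tL)$ is the restriction of $\mathcal{O}_{\mathbb{P}^2}(t)$ to $C$): (1) if $t>nm/3$,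 then $s(t,n,m)=0$; (2) if $n=9$ and $t=3m$, let $\lambda$ be the order (possibly infinite) of $\mathcal{O}_C(3L)\otimes\mathcal{O}_C(-p_1-\cdots-p_9)$ in $\mathrm{Pic}(C)$, and set $s(t,n,m)=\lfloor m/\lambda\rfloor$ (which is $0$ if $\lambda$ is infinite); (3) if $n>9$ and $t=nm/3$, then $s(t,n,m)=1$ if $\mathcal{O}_C(tL)\otimes\mathcal{O}_C(-mp_1-\cdots-mp_n)=\mathcal{O}_C$ in $\mathrm{Pic}(C)$, and $s(t,n,m)=0$ otherwise.
   Formalization: In (iii) with t=3m (so r=m) the value s(0,n,0) is taken to be 0; applying clause (3) of the definition of s literally at m=0 would give 1, and the formula would then be false (e.g. n=10, m=1, t=3 on a smooth cubic, where h=9, not 8). *)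

theory Defs
  imports
    "HOL-Library.Poly_Mapping"
    "HOL-Library.Numeral_Type"
    "HOL-Analysis.Finite_Cartesian_Product"
    "HOL-Computational_Algebra.Fraction_Field"
    "HOL-Computational_Algebra.Squarefree"
    "HOL-Algebra.Embedded_Algebras"
    "HOL-Algebra.Ideal_Product"
    "HOL-Algebra.QuotRing"
    "HOL-Algebra.Multiplicative_Group"
begin

section \<open>Forms in three variables and points of the projective plane\<close>

type_synonym 'k poly3 = "(3 \<Rightarrow>\<^sub>0 nat) \<Rightarrow>\<^sub>0 'k"

definition form :: "nat \<Rightarrow> 'k::zero poly3 \<Rightarrow> bool" where
  "form d F \<longleftrightarrow> (\<forall>e\<in>Poly_Mapping.keys F. (\<Sum>i\<in>UNIV. Poly_Mapping.lookup e i) = d)"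

definition Var :: "3 \<Rightarrow> 'k::zero_neq_one poly3" where
  "Var i = Poly_Mapping.single (Poly_Mapping.single i 1) 1"

definition Const :: "'k::zero \<Rightarrow> 'k poly3" where
  "Const c = Poly_Mapping.single 0 c"

definition eval3 :: "'k::comm_semiring_1 poly3 \<Rightarrow> 'k ^ 3 \<Rightarrow> 'k" where
  "eval3 F v = (\<Sum>e\<in>Poly_Mapping.keys F. Poly_Mapping.lookup F e * (\<Prod>i\<in>UNIV. (v $ i) ^ Poly_Mapping.lookup e i))"

definition partial_deriv :: "3 \<Rightarrow> 'k::comm_semiring_1 poly3 \<Rightarrow> 'k poly3" where
  "partial_deriv i F =
     (\<Sum>e\<in>Poly_Mapping.keys F. Poly_Mapping.single (e - Poly_Mapping.single i 1)
                    (of_nat (Poly_Mapping.lookup e i) * Poly_Mapping.lookup F e))"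

text \<open>A (rational) point of the projective plane is given by a nonzero vector of homogeneous
  coordinates; two such vectors give the same point iff they are proportional.\<close>

definition same_point :: "'k::field ^ 3 \<Rightarrow> 'k ^ 3 \<Rightarrow> bool" where
  "same_point v w \<longleftrightarrow> (\<exists>c. c \<noteq> 0 \<and> w = c *s v)"

definition smooth_point :: "'k::field poly3 \<Rightarrow> 'k ^ 3 \<Rightarrow> bool" where
  "smooth_point F v \<longleftrightarrow> v \<noteq> 0 \<and> eval3 F v = 0 \<and> (\<exists>i. eval3 (partial_deriv i F) v \<noteq> 0)"

definition reduced_cubic :: "'k::field poly3 \<Rightarrow> bool" where
  "reduced_cubic F \<longleftrightarrow> F \<noteq> 0 \<and> form 3 F \<and> squarefree F"

text \<open>The reduced irreducible components of \<open>F = 0\<close> are the curves \<open>D = 0\<close> with \<open>D\<close> an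
  irreducible factor of \<open>F\<close>; factors of forms are forms.\<close>

definition evenly_distributed :: "'k::field poly3 \<Rightarrow> (nat \<Rightarrow> 'k ^ 3) \<Rightarrow> nat \<Rightarrow> bool" where
  "evenly_distributed F p n \<longleftrightarrow>
     (\<forall>D d. irreducible D \<and> D dvd F \<and> form d D \<longrightarrow>
        real (card {i \<in> {1..n}. eval3 D (p i) = 0}) = real n * real d / 3)"


section \<open>Fat points and their Hilbert functions\<close>

definition PR :: "'k::field poly3 ring" where
  "PR = \<lparr>carrier = UNIV, mult = (*), one = 1, zero = 0, add = (+)\<rparr>"

definition point_ideal :: "'k::field ^ 3 \<Rightarrow> 'k poly3 set" where
  "point_ideal v = Idl\<^bsub>PR\<^esub> {G. (\<exists>d. form d G) \<and> eval3 G v = 0}"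

definition fat_ideal :: "(nat \<Rightarrow> 'k::field ^ 3) \<Rightarrow> nat \<Rightarrow> nat \<Rightarrow> 'k poly3 set" where
  "fat_ideal p n m = (\<Inter>i\<in>{1..n}. point_ideal (p i) [^]\<^bsub>ideals_set PR\<^esub> m)"

definition hilbert_function :: "'k::field poly3 set \<Rightarrow> nat \<Rightarrow> nat" where
  "hilbert_function I t =
     ring.dim (PR Quot I) ((\<lambda>c. I +>\<^bsub>PR\<^esub> Const c) ` UNIV) ((\<lambda>G. I +>\<^bsub>PR\<^esub> G) ` {G. form t G})"


section \<open>The Picard group of a plane curve\<close>

text \<open>\<open>Pic\<close> of the reduced projective curve \<open>C: F = 0\<close> is the group of Cartier divisors on \<open>C\<close>,
  i.e. global sections of \<open>K\<^sup>* / O\<^sup>*\<close>, modulo principal divisors; here \<open>K\<close> is the sheaf of total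
  quotient rings of \<open>C\<close>. The points of \<open>C\<close> (closed points and generic points of components) are
  the relevant homogeneous primes containing \<open>F\<close>.\<close>

definition curve_points :: "'k::field poly3 \<Rightarrow> 'k poly3 set set" where
  "curve_points F =
     {P. primeideal P PR \<and> P = Idl\<^bsub>PR\<^esub> {G \<in> P. \<exists>d. form d G} \<and> F \<in> P \<and> (\<exists>i. Var i \<notin> P)}"

text \<open>\<open>G\<close> is a nonzerodivisor modulo \<open>F\<close>, i.e. it vanishes on no component of \<open>C\<close>.\<close>

definition nonzerodiv_on :: "'k::field poly3 \<Rightarrow> 'k poly3 \<Rightarrow> bool" where
  "nonzerodiv_on F G \<longleftrightarrow> (\<forall>A. F dvd G * A \<longrightarrow> F dvd A)"

text \<open>Rational functions on the plane that restrict to units of the total quotient ring of \<open>C\<close>.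
  Every such unit, and every germ of \<open>K\<^sup>* / O\<^sup>*\<close>, is the restriction of one of them.\<close>

definition rat_units :: "'k::field poly3 \<Rightarrow> 'k poly3 fract set" where
  "rat_units F = {Fract G H | d G H.
     form d G \<and> form d H \<and> nonzerodiv_on F G \<and> nonzerodiv_on F H}"

text \<open>The restriction of \<open>\<phi>\<close> to \<open>C\<close> is a unit of the local ring of \<open>C\<close> at \<open>P\<close>: it equals there a
  fraction \<open>A / B\<close> with \<open>A\<close> and \<open>B\<close> not vanishing at \<open>P\<close>.\<close>

definition stalk_unit :: "'k::field poly3 \<Rightarrow> 'k poly3 set \<Rightarrow> 'k poly3 fract \<Rightarrow> bool" where
  "stalk_unit F P \<phi> \<longleftrightarrow>
     (\<exists>d G H e A B. form d G \<and> form d H \<and> \<phi> = Fract G H \<and> nonzerodiv_on F H \<and>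
        form e A \<and> form e B \<and> A \<notin> P \<and> B \<notin> P \<and> F dvd G * B - A * H)"

text \<open>Cartier divisors given by a local equation \<open>\<phi> P\<close> at every point \<open>P\<close> of \<open>C\<close>: on some basic open
  neighbourhood \<open>{Q. U \<notin> Q}\<close> of \<open>P\<close>, \<open>\<phi> P\<close> is a local equation at every other point as well.
  Two such families give the same divisor iff their quotient is a unit at every \<open>P\<close>; this
  identification is absorbed in \<open>principal_data\<close>.\<close>

definition cartier_data :: "'k::field poly3 \<Rightarrow> ('k poly3 set \<Rightarrow> 'k poly3 fract) monoid" where
  "cartier_data F =
     \<lparr>carrier = {\<phi>. (\<forall>P\<in>curve_points F. \<phi> P \<in> rat_units F) \<and> (\<forall>P. P \<notin> curve_points F \<longrightarrow> \<phi> P = 1) \<and>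
        (\<forall>P\<in>curve_points F. \<exists>d U. form d U \<and> U \<notin> P \<and>
           (\<forall>Q\<in>curve_points F. U \<notin> Q \<longrightarrow> stalk_unit F Q (\<phi> P / \<phi> Q)))},
      mult = (\<lambda>\<phi> \<psi> P. \<phi> P * \<psi> P),
      one = (\<lambda>P. 1)\<rparr>"

definition principal_data :: "'k::field poly3 \<Rightarrow> ('k poly3 set \<Rightarrow> 'k poly3 fract) set" where
  "principal_data F = {\<phi> \<in> carrier (cartier_data F).
     \<exists>f\<in>rat_units F. \<forall>P\<in>curve_points F. stalk_unit F P (\<phi> P / f)}"

definition Pic :: "'k::field poly3 \<Rightarrow> ('k poly3 set \<Rightarrow> 'k poly3 fract) set monoid" where
  "Pic F = cartier_data F Mod principal_data F"

text \<open>For a homogeneous ideal \<open>J\<close> containing \<open>F\<close>: \<open>\<phi>\<close> generates the stalk at \<open>P\<close> of the ideal sheaf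
  on \<open>C\<close> defined by \<open>J\<close>. The two last conjuncts are the two inclusions.\<close>

definition local_equation ::
  "'k::field poly3 \<Rightarrow> 'k poly3 set \<Rightarrow> 'k poly3 set \<Rightarrow> 'k poly3 fract \<Rightarrow> bool" where
  "local_equation F J P \<phi> \<longleftrightarrow>
     (\<exists>d G H. form d G \<and> form d H \<and> \<phi> = Fract G H \<and> nonzerodiv_on F H \<and> H \<notin> P \<and>
        (\<exists>e U. form e U \<and> U \<notin> P \<and> U * G \<in> J) \<and>
        (\<forall>c A. form c A \<and> A \<in> J \<longrightarrow>
           (\<exists>a U b V. form a U \<and> form b V \<and> U \<notin> P \<and> F dvd U * A - V * G)))"

text \<open>The class of \<open>O\<^sub>C(Y)\<close>, for \<open>Y\<close> the effective Cartier divisor on \<open>C\<close> with ideal \<open>J\<close>; with the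
  usual sign convention the ideal sheaf of \<open>Y\<close> is \<open>O\<^sub>C(-Y)\<close>.\<close>

definition bundle_of :: "'k::field poly3 \<Rightarrow> 'k poly3 set \<Rightarrow> ('k poly3 set \<Rightarrow> 'k poly3 fract) set" where
  "bundle_of F J = (THE c. c \<in> carrier (Pic F) \<and>
     (\<exists>\<phi>\<in>c. \<forall>P\<in>curve_points F. local_equation F J P (\<phi> P)))"

text \<open>\<open>O\<^sub>C(L)\<close>: the class is the same for all lines \<open>L\<close> that are not components of \<open>C\<close>.\<close>

definition line_class :: "'k::field poly3 \<Rightarrow> ('k poly3 set \<Rightarrow> 'k poly3 fract) set" where
  "line_class F = (THE c. \<exists>l. form 1 l \<and> nonzerodiv_on F l \<and> c = bundle_of F (Idl\<^bsub>PR\<^esub> {l, F}))"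

text \<open>\<open>O\<^sub>C(tL) \<otimes> O\<^sub>C(-m p\<^sub>1 - \<dots> - m p\<^sub>n)\<close>\<close>

definition twist_class ::
  "'k::field poly3 \<Rightarrow> (nat \<Rightarrow> 'k ^ 3) \<Rightarrow> nat \<Rightarrow> nat \<Rightarrow> nat \<Rightarrow> ('k poly3 set \<Rightarrow> 'k poly3 fract) set" where
  "twist_class F p t n m =
     line_class F [^]\<^bsub>Pic F\<^esub> t \<otimes>\<^bsub>Pic F\<^esub>
     (\<Otimes>\<^bsub>Pic F\<^esub>i\<in>{1..n}. inv\<^bsub>Pic F\<^esub> (bundle_of F (point_ideal (p i))) [^]\<^bsub>Pic F\<^esub> m)"

text \<open>\<open>group.ord\<close> is \<open>0\<close> for elements of infinite order, and then \<open>m div 0 = 0\<close>.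
  For \<open>m = 0\<close> the scheme \<open>mX\<close> is empty and imposes no conditions, so \<open>s(t, n, 0) = 0\<close>; the
  triviality test in the last clause is for positive multiplicities (for \<open>m = t = 0\<close> and \<open>n > 9\<close>
  it would give \<open>1\<close>, although the empty scheme has Hilbert function \<open>0\<close>).\<close>

definition s_defect :: "'k::field poly3 \<Rightarrow> (nat \<Rightarrow> 'k ^ 3) \<Rightarrow> nat \<Rightarrow> nat \<Rightarrow> nat \<Rightarrow> nat" where
  "s_defect F p t n m =
     (if n < 9 \<or> real t < real (n * m) / 3 then undefined
      else if real t > real (n * m) / 3 then 0
      else if n = 9 then m div group.ord (Pic F) (twist_class F p 3 9 1)
      else if m > 0 \<and> twist_class F p t n m = \<one>\<^bsub>Pic F\<^esub> then 1
      else 0)"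

end

theory Submission
  imports Defs "Berlekamp_Zassenhaus.Unique_Factorization_Poly" "HOL-Analysis.Cartesian_Space"
begin

text \<open>
  A form whose divisor on the cubic \<open>C = V(F)\<close> has negative degree on some component vanishes on that
  component. As the points are evenly distributed, every form of degree \<open>t\<close> vanishing to order \<open>m\<close> at
  the points is divisible by \<open>F\<close> when \<open>3 t < n m\<close>; peeling off \<open>C\<close> replaces \<open>(t, m)\<close> by
  \<open>(t - 3, m - 1)\<close>, and this is repeated until \<open>3 t \<ge> n m\<close> or no forms are left. In the range
  \<open>3 t \<ge> n m\<close> the same step raises the dimension by that of the image of the restriction to \<open>C\<close>, which
  is everything unless the divisor class has degree \<open>0\<close>. In degree \<open>0\<close> the image has dimension at
  most one, and a section is nonzero exactly when it trivialises the line bundle.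

  Bezout's theorem, as a count of local conditions, comes from comparing Hilbert functions in large
  degree; Max Noether's theorem comes from the saturation of complete intersections; and that a line
  bundle of degree one has at most one section comes from comparing the pencils of lines through two
  of the points.
\<close>

text \<open>The obstacle is that \<open>k\<close> is arbitrary and the cubic may be reducible or
  singular: rational points and general lines may be missing, and intersection numbers are not at
  hand. Only conditions at the marked points are used. There smoothness gives discrete valuations,
  whose filtrations are written without denominators as \<open>U * A = u ^ j * a\<close> modulo
  \<open>F\<close>; everything else is counting dimensions of forms. Removing the cubic once raises
  \<open>3 t - n m\<close> by \<open>n - 9\<close>. Hence \<open>r\<close> is the least number of
  removals after which the degree is not negative, while for \<open>n = 9\<close> a class of degree
  \<open>0\<close> stays in degree \<open>0\<close>. A section on the curve does not come a priori
  from a form of multiplicity \<open>m\<close> in the plane. It does if the residual system for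
  \<open>(t - 3, m - 1)\<close> has the expected dimension, since then the at most
  \<open>n * (m choose 2)\<close> further conditions leave no room for failure. For
  \<open>n > 9\<close> the residual degree is positive and this holds. For \<open>n = 9\<close> it
  holds up to the first multiplicity that has a section, the torsion order; later multiples are
  served by powers of that first form.\<close>

section \<open>Forms, and homomorphisms out of the polynomial ring\<close>

definition mdeg :: "(3 \<Rightarrow>\<^sub>0 nat) \<Rightarrow> nat" where
  "mdeg e = (\<Sum>i\<in>UNIV. Poly_Mapping.lookup e i)"

lemma form_iff_mdeg: "form d F \<longleftrightarrow> (\<forall>e\<in>Poly_Mapping.keys F. mdeg e = d)"
  by (simp add: form_def mdeg_def)

lemma mdeg_add: "mdeg (e + e') = mdeg e + mdeg e'"
  by (simp add: mdeg_def lookup_add sum.distrib)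

text \<open>One homomorphism for many uses: evaluation, the grading, expansion at a point, linear
  changes of coordinates and the passage to iterated univariate polynomials all have the form
  \<open>subst h \<sigma>\<close>, so additivity and multiplicativity are proved once.\<close>

definition subst :: "('k::zero \<Rightarrow> 'b::comm_ring_1) \<Rightarrow> (3 \<Rightarrow> 'b) \<Rightarrow> 'k poly3 \<Rightarrow> 'b" where
  "subst h \<sigma> F = (\<Sum>e\<in>Poly_Mapping.keys F. h (Poly_Mapping.lookup F e) * (\<Prod>i\<in>UNIV. \<sigma> i ^ Poly_Mapping.lookup e i))"

lemma poly3_expand: "F = (\<Sum>e\<in>Poly_Mapping.keys F. Poly_Mapping.single e (Poly_Mapping.lookup F e))"
proof (rule poly_mapping_eqI)
  fix k
  have "Poly_Mapping.lookup (\<Sum>e\<in>Poly_Mapping.keys F. Poly_Mapping.single e (Poly_Mapping.lookup F e)) k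
      = (\<Sum>e\<in>Poly_Mapping.keys F. if e = k then Poly_Mapping.lookup F k else 0)"
    by (auto simp: lookup_sum lookup_single when_def intro!: sum.cong)
  also have "\<dots> = Poly_Mapping.lookup F k"
    by (auto simp: sum.delta in_keys_iff)
  finally show "Poly_Mapping.lookup F k
      = Poly_Mapping.lookup (\<Sum>e\<in>Poly_Mapping.keys F. Poly_Mapping.single e (Poly_Mapping.lookup F e)) k" ..
qed

locale scalar_hom =
  fixes h :: "'k::field \<Rightarrow> 'b::comm_ring_1"
  assumes h_add: "h (a + b) = h a + h b"
    and h_mult: "h (a * b) = h a * h b"
    and h_one: "h 1 = 1"
begin

lemma h_zero: "h 0 = 0"
  using h_add[of 0 0] by simp

lemma subst_superset:
  assumes "finite S" "Poly_Mapping.keys F \<subseteq> S"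
  shows "subst h \<sigma> F = (\<Sum>e\<in>S. h (Poly_Mapping.lookup F e) * (\<Prod>i\<in>UNIV. \<sigma> i ^ Poly_Mapping.lookup e i))"
  unfolding subst_def using assms
  by (intro sum.mono_neutral_left) (auto simp: in_keys_iff h_zero)

lemma subst_0: "subst h \<sigma> 0 = 0"
  by (simp add: subst_def)

lemma subst_add: "subst h \<sigma> (F + G) = subst h \<sigma> F + subst h \<sigma> G"
proof -
  let ?S = "Poly_Mapping.keys F \<union> Poly_Mapping.keys G"
  have "finite ?S" "Poly_Mapping.keys (F + G) \<subseteq> ?S"
    using Poly_Mapping.keys_add[of F G] by auto
  then show ?thesis
    by (simp add: subst_superset[of ?S] lookup_add h_add sum.distrib distrib_right)
qed

lemma subst_sum: "subst h \<sigma> (sum f A) = (\<Sum>a\<in>A. subst h \<sigma> (f a))"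
  by (induction A rule: infinite_finite_induct) (auto simp: subst_0 subst_add)

lemma subst_single:
  "subst h \<sigma> (Poly_Mapping.single e c) = h c * (\<Prod>i\<in>UNIV. \<sigma> i ^ Poly_Mapping.lookup e i)"
proof -
  have "Poly_Mapping.keys (Poly_Mapping.single e c) \<subseteq> {e}" by (simp)
  then show ?thesis by (subst subst_superset[of "{e}"]) auto
qed

lemma subst_mult: "subst h \<sigma> (F * G) = subst h \<sigma> F * subst h \<sigma> G"
proof -
  let ?s = "\<lambda>F e. Poly_Mapping.single e (Poly_Mapping.lookup F e)"
  have "F * G = (\<Sum>e\<in>Poly_Mapping.keys F. \<Sum>e'\<in>Poly_Mapping.keys G. ?s F e * ?s G e')"
    unfolding sum_product[symmetric] using poly3_expand[of F] poly3_expand[of G] by simp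
  then have "subst h \<sigma> (F * G)
      = (\<Sum>e\<in>Poly_Mapping.keys F. \<Sum>e'\<in>Poly_Mapping.keys G. subst h \<sigma> (?s F e * ?s G e'))"
    by (simp add: subst_sum)
  also have "\<dots> = (\<Sum>e\<in>Poly_Mapping.keys F. \<Sum>e'\<in>Poly_Mapping.keys G.
      (h (Poly_Mapping.lookup F e) * (\<Prod>i\<in>UNIV. \<sigma> i ^ Poly_Mapping.lookup e i)) *
      (h (Poly_Mapping.lookup G e') * (\<Prod>i\<in>UNIV. \<sigma> i ^ Poly_Mapping.lookup e' i)))"
    by (intro sum.cong refl)
       (simp add: mult_single subst_single h_mult lookup_add power_add prod.distrib mult_ac)
  also have "\<dots> = subst h \<sigma> F * subst h \<sigma> G"
    by (simp add: subst_def sum_product)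
  finally show ?thesis .
qed

lemma subst_Const: "subst h \<sigma> (Const c) = h c"
  by (simp add: Const_def subst_single)

lemma subst_1: "subst h \<sigma> 1 = 1"
  using subst_Const[of \<sigma> 1] by (simp add: Const_def h_one)

lemma subst_Var: "subst h \<sigma> (Var i) = \<sigma> i"
proof -
  have "(\<Prod>j\<in>UNIV. \<sigma> j ^ Poly_Mapping.lookup (Poly_Mapping.single i (1::nat)) j)
      = (\<Prod>j\<in>UNIV. if i = j then \<sigma> j else 1)"
    by (intro prod.cong) (auto simp: lookup_single when_def)
  then show ?thesis by (simp add: Var_def subst_single h_one)
qed

lemma subst_uminus: "subst h \<sigma> (- F) = - subst h \<sigma> F"
  using subst_add[of \<sigma> F "- F"] by (simp add: subst_0 add_eq_0_iff)

lemma subst_diff: "subst h \<sigma> (F - G) = subst h \<sigma> F - subst h \<sigma> G"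
  using subst_add[of \<sigma> F "- G"] by (simp add: subst_uminus)

lemma subst_power: "subst h \<sigma> (F ^ n) = subst h \<sigma> F ^ n"
  by (induction n) (auto simp: subst_1 subst_mult)

lemma subst_prod: "subst h \<sigma> (prod f A) = (\<Prod>a\<in>A. subst h \<sigma> (f a))"
  by (induction A rule: infinite_finite_induct) (auto simp: subst_1 subst_mult)

end

lemma Const_0 [simp]: "Const 0 = 0"
  by (simp add: Const_def)

lemma Const_1 [simp]: "Const 1 = 1"
  by (simp add: Const_def)

lemma Const_add: "Const (a + b :: 'k::field) = Const a + Const b"
  by (simp add: Const_def single_add)

lemma Const_mult: "Const (a * b :: 'k::field) = Const a * Const b"
  by (simp add: Const_def mult_single)

lemma Const_uminus: "Const (- a :: 'k::field) = - Const a"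
  by (simp add: Const_def single_uminus)

lemma Const_eq_iff [simp]: "Const a = Const b \<longleftrightarrow> a = (b :: 'k::field)"
  by (metis Const_def lookup_single_eq)

lemma Const_eq_0_iff [simp]: "Const a = 0 \<longleftrightarrow> a = (0 :: 'k::field)"
  by (metis Const_0 Const_eq_iff)

lemma Const_inverse: "a \<noteq> (0 :: 'k::field) \<Longrightarrow> Const a * Const (inverse a) = 1"
  by (simp flip: Const_mult)

lemma single_eq_prod_Var:
  "Poly_Mapping.single e (c::'k::field) = Const c * (\<Prod>i\<in>UNIV. Var i ^ Poly_Mapping.lookup e i)"
proof -
  have 1: "Var i ^ n = Poly_Mapping.single (Poly_Mapping.single i n) (1::'k)" for i n
    by (induction n) (auto simp: Var_def mult_single single_add[symmetric])
  have 2: "(\<Prod>i\<in>A. Poly_Mapping.single (f i) (1::'k)) = Poly_Mapping.single (sum f A) 1"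
    if "finite A" for A :: "3 set" and f :: "3 \<Rightarrow> 3 \<Rightarrow>\<^sub>0 nat"
    using that by (induction A rule: finite_induct) (auto simp: mult_single)
  have "(\<Sum>i\<in>UNIV. Poly_Mapping.single i (Poly_Mapping.lookup e i)) = e"
    by (intro poly_mapping_eqI) (simp add: lookup_sum lookup_single when_def)
  then show ?thesis
    by (simp add: 1 2 Const_def mult_single)
qed

text \<open>Scalars and variables generate the ring, so identities between homomorphisms need to be
  checked only there.\<close>

lemma poly3_induct [case_names Const Var add mult]:
  fixes F :: "'k::field poly3"
  assumes "\<And>c. P (Const c)" "\<And>i. P (Var i)"
    "\<And>F G. P F \<Longrightarrow> P G \<Longrightarrow> P (F + G)" "\<And>F G. P F \<Longrightarrow> P G \<Longrightarrow> P (F * G)"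
  shows "P F"
proof -
  have P0: "P 0" "P 1" using assms(1)[of 0] assms(1)[of 1] by simp_all
  have pow: "P (Var i ^ n)" for i n
    by (induction n) (auto simp: P0 assms)
  have pr: "P (\<Prod>i\<in>A. Var i ^ f i)" for f and A :: "3 set"
    by (induction A rule: infinite_finite_induct) (auto simp: P0 pow assms(4))
  have "P (\<Sum>e\<in>S. Poly_Mapping.single e (Poly_Mapping.lookup F e))" for S
    by (induction S rule: infinite_finite_induct) (auto simp: P0 assms pr single_eq_prod_Var)
  then show ?thesis using poly3_expand[of F] by metis
qed

lemma form_0 [simp]: "form d 0"
  by (simp add: form_def)

lemma form_Const [simp]: "form 0 (Const (c::'k::field))"
  by (auto simp: form_def Const_def)

lemma form_1 [simp]: "form 0 (1 :: 'k::field poly3)"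
  using form_Const[of 1] by simp

lemma form_single: "form (mdeg e) (Poly_Mapping.single e c)"
  by (auto simp: form_iff_mdeg split: if_splits)

lemma form_Var [simp]: "form 1 (Var i :: 'k::field poly3)"
proof -
  have "mdeg (Poly_Mapping.single i 1) = 1"
    by (simp add: mdeg_def lookup_single when_def)
  then show ?thesis unfolding Var_def using form_single[of "Poly_Mapping.single i 1" "1::'k"] by simp
qed

lemma form_add: "form d F \<Longrightarrow> form d G \<Longrightarrow> form d (F + G)"
  unfolding form_iff_mdeg using Poly_Mapping.keys_add[of F G] by blast

lemma form_uminus: "form d F \<Longrightarrow> form d (- F :: 'k::field poly3)"
  unfolding form_def by (simp add: in_keys_iff)

lemma form_diff: "form d F \<Longrightarrow> form d G \<Longrightarrow> form d (F - G :: 'k::field poly3)"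
  using form_add[of d F "- G"] form_uminus[of d G] by simp

lemma form_mult: "form d F \<Longrightarrow> form e G \<Longrightarrow> form (d + e) (F * G)"
  unfolding form_iff_mdeg using keys_mult[of F G] by (fastforce simp: mdeg_add)

lemma form_Const_mult: "form d F \<Longrightarrow> form d (Const (c::'k::field) * F)"
  using form_mult[of 0 "Const c" d F] by simp

lemma form_sum: "(\<And>a. a \<in> A \<Longrightarrow> form d (f a)) \<Longrightarrow> form d (sum f A)"
  by (induction A rule: infinite_finite_induct) (auto intro: form_add)

lemma form_power: "form d F \<Longrightarrow> form (n * d) (F ^ n :: 'k::field poly3)"
  by (induction n) (auto intro: form_mult)

lemma form_prod:
  "(\<And>a. a \<in> A \<Longrightarrow> form (g a) (f a)) \<Longrightarrow> form (sum g A) (prod f A :: 'k::field poly3)"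
  by (induction A rule: infinite_finite_induct) (auto intro: form_mult)

lemma form_degree_unique: "form d F \<Longrightarrow> form e F \<Longrightarrow> F \<noteq> 0 \<Longrightarrow> d = e"
  unfolding form_iff_mdeg by (metis in_keys_iff lookup_zero poly_mapping_eqI)

text \<open>The grading, encoded by the ring homomorphism \<open>G(x, y, z) \<mapsto> G(s x, s y, s z)\<close>.\<close>

definition homg :: "'k::field poly3 \<Rightarrow> 'k poly3 poly" where
  "homg = subst (\<lambda>c. [:Const c:]) (\<lambda>i. monom (Var i) 1)"

text \<open>Reading the component off as a coefficient turns its behaviour under products into the
  Cauchy product of univariate polynomials.\<close>

definition hcomp :: "nat \<Rightarrow> 'k::field poly3 \<Rightarrow> 'k poly3" where
  "hcomp d F = coeff (homg F) d"

interpretation homg: scalar_hom "\<lambda>c::'k::field. [:Const c:]"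
  by unfold_locales (simp_all add: Const_add Const_mult pCons_one)

lemma homg_single: "homg (Poly_Mapping.single e c) = monom (Poly_Mapping.single e c) (mdeg e)"
proof -
  have "(\<Prod>i\<in>A. monom (Var i :: 'a poly3) 1 ^ f i) = monom (\<Prod>i\<in>A. Var i ^ f i) (\<Sum>i\<in>A. f i)"
    if "finite A" for f and A :: "3 set"
    using that by (induction A rule: finite_induct) (auto simp: monom_power mult_monom)
  then show ?thesis
    unfolding homg_def homg.subst_single mdeg_def
    by (simp add: single_eq_prod_Var[of e c] smult_monom)
qed

lemma lookup_hcomp:
  "Poly_Mapping.lookup (hcomp d F) e = (if mdeg e = d then Poly_Mapping.lookup F e else 0)"
proof -
  have "homg F = (\<Sum>e\<in>Poly_Mapping.keys F. monom (Poly_Mapping.single e (Poly_Mapping.lookup F e)) (mdeg e))"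
    by (subst (1) poly3_expand) (simp only: homg_def homg.subst_sum flip: homg_single)
  then have "Poly_Mapping.lookup (hcomp d F) e
      = (\<Sum>e'\<in>Poly_Mapping.keys F. Poly_Mapping.lookup
          (if mdeg e' = d then Poly_Mapping.single e' (Poly_Mapping.lookup F e') else 0) e)"
    by (simp add: hcomp_def coeff_sum lookup_sum)
  also have "\<dots> = (\<Sum>e'\<in>Poly_Mapping.keys F.
      if e' = e then (if mdeg e = d then Poly_Mapping.lookup F e else 0) else 0)"
    by (intro sum.cong refl) (auto simp: lookup_single when_def)
  finally show ?thesis by (auto simp: in_keys_iff)
qed

lemma form_hcomp: "form d (hcomp d F)"
  by (auto simp: form_iff_mdeg in_keys_iff lookup_hcomp split: if_splits)

lemma hcomp_form: "form d F \<Longrightarrow> hcomp e F = (if e = d then F else 0)"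
  by (intro poly_mapping_eqI) (auto simp: lookup_hcomp form_iff_mdeg in_keys_iff)

lemma homg_form: "form d F \<Longrightarrow> homg F = monom F d"
  by (intro poly_eqI) (simp add: hcomp_form flip: hcomp_def)

lemma form_if_homg: "homg F = monom F d \<Longrightarrow> form d F"
  using form_hcomp[of d F] by (simp add: hcomp_def)

lemma homg_1: "poly (homg F) 1 = F"
proof (induction F rule: poly3_induct)
  case (Const c) then show ?case by (simp add: homg_def homg.subst_Const)
next
  case (Var i) then show ?case by (simp add: homg_def homg.subst_Var poly_monom)
next
  case (add F G) then show ?case by (simp add: homg_def homg.subst_add)
next
  case (mult F G) then show ?case by (simp add: homg_def homg.subst_mult)
qed

lemma sum_hcomp: "F = (\<Sum>d\<le>degree (homg F). hcomp d F)"
  using homg_1[of F] by (simp add: poly_altdef hcomp_def)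

lemma hcomp_0 [simp]: "hcomp d 0 = 0"
  by (simp add: hcomp_form[of 0])

lemma hcomp_add: "hcomp d (F + G) = hcomp d F + hcomp d G"
  by (simp add: hcomp_def homg_def homg.subst_add)

lemma hcomp_diff: "hcomp d (F - G) = hcomp d F - hcomp d G"
  by (simp add: hcomp_def homg_def homg.subst_diff)

lemma homg_mult: "homg (F * G) = homg F * homg G"
  by (simp add: homg_def homg.subst_mult)

lemma hcomp_mult_form:
  assumes "form d F" shows "hcomp (d + e) (F * G) = F * hcomp e G"
  by (simp add: hcomp_def homg_mult homg_form[OF assms] coeff_monom_mult)

lemma hcomp_mult_form':
  assumes "form d F" shows "hcomp e (F * G) = (if e < d then 0 else F * hcomp (e - d) G)"
  by (simp add: hcomp_def homg_mult homg_form[OF assms] coeff_monom_mult)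

text \<open>Order at \<open>0\<close> and degree are both additive over a domain, and the order
  never exceeds the degree. They agree for the product, hence for each factor, and equality of the
  two characterises monomials.\<close>

lemma monom_factor:
  fixes a b :: "'a::idom poly"
  assumes "a * b = monom c n" "c \<noteq> 0"
  shows "\<exists>a' i. a = monom a' i"
proof -
  have nz: "a \<noteq> 0" "b \<noteq> 0" using assms by (auto simp: monom_eq_0_iff)
  have "order 0 (a * b) = n" unfolding assms(1) using assms(2)
    using order_power_n_n[of "0 :: 'a" n] by (simp add: monom_altdef order_smult)
  then have o: "order 0 a + order 0 b = n"
    using nz by (simp add: order_mult)
  have d: "degree a + degree b = n"
    using nz assms by (metis degree_monom_eq degree_mult_eq)
  have "order 0 a \<le> degree a" "order 0 b \<le> degree b"
    using nz by (auto intro: order_degree)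
  with o d have eq: "order 0 a = degree a" by simp
  obtain q where q: "a = [:- 0, 1:] ^ order 0 a * q" using order_1[of 0 a] by (auto elim: dvdE)
  then have qnz: "q \<noteq> 0" using nz by auto
  have "degree a = order 0 a + degree q"
    using arg_cong[OF q, of degree] qnz by (subst (asm) degree_mult_eq) (auto simp: degree_power_eq)
  with eq have "degree q = 0" by simp
  then obtain c' where "q = [:c':]" by (metis degree_eq_zeroE)
  with q have "a = monom c' (order 0 a)" by (simp add: monom_altdef mult.commute)
  then show ?thesis by blast
qed

text \<open>The grading homomorphism sends a form to a monomial. Its factors there are monomials
  too, and setting the grading variable to \<open>1\<close> identifies the coefficient with the
  factor itself.\<close>

lemma form_factor:
  fixes G H :: "'k::field poly3"
  assumes "form d (G * H)" "G * H \<noteq> 0"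
  shows "\<exists>e. form e G"
proof -
  have "homg G * homg H = monom (G * H) d"
    using homg_form[OF assms(1)] by (simp add: homg_mult)
  then obtain a i where a: "homg G = monom a i"
    using monom_factor[of "homg G" "homg H"] assms(2) by blast
  then have "G = a" using homg_1[of G] by (simp add: poly_monom)
  with a have "form i G" using form_if_homg by blast
  then show ?thesis ..
qed

lemma form_factors:
  fixes G H :: "'k::field poly3"
  assumes "form d (G * H)" "G * H \<noteq> 0"
  obtains i j where "form i G" "form j H" "i + j = d"
proof -
  obtain i where i: "form i G" using form_factor[OF assms] by blast
  obtain j where j: "form j H" using form_factor[of d H G] assms by (auto simp: mult.commute)
  have "i + j = d" using form_mult[OF i j] assms form_degree_unique by blast
  with i j that show ?thesis by blast
qed

lemma form_0_eq_Const:
  assumes "form 0 (F :: 'k::field poly3)" shows "\<exists>c. F = Const c"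
proof -
  have "mdeg e = 0 \<longleftrightarrow> e = 0" for e
    by (auto simp: mdeg_def intro!: poly_mapping_eqI)
  then have "Poly_Mapping.keys F \<subseteq> {0}" using assms by (auto simp: form_iff_mdeg)
  then have "F = Poly_Mapping.single 0 (Poly_Mapping.lookup F 0)"
    by (intro poly_mapping_eqI) (auto simp: lookup_single when_def in_keys_iff)
  then show ?thesis unfolding Const_def by blast
qed

lemma is_unit_Const: "c \<noteq> 0 \<Longrightarrow> Const (c :: 'k::field) dvd 1"
  using Const_inverse[of c] by (metis dvd_triv_left)

lemma unit_eq_Const:
  assumes "(F :: 'k::field poly3) dvd 1" shows "\<exists>c. c \<noteq> 0 \<and> F = Const c"
proof -
  obtain G where G: "F * G = 1" using assms by (metis dvdE)
  obtain i j where ij: "form i F" "form j G" "i + j = 0"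
    using form_factors[of 0 F G] G by (metis form_1 one_neq_zero)
  then obtain c where c: "F = Const c" using form_0_eq_Const[of F] by auto
  have "c \<noteq> 0" using G unfolding c by auto
  with c show ?thesis by blast
qed

lemma form_not_unit: "form d F \<Longrightarrow> d > 0 \<Longrightarrow> \<not> (F :: 'k::field poly3) dvd (1::'k poly3)"
  by (metis form_Const form_degree_unique unit_eq_Const Const_eq_0_iff less_numeral_extra(3))

section \<open>Unique factorisation in three variables\<close>

text \<open>Irreducible and prime are purely multiplicative notions, so a multiplicative bijection
  onto a factorial ring carries the primeness of irreducibles back.\<close>

lemma irreducible_imp_prime_elem_via_iso:
  fixes f :: "'a::idom \<Rightarrow> 'b::ufd" and p :: 'a
  assumes bij: "bij f" and mult: "\<And>x y. f (x * y) = f x * f y" and one: "f 1 = 1" and zero: "f 0 = 0"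
    and irr: "irreducible p"
  shows "prime_elem p"
proof -
  have inj: "f x = f y \<longleftrightarrow> x = y" for x y
    using bij by (auto simp: bij_def inj_def)
  have surj: "\<exists>x. y = f x" for y
    using bij by (auto simp: bij_def surj_def)
  have dvd: "f x dvd f y \<longleftrightarrow> x dvd y" for x y
  proof
    assume "f x dvd f y"
    then obtain z where "f y = f x * f z" using surj by (metis dvdE)
    then show "x dvd y" by (simp add: inj flip: mult)
  qed (auto simp: mult elim!: dvdE)
  have "irreducible (f p)"
  proof (rule irreducibleI)
    show "f p \<noteq> 0" using irr inj[of p 0] zero by auto
    show "\<not> f p dvd 1" using irr dvd[of p 1] one by auto
    fix a b assume "f p = a * b"
    moreover obtain a' b' where ab: "a = f a'" "b = f b'" using surj by blast
    ultimately have "p = a' * b'" by (simp add: inj flip: mult)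
    then have "a' dvd 1 \<or> b' dvd 1" using irr by (auto dest: irreducibleD)
    then show "a dvd 1 \<or> b dvd 1" using dvd[of _ 1] one ab by auto
  qed
  then have pr: "prime_elem (f p)" by simp
  show ?thesis
  proof (rule prime_elemI)
    show "p \<noteq> 0" "\<not> p dvd 1" using irr by auto
    fix a b assume "p dvd a * b"
    then have "f p dvd f a * f b" by (simp add: dvd flip: mult)
    then show "p dvd a \<or> p dvd b" using pr by (simp add: prime_elem_dvd_mult_iff dvd)
  qed
qed

text \<open>The ring \<open>k[x][y][z]\<close> with the first variable innermost; it is factorial by
  Gauss's lemma, one layer at a time.\<close>

definition nested :: "'k::field poly3 \<Rightarrow> 'k poly poly poly" where
  "nested = subst (\<lambda>c. [:[:[:c:]:]:])
     (\<lambda>i. if i = 1 then [:[:monom 1 1:]:] else if i = 2 then [:monom 1 1:] else monom 1 1)"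

interpretation nested: scalar_hom "\<lambda>c::'k::field. [:[:[:c:]:]:]"
  by unfold_locales (simp_all add: pCons_one)

lemma prod_UNIV_3: "(\<Prod>i\<in>UNIV. f i) = f (1::3) * f 2 * f 3" for f :: "3 \<Rightarrow> 'b::comm_monoid_mult"
  unfolding UNIV_3 by (simp add: mult_ac)

lemma nested_single: "nested (Poly_Mapping.single e c) =
    monom (monom (monom c (Poly_Mapping.lookup e 1)) (Poly_Mapping.lookup e 2)) (Poly_Mapping.lookup e 3)"
proof -
  have pw: "[:p:] ^ n = [:p ^ n:]" for p :: "'b::comm_ring_1" and n
    by (induction n) (auto simp: pCons_one mult_ac)
  show ?thesis
    by (simp add: nested_def nested.subst_single prod_UNIV_3 pw monom_power smult_monom)
qed

lemma lookup_eq_coeff_nested: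
  "Poly_Mapping.lookup F e =
     coeff (coeff (coeff (nested F) (Poly_Mapping.lookup e 3)) (Poly_Mapping.lookup e 2)) (Poly_Mapping.lookup e 1)"
proof -
  have eq: "e' = e \<longleftrightarrow> Poly_Mapping.lookup e' 3 = Poly_Mapping.lookup e 3 \<and>
      Poly_Mapping.lookup e' 2 = Poly_Mapping.lookup e 2 \<and> Poly_Mapping.lookup e' 1 = Poly_Mapping.lookup e 1"
    for e' :: "3 \<Rightarrow>\<^sub>0 nat"
    by (auto simp: poly_mapping_eq_iff fun_eq_iff forall_3)
  have "nested F = (\<Sum>e'\<in>Poly_Mapping.keys F. nested (Poly_Mapping.single e' (Poly_Mapping.lookup F e')))"
    by (subst (1) poly3_expand) (simp only: nested_def nested.subst_sum)
  then have "coeff (coeff (coeff (nested F) (Poly_Mapping.lookup e 3)) (Poly_Mapping.lookup e 2)) (Poly_Mapping.lookup e 1)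
     = (\<Sum>e'\<in>Poly_Mapping.keys F.
         coeff (coeff (coeff (nested (Poly_Mapping.single e' (Poly_Mapping.lookup F e')))
           (Poly_Mapping.lookup e 3)) (Poly_Mapping.lookup e 2)) (Poly_Mapping.lookup e 1))"
    by (simp add: coeff_sum)
  also have "\<dots> = (\<Sum>e'\<in>Poly_Mapping.keys F. if e' = e then Poly_Mapping.lookup F e else 0)"
  proof (intro sum.cong refl)
    fix e'
    show "coeff (coeff (coeff (nested (Poly_Mapping.single e' (Poly_Mapping.lookup F e')))
        (Poly_Mapping.lookup e 3)) (Poly_Mapping.lookup e 2)) (Poly_Mapping.lookup e 1)
      = (if e' = e then Poly_Mapping.lookup F e else 0)"
      using eq[of e'] by (cases "e' = e") (auto simp: nested_single)
  qed
  finally show ?thesis by (auto simp: in_keys_iff)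
qed

lemma nested_Var:
  "nested (Var 1 :: 'k::field poly3) = [:[:[:0,1:]:]:]"
  "nested (Var 2 :: 'k::field poly3) = [:[:0,1:]:]"
  "nested (Var 3 :: 'k::field poly3) = [:0,1:]"
proof -
  have ne: "(2::3) \<noteq> 1" "(3::3) \<noteq> 1" "(3::3) \<noteq> 2" by simp_all
  have *: "nested (Var i :: 'k poly3) =
      (if i = 1 then [:[:monom 1 1:]:] else if i = 2 then [:monom 1 1:] else monom 1 1)" for i
    unfolding nested_def nested.subst_Var ..
  have m: "monom 1 1 = [:0, 1::'b::comm_ring_1:]" by (simp add: monom_Suc)
  show "nested (Var 1 :: 'k poly3) = [:[:[:0,1:]:]:]"
    unfolding * m if_P[OF refl] ..
  show "nested (Var 2 :: 'k poly3) = [:[:0,1:]:]"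
    unfolding * m if_not_P[OF ne(1)] if_P[OF refl] ..
  show "nested (Var 3 :: 'k poly3) = [:0,1:]"
    unfolding * m if_not_P[OF ne(2)] if_not_P[OF ne(3)] ..
qed

lemma nested_add: "nested (F + G) = nested F + nested G"
  by (simp add: nested_def nested.subst_add)

lemma nested_mult: "nested (F * G) = nested F * nested G"
  by (simp add: nested_def nested.subst_mult)

text \<open>Injective because every coefficient can be read off. Surjective because the range is
  closed under sums and products and contains the constants and the three variables; each layer is
  generated by the one below and its own variable, by Horner's scheme.\<close>

lemma bij_nested: "bij (nested :: 'k::field poly3 \<Rightarrow> _)"
proof (rule bijI)
  show "inj (nested :: 'k::field poly3 \<Rightarrow> _)"
  proof (intro injI poly_mapping_eqI)
    fix F G :: "'k poly3" and e assume "nested F = nested G"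
    then show "Poly_Mapping.lookup F e = Poly_Mapping.lookup G e"
      by (simp only: lookup_eq_coeff_nested[of F] lookup_eq_coeff_nested[of G])
  qed
  let ?R = "range (nested :: 'k::field poly3 \<Rightarrow> _)"
  have add: "a + b \<in> ?R" if ab: "a \<in> ?R" "b \<in> ?R" for a b
  proof -
    obtain F G where "a = nested F" "b = nested G" using ab by auto
    then show ?thesis by (simp flip: nested_add)
  qed
  have mult: "a * b \<in> ?R" if ab: "a \<in> ?R" "b \<in> ?R" for a b
  proof -
    obtain F G where "a = nested F" "b = nested G" using ab by auto
    then show ?thesis by (simp flip: nested_mult)
  qed
  have c: "[:[:[:c:]:]:] \<in> ?R" for c
    by (rule range_eqI[where x = "Const c"]) (simp add: nested_def nested.subst_Const)
  have x: "[:[:[:0,1:]:]:] \<in> ?R" "[:[:0,1:]:] \<in> ?R" "[:0,1:] \<in> ?R"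
    by (rule range_eqI, rule nested_Var[symmetric])+
  have z: "0 \<in> ?R" using c[of 0] by simp
  have 1: "[:[:p:]:] \<in> ?R" for p
  proof (induction p)
    case (pCons a p)
    have "[:[:pCons a p:]:] = [:[:[:a:]:]:] + [:[:[:0,1:]:]:] * [:[:p:]:]" by simp
    then show ?case using add[OF c mult[OF x(1) pCons(2)]] by simp
  qed (use z in simp)
  have 2: "[:p:] \<in> ?R" for p
  proof (induction p)
    case (pCons a p)
    have "[:pCons a p:] = [:[:a:]:] + [:[:0,1:]:] * [:p:]" by simp
    then show ?case using add[OF 1 mult[OF x(2) pCons(2)]] by simp
  qed (use z in simp)
  have "p \<in> ?R" for p
  proof (induction p)
    case (pCons a p)
    have "pCons a p = [:a:] + [:0,1:] * p" by simp
    then show ?case using add[OF 2 mult[OF x(3) pCons(2)]] by simp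
  qed (use z in simp)
  then show "?R = UNIV" by blast
qed

lemma irreducible_poly3_prime:
  fixes F :: "'k::field poly3"
  assumes "irreducible F" shows "prime_elem F"
  using irreducible_imp_prime_elem_via_iso[OF bij_nested _ _ _ assms]
  by (simp add: nested_def nested.subst_mult nested.subst_1 nested.subst_0)

section \<open>Finite-dimensional subspaces\<close>

locale vspace = vector_space
begin

text \<open>The polynomial ring has infinite dimension, so finiteness has to be attached to the
  subsets under consideration.\<close>

definition fin_dim :: "'b set \<Rightarrow> bool" where
  "fin_dim W \<longleftrightarrow> (\<exists>B. finite B \<and> W \<subseteq> span B)"

lemma fin_dim_subset: "fin_dim W \<Longrightarrow> U \<subseteq> W \<Longrightarrow> fin_dim U"
  unfolding fin_dim_def by blast

lemma fin_dim_independent: "fin_dim W \<Longrightarrow> independent S \<Longrightarrow> S \<subseteq> W \<Longrightarrow> finite S"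
  unfolding fin_dim_def using independent_span_bound by blast

lemma fin_dim_basis_extend:
  assumes "fin_dim W" "subspace W" "independent S" "S \<subseteq> W"
  obtains B where "S \<subseteq> B" "B \<subseteq> W" "finite B" "independent B" "span B = W" "card B = dim W"
proof -
  obtain B where B: "S \<subseteq> B" "B \<subseteq> W" "independent B" "W \<subseteq> span B"
    using maximal_independent_subset_extend[OF assms(4,3)] by blast
  show ?thesis
  proof (rule that[OF B(1,2) _ B(3)])
    show "finite B" using fin_dim_independent[OF assms(1) B(3,2)] .
    show "span B = W" using span_subspace[OF B(2,4) assms(2)] .
    show "card B = dim W" using basis_card_eq_dim[OF B(2,4,3)] .
  qed
qed

lemma fin_dim_mono:
  assumes "fin_dim W" "U \<subseteq> W" shows "dim U \<le> dim W"
proof -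
  obtain B where B: "B \<subseteq> W" "independent B" "W \<subseteq> span B" "card B = dim W"
    using basis_exists[of W] .
  then show ?thesis
    using dim_le_card[of U B] fin_dim_independent[OF assms(1) B(2,1)] assms(2) by auto
qed

lemma fin_dim_subspace_eq:
  assumes "fin_dim W" "subspace W" "subspace U" "U \<subseteq> W" "dim W \<le> dim U"
  shows "U = W"
proof -
  have fU: "fin_dim U" using fin_dim_subset assms by blast
  obtain A where A: "A \<subseteq> U" "finite A" "independent A" "span A = U" "card A = dim U"
    using fin_dim_basis_extend[OF fU assms(3) independent_empty empty_subsetI] by metis
  obtain B where B: "A \<subseteq> B" "B \<subseteq> W" "finite B" "independent B" "span B = W" "card B = dim W"
    using fin_dim_basis_extend[OF assms(1,2) A(3) order_trans[OF A(1) assms(4)]] .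
  have "A = B" using card_seteq[OF B(3,1)] A(5) B(6) assms(5) by simp
  then show ?thesis using A B by simp
qed

lemma fin_dim_sums:
  assumes "fin_dim U" "fin_dim W" shows "fin_dim {x + y |x y. x \<in> U \<and> y \<in> W}"
proof -
  obtain A B where "finite A" "U \<subseteq> span A" "finite B" "W \<subseteq> span B"
    using assms unfolding fin_dim_def by blast
  moreover from this have "{x + y |x y. x \<in> U \<and> y \<in> W} \<subseteq> span (A \<union> B)"
    unfolding span_Un by blast
  ultimately show ?thesis unfolding fin_dim_def by blast
qed

text \<open>A basis \<open>A\<close> of the intersection is extended to bases \<open>B\<close> of
  \<open>U\<close> and \<open>C\<close> of \<open>W\<close>. Then \<open>B \<union> (C - A)\<close>
  is a basis of the sum: a relation involving some vector of \<open>C - A\<close> has its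
  \<open>U\<close>-part in \<open>U \<inter> W = span A\<close>, against the independence of
  \<open>C\<close>.\<close>

lemma dim_sums_Int:
  assumes "fin_dim U" "fin_dim W" "subspace U" "subspace W"
  shows "dim {x + y |x y. x \<in> U \<and> y \<in> W} + dim (U \<inter> W) = dim U + dim W"
proof -
  have sI: "subspace (U \<inter> W)" using assms by (simp add: subspace_inter)
  have fI: "fin_dim (U \<inter> W)" using fin_dim_subset assms(1) by blast
  obtain A where A: "A \<subseteq> U \<inter> W" "finite A" "independent A" "span A = U \<inter> W" "card A = dim (U \<inter> W)"
    using fin_dim_basis_extend[OF fI sI independent_empty empty_subsetI] by metis
  obtain B where B: "A \<subseteq> B" "B \<subseteq> U" "finite B" "independent B" "span B = U" "card B = dim U"
    using fin_dim_basis_extend[OF assms(1,3) A(3) A(1)[THEN order_trans, OF Int_lower1]] .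
  obtain C where C: "A \<subseteq> C" "C \<subseteq> W" "finite C" "independent C" "span C = W" "card C = dim W"
    using fin_dim_basis_extend[OF assms(2,4) A(3) A(1)[THEN order_trans, OF Int_lower2]] .
  have disj: "B \<inter> (C - A) = {}"
  proof -
    have "c \<notin> B" if "c \<in> C - A" for c
    proof
      assume "c \<in> B"
      then have "c \<in> span A" using that A(4) B(2) C(2) by auto
      moreover have "c \<notin> span (C - {c})" using C(4) that unfolding dependent_def by blast
      moreover have "span A \<subseteq> span (C - {c})" using that C(1) by (intro span_mono) auto
      ultimately show False by blast
    qed
    then show ?thesis by blast
  qed
  have ind: "independent (B \<union> S)" if "finite S" "S \<subseteq> C - A" for S
    using that
  proof (induction S rule: finite_induct)
    case empty then show ?case using B by simp
  next
    case (insert c S)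
    have "c \<notin> span (B \<union> S)"
    proof
      assume "c \<in> span (B \<union> S)"
      then obtain x y where xy: "c = x + y" "x \<in> U" "y \<in> span S"
        unfolding span_Un B(5) by blast
      have "span S \<subseteq> W" using insert.prems C(2,5) span_mono[of S C] by auto
      then have "x \<in> W"
        using xy insert.prems C(2) assms(4) subspace_diff[of W c y] by (auto simp: algebra_simps)
      then have "x \<in> span A" using A(4) xy by blast
      then have "c \<in> span (A \<union> S)" unfolding span_Un xy(1) using xy(3) by blast
      moreover have "span (A \<union> S) \<subseteq> span (C - {c})"
        using insert C(1) by (intro span_mono) auto
      ultimately show False using C(4) insert.prems unfolding dependent_def by blast
    qed
    then show ?case using insert independent_insertI by simp
  qed
  have "{x + y |x y. x \<in> U \<and> y \<in> W} = span (B \<union> C)"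
    unfolding span_Un B(5) C(5) ..
  also have "\<dots> = span (B \<union> (C - A))" using B(1) by (auto intro!: arg_cong[where f = span])
  finally have "dim {x + y |x y. x \<in> U \<and> y \<in> W} = card (B \<union> (C - A))"
    using dim_span_eq_card_independent[OF ind[of "C - A"]] C(3) by auto
  also have "\<dots> = card B + card (C - A)" using disj B(3) C(3) by (intro card_Un_disjoint) auto
  also have "card (C - A) = card C - card A" using A(2) C(1) by (intro card_Diff_subset) auto
  finally show ?thesis
    using A(5) B(6) C(6) card_mono[OF C(3,1)] by simp
qed

text \<open>Codimension at most one is phrased through pairs of vectors so that leading coefficients
  can supply it: two sections of the same order at a point have a combination of higher
  order.\<close>

lemma dim_le_Suc:
  assumes "fin_dim U" "subspace U" "subspace U'" "U' \<subseteq> U"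
    and "\<And>a b. a \<in> U \<Longrightarrow> b \<in> U \<Longrightarrow> \<exists>c d. (c \<noteq> 0 \<or> d \<noteq> 0) \<and> scale c a + scale d b \<in> U'"
  shows "dim U \<le> dim U' + 1"
proof (cases "U = U'")
  case False
  then obtain a where a: "a \<in> U" "a \<notin> U'" using assms(4) by blast
  have "U \<subseteq> {x + y |x y. x \<in> U' \<and> y \<in> span {a}}"
  proof
    fix b assume "b \<in> U"
    then obtain c d where cd: "c \<noteq> 0 \<or> d \<noteq> 0" "scale c a + scale d b \<in> U'"
      using assms(5) a by blast
    have d: "d \<noteq> 0"
    proof
      assume "d = 0"
      then have c: "c \<noteq> 0" "scale c a \<in> U'" using cd by auto
      then have "scale (inverse c) (scale c a) \<in> U'" using subspace_scale[OF assms(3)] by blast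
      then show False using a c(1) by simp
    qed
    have "b = scale (inverse d) (scale c a + scale d b) + scale (- inverse d * c) a"
      using d by (simp add: scale_right_distrib)
    moreover have "scale (inverse d) (scale c a + scale d b) \<in> U'" using subspace_scale[OF assms(3) cd(2)] .
    moreover have "scale (- inverse d * c) a \<in> span {a}" unfolding span_singleton by blast
    ultimately show "b \<in> {x + y |x y. x \<in> U' \<and> y \<in> span {a}}" by blast
  qed
  moreover have f: "fin_dim U'" "fin_dim (span {a})"
    using fin_dim_subset[OF assms(1,4)] unfolding fin_dim_def by (blast, blast)
  ultimately have "dim U \<le> dim {x + y |x y. x \<in> U' \<and> y \<in> span {a}}"
    by (intro fin_dim_mono fin_dim_sums)
  also have "\<dots> \<le> dim U' + dim (span {a})"
    using dim_sums_Int[OF f assms(3) subspace_span] by simp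
  also have "dim (span {a}) \<le> card {a}" using dim_le_card'[of "{a}"] by simp
  finally show ?thesis by simp
qed simp

end

section \<open>The space of forms of a given degree\<close>

interpretation lin: vspace "\<lambda>c (F :: 'k::field poly3). Const c * F"
  by unfold_locales (auto simp: Const_add Const_mult algebra_simps)

interpretation linp: vector_space_pair "\<lambda>c (F :: 'k::field poly3). Const c * F" "\<lambda>c (F :: 'k::field poly3). Const c * F"
  by unfold_locales

lemma inj_mult_poly3: "A \<noteq> 0 \<Longrightarrow> inj (\<lambda>F. A * F :: 'k::field poly3)"
  by (auto simp: inj_def)

lemma linear_mult_poly3:
  "Vector_Spaces.linear (\<lambda>c F. Const c * F) (\<lambda>c F. Const c * F) (\<lambda>F. A * F :: 'k::field poly3)"
  by (simp add: Vector_Spaces.linear_iff lin.vector_space_axioms distrib_left mult.left_commute)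

lemma subspace_mult_image: "lin.subspace U \<Longrightarrow> lin.subspace ((\<lambda>F. A * F) ` U)"
  by (rule linp.linear_subspace_image[OF linear_mult_poly3])

lemma dim_mult_image:
  assumes "A \<noteq> 0" shows "lin.dim ((\<lambda>F. A * F) ` U) = lin.dim (U :: 'k::field poly3 set)"
proof -
  obtain B where B: "B \<subseteq> U" "lin.independent B" "U \<subseteq> lin.span B" "card B = lin.dim U"
    using lin.basis_exists[of U] .
  show ?thesis
  proof (rule lin.dim_unique)
    show "(*) A ` B \<subseteq> (*) A ` U" using B by blast
    show "(*) A ` U \<subseteq> lin.span ((*) A ` B)"
      using B(3) unfolding linp.linear_span_image[OF linear_mult_poly3] by blast
    show "lin.independent ((*) A ` B)"
      by (rule linp.linear_independent_injective_image[OF linear_mult_poly3 B(2) inj_on_subset[OF inj_mult_poly3[OF assms] subset_UNIV]])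
    show "card ((*) A ` B) = lin.dim U"
      using B(4) card_image[OF inj_on_subset[OF inj_mult_poly3[OF assms]]] by simp
  qed
qed

definition forms :: "nat \<Rightarrow> 'k::field poly3 set" where
  "forms t = {F. form t F}"

lemma mem_forms [simp]: "F \<in> forms t \<longleftrightarrow> form t F"
  by (simp add: forms_def)

lemma subspace_forms: "lin.subspace (forms t)"
  by (auto intro!: lin.subspaceI form_add form_Const_mult)

definition monoms :: "nat \<Rightarrow> 'k::field poly3 set" where
  "monoms t = (\<lambda>e. Poly_Mapping.single e 1) ` {e. mdeg e = t}"

lemma bij_exponents:
  "bij_betw (\<lambda>e :: 3 \<Rightarrow>\<^sub>0 nat. (Poly_Mapping.lookup e 1, Poly_Mapping.lookup e 2)) {e. mdeg e = t} (SIGMA a:{..t}. {..t - a})"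
proof (rule bij_betwI')
  fix e e' :: "3 \<Rightarrow>\<^sub>0 nat" assume "e \<in> {e. mdeg e = t}" "e' \<in> {e. mdeg e = t}"
  then show "((Poly_Mapping.lookup e 1, Poly_Mapping.lookup e 2) = (Poly_Mapping.lookup e' 1, Poly_Mapping.lookup e' 2)) = (e = e')"
    by (auto simp: mdeg_def sum_3 poly_mapping_eq_iff fun_eq_iff forall_3)
next
  fix e :: "3 \<Rightarrow>\<^sub>0 nat" assume "e \<in> {e. mdeg e = t}"
  then show "(Poly_Mapping.lookup e 1, Poly_Mapping.lookup e 2) \<in> (SIGMA a:{..t}. {..t - a})"
    by (auto simp: mdeg_def sum_3)
next
  fix ab assume ab: "ab \<in> (SIGMA a:{..t}. {..t - a})"
  obtain a b where [simp]: "ab = (a, b)" by fastforce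
  let ?e = "Poly_Mapping.single 1 a + Poly_Mapping.single 2 b + Poly_Mapping.single (3::3) (t - a - b)"
  have ne: "(1::3) \<noteq> 2" "(2::3) \<noteq> 1" "(1::3) \<noteq> 3" "(3::3) \<noteq> 1" "(2::3) \<noteq> 3" "(3::3) \<noteq> 2" by simp_all
  have l: "Poly_Mapping.lookup ?e 1 = a" "Poly_Mapping.lookup ?e 2 = b" "Poly_Mapping.lookup ?e 3 = t - a - b"
    using ne by (simp_all only: lookup_add lookup_single when_def if_True if_False refl add_0 add_0_right)
  then have "mdeg ?e = t" using ab by (auto simp: mdeg_def sum_3)
  with l show "\<exists>e\<in>{e. mdeg e = t}. ab = (Poly_Mapping.lookup e 1, Poly_Mapping.lookup e 2)"
    by (intro bexI[of _ ?e]) auto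
qed

lemma finite_exponents: "finite {e. mdeg e = t}"
  using bij_betw_finite[OF bij_exponents[of t]] by simp

lemma card_exponents: "card {e. mdeg e = t} = (t + 2) choose 2"
proof -
  have "card {e. mdeg e = t} = (\<Sum>a\<le>t. Suc (t - a))"
    using bij_betw_same_card[OF bij_exponents[of t]] by simp
  also have "\<dots> = (\<Sum>a\<le>t. Suc a)"
    using sum.nat_diff_reindex[of Suc "Suc t"] by (simp add: lessThan_Suc_atMost)
  also have "\<dots> = (t + 2) choose 2"
    by (induction t) (auto simp: numeral_2_eq_2)
  finally show ?thesis .
qed

lemma finite_monoms: "finite (monoms t)"
  unfolding monoms_def using finite_exponents by blast

lemma span_monoms: "lin.span (monoms t) = (forms t :: 'k::field poly3 set)"
proof (rule lin.span_subspace)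
  show "monoms t \<subseteq> (forms t :: 'k poly3 set)"
    using form_single by (auto simp: monoms_def)
  show "forms t \<subseteq> lin.span (monoms t :: 'k poly3 set)"
  proof
    fix F :: "'k poly3" assume F: "F \<in> forms t"
    have "(\<Sum>e\<in>Poly_Mapping.keys F. Const (Poly_Mapping.lookup F e) * Poly_Mapping.single e 1) \<in> lin.span (monoms t)"
      using F by (intro lin.span_sum lin.span_scale lin.span_base) (auto simp: monoms_def form_iff_mdeg)
    then show "F \<in> lin.span (monoms t)"
      using poly3_expand[of F] by (simp add: Const_def mult_single)
  qed
qed (rule subspace_forms)

lemma fin_dim_forms: "lin.fin_dim (forms t)"
  unfolding lin.fin_dim_def using finite_monoms span_monoms by blast

lemma independent_monoms: "lin.independent (monoms t :: 'k::field poly3 set)"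
  unfolding lin.dependent_def
proof
  assume "\<exists>a\<in>monoms t. a \<in> lin.span (monoms t - {a :: 'k poly3})"
  then obtain e where e: "Poly_Mapping.single e 1 \<in> lin.span (monoms t - {Poly_Mapping.single e (1::'k)})"
    by (auto simp: monoms_def)
  have "lin.subspace {F :: 'k poly3. Poly_Mapping.lookup F e = 0}"
  proof (rule lin.subspaceI)
    fix c and F :: "'k poly3" assume "F \<in> {F. Poly_Mapping.lookup F e = 0}"
    moreover have "Const c * F = Poly_Mapping.map ((*) c) F" by (simp add: mult_map_scale_conv_mult Const_def)
    ultimately show "Const c * F \<in> {F. Poly_Mapping.lookup F e = 0}"
      by (simp add: Poly_Mapping.map.rep_eq)
  qed (auto simp: lookup_add)
  moreover have "monoms t - {Poly_Mapping.single e (1::'k)} \<subseteq> {F. Poly_Mapping.lookup F e = 0}"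
    by (auto simp: monoms_def lookup_single when_def)
  ultimately have "lin.span (monoms t - {Poly_Mapping.single e (1::'k)}) \<subseteq> {F. Poly_Mapping.lookup F e = 0}"
    by (intro lin.span_minimal)
  then show False using e by auto
qed

lemma dim_forms: "lin.dim (forms t :: 'k::field poly3 set) = (t + 2) choose 2"
proof -
  have "inj_on (\<lambda>e. Poly_Mapping.single e (1::'k)) {e. mdeg e = t}"
    by (rule inj_onI) (metis keys_single one_neq_zero singleton_inject)
  then have "card (monoms t :: 'k poly3 set) = (t + 2) choose 2"
    unfolding monoms_def by (simp add: card_image card_exponents)
  moreover have "lin.dim (lin.span (monoms t :: 'k poly3 set)) = card (monoms t :: 'k poly3 set)"
    by (rule lin.dim_span_eq_card_independent[OF independent_monoms])
  ultimately show ?thesis unfolding span_monoms by simp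
qed

section \<open>The Hilbert function as a codimension\<close>

lemma cring_PR: "cring (PR :: 'k::field poly3 ring)"
  by (rule cringI; (rule abelian_groupI comm_monoidI)?; simp add: PR_def algebra_simps)
     (metis add.commute add.right_inverse)

lemma PR_simps [simp]:
  "carrier PR = UNIV" "mult PR = (*)" "monoid.one PR = 1" "ring.zero PR = 0" "add PR = (+)"
  by (simp_all add: PR_def)

lemma ring_PR: "ring (PR :: 'k::field poly3 ring)"
  using cring_PR by (rule cring.axioms)

lemma PR_a_inv [simp]: "\<ominus>\<^bsub>PR\<^esub> x = - (x :: 'k::field poly3)"
  by (rule abelian_group.minus_equality[OF ring.is_abelian_group[OF ring_PR]]) simp_all

lemma PR_minus [simp]: "x \<ominus>\<^bsub>PR\<^esub> y = (x :: 'k::field poly3) - y"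
  by (simp add: a_minus_def)

lemma ideal_PR_iff:
  "ideal I (PR :: 'k::field poly3 ring) \<longleftrightarrow> 0 \<in> I \<and> (\<forall>a\<in>I. \<forall>b\<in>I. a + b \<in> I) \<and> (\<forall>a\<in>I. \<forall>r. r * a \<in> I)"
proof
  assume "ideal I (PR :: 'k poly3 ring)"
  then interpret ideal I "PR :: 'k poly3 ring" .
  show "0 \<in> I \<and> (\<forall>a\<in>I. \<forall>b\<in>I. a + b \<in> I) \<and> (\<forall>a\<in>I. \<forall>r. r * a \<in> I)"
    using additive_subgroup.zero_closed[OF additive_subgroup_axioms]
      additive_subgroup.a_closed[OF additive_subgroup_axioms] I_l_closed by auto
next
  assume I: "0 \<in> I \<and> (\<forall>a\<in>I. \<forall>b\<in>I. a + b \<in> I) \<and> (\<forall>a\<in>I. \<forall>r. r * a \<in> I)"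
  have neg: "- a \<in> I" if "a \<in> I" for a
    using I that by (metis mult_minus1)
  interpret ring "PR :: 'k poly3 ring" by (rule ring_PR)
  show "ideal I (PR :: 'k poly3 ring)"
  proof (rule idealI[OF ring_PR])
    show "subgroup I (add_monoid PR)"
      using I neg by (intro add.subgroupI) (auto simp flip: a_inv_def)
  qed (use I in \<open>auto simp: mult.commute\<close>)
qed

lemma subspace_ideal:
  assumes "ideal I (PR :: 'k::field poly3 ring)" shows "lin.subspace I"
  using assms unfolding ideal_PR_iff by (intro lin.subspaceI) auto

lemma subfield_Const: "subfield (range Const) (PR :: 'k::field poly3 ring)"
proof -
  interpret cring "PR :: 'k poly3 ring" by (rule cring_PR)
  have sr: "subring (range Const) (PR :: 'k poly3 ring)"
  proof (rule subringI)
    show "\<one>\<^bsub>PR\<^esub> \<in> range (Const :: 'k \<Rightarrow> _)" by (rule range_eqI[of _ _ 1]) simp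
    fix a b :: "'k poly3" assume "a \<in> range Const" "b \<in> range Const"
    then obtain x y where "a = Const x" "b = Const y" by auto
    then show "\<ominus>\<^bsub>PR\<^esub> a \<in> range Const" "a \<otimes>\<^bsub>PR\<^esub> b \<in> range Const" "a \<oplus>\<^bsub>PR\<^esub> b \<in> range Const"
      by (simp_all flip: Const_uminus Const_mult Const_add)
  qed simp
  show ?thesis
  proof (rule subfieldI)
    show "subcring (range Const) (PR :: 'k poly3 ring)"
      using sr by (rule subcringI) (simp add: mult.commute)
    have *: "Const c \<in> Units (PR\<lparr>carrier := range Const\<rparr>) \<longleftrightarrow> c \<noteq> 0" for c :: 'k
    proof
      show "c \<noteq> 0" if "Const c \<in> Units (PR\<lparr>carrier := range Const\<rparr>)"
        using that by (auto simp: Units_def)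
      show "Const c \<in> Units (PR\<lparr>carrier := range Const\<rparr>)" if "c \<noteq> 0"
        using Const_inverse[OF that]
        by (auto simp: Units_def mult.commute intro!: bexI[of _ "Const (inverse c)"])
    qed
    have "Units (PR\<lparr>carrier := range Const\<rparr>) \<subseteq> range (Const :: 'k \<Rightarrow> _)"
      by (auto simp: Units_def)
    then show "Units (PR\<lparr>carrier := range Const\<rparr>) = range (Const :: 'k \<Rightarrow> _) - {\<zero>\<^bsub>PR\<^esub>}"
      using * *[of 0] by auto
  qed
qed

text \<open>The dimension is taken in the quotient ring over the image of \<open>k\<close>, which is
  a field there because \<open>1 \<notin> I\<close>. A basis of \<open>I \<inter> forms t\<close> is
  extended to one of \<open>forms t\<close>, and the added vectors map to a basis of the
  image.\<close>

lemma hilbert_function_eq: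
  fixes I :: "'k::field poly3 set"
  assumes I: "ideal I PR" and one: "1 \<notin> I"
  shows "hilbert_function I t = lin.dim (forms t :: 'k poly3 set) - lin.dim (I \<inter> forms t)"
proof -
  interpret ideal I PR by (rule I)
  interpret Q: ring_hom_ring PR "PR Quot I" "(+>\<^bsub>PR\<^esub>) I" by (rule rcos_ring_hom_ring)
  let ?\<pi> = "(+>\<^bsub>PR\<^esub>) I"
  let ?K = "range (\<lambda>c. I +>\<^bsub>PR\<^esub> Const c)"
  have K: "?K = ?\<pi> ` range Const" by auto
  have eq: "?\<pi> x = ?\<pi> y \<longleftrightarrow> x - y \<in> I" for x y
    using ring.quotient_eq_iff_same_a_r_cos[OF ring_PR I, of x y] by simp
  have sfK: "subfield ?K (PR Quot I)"
    unfolding K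
  proof (rule Q.img_is_subfield(2)[OF subfield_Const])
    show "\<one>\<^bsub>PR Quot I\<^esub> \<noteq> \<zero>\<^bsub>PR Quot I\<^esub>"
      using eq[of 1 0] one Q.hom_one Q.hom_zero by auto
  qed
  have sI: "lin.subspace (I \<inter> forms t)"
    using subspace_ideal[OF I] subspace_forms by (rule lin.subspace_inter)
  have fI: "lin.fin_dim (I \<inter> forms t)"
    using lin.fin_dim_subset[OF fin_dim_forms] by blast
  obtain A where A: "A \<subseteq> I \<inter> forms t" "finite A" "lin.independent A" "lin.span A = I \<inter> forms t"
      "card A = lin.dim (I \<inter> forms t)"
    using lin.fin_dim_basis_extend[OF fI sI lin.independent_empty empty_subsetI] by metis
  obtain B :: "'k poly3 set" where B: "A \<subseteq> B" "B \<subseteq> forms t" "finite B" "lin.independent B" "lin.span B = forms t"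
      "card B = lin.dim (forms t :: 'k poly3 set)"
    using lin.fin_dim_basis_extend[OF fin_dim_forms subspace_forms A(3) A(1)[THEN order_trans, OF Int_lower2]] .
  \<comment> \<open>One basis vector at a time, to match the inductive definition of
    \<open>dimension\<close> by line extensions.\<close>
  have main: "Q.S.dimension (card S) ?K (?\<pi> ` lin.span S)" if "finite S" "S \<subseteq> B - A" for S
    using that
  proof (induction S rule: finite_induct)
    case empty
    have "?\<pi> ` lin.span {} = {\<zero>\<^bsub>PR Quot I\<^esub>}" using Q.hom_zero by simp
    then show ?case by (simp only: card.empty Q.S.dimension.zero_dim)
  next
    case (insert s S)
    have "?\<pi> s \<notin> ?\<pi> ` lin.span S"
    proof
      assume "?\<pi> s \<in> ?\<pi> ` lin.span S"
      then obtain v where v: "v \<in> lin.span S" "s - v \<in> I" using eq by auto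
      have "lin.span S \<subseteq> forms t" using insert.prems B(5) lin.span_mono[of S B] by auto
      then have "s - v \<in> I \<inter> forms t" using v insert.prems B(2) by (auto intro!: form_diff)
      then have "s - v \<in> lin.span A" using A(4) by simp
      then have "(s - v) + v \<in> lin.span (A \<union> S)" unfolding lin.span_Un using v(1) by blast
      moreover have "lin.span (A \<union> S) \<subseteq> lin.span (B - {s})"
        using insert B(1) by (intro lin.span_mono) auto
      ultimately show False using B(4) insert.prems unfolding lin.dependent_def by auto
    qed
    then have "Q.S.dimension (Suc (card S)) ?K (Q.S.line_extension ?K (?\<pi> s) (?\<pi> ` lin.span S))"
      using insert by (intro Q.S.dimension.Suc_dim) auto
    also have "Q.S.line_extension ?K (?\<pi> s) (?\<pi> ` lin.span S) = ?\<pi> ` line_extension (range Const) s (lin.span S)"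
      unfolding K by (intro Q.line_extension_hom) auto
    also have "line_extension (range Const) s (lin.span S) = lin.span (insert s S)"
    proof (rule Set.set_eqI)
      fix x
      have "x \<in> line_extension (range Const) s (lin.span S) \<longleftrightarrow> (\<exists>c. \<exists>v\<in>lin.span S. x = Const c * s + v)"
        by (simp add: line_extension_mem_iff)
      also have "\<dots> \<longleftrightarrow> x \<in> lin.span (insert s S)"
      proof -
        have "x = Const c * s + v \<longleftrightarrow> v = x - Const c * s" for c v by (auto simp: algebra_simps)
        then show ?thesis unfolding lin.span_breakdown_eq by simp
      qed
      finally show "x \<in> line_extension (range Const) s (lin.span S) \<longleftrightarrow> x \<in> lin.span (insert s S)" .
    qed
    finally show ?case using insert by simp
  qed
  have "?\<pi> ` lin.span (B - A) = ?\<pi> ` forms t"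
  proof
    show "?\<pi> ` lin.span (B - A) \<subseteq> ?\<pi> ` forms t" using B(5) lin.span_mono[of "B - A" B] by auto
    show "?\<pi> ` forms t \<subseteq> ?\<pi> ` lin.span (B - A)"
    proof
      fix y assume "y \<in> ?\<pi> ` forms t"
      then obtain x where x: "y = ?\<pi> x" "x \<in> lin.span (A \<union> (B - A))"
        using B(1,5) by (metis Un_Diff_cancel imageE sup.absorb2)
      then obtain a b where ab: "x = a + b" "a \<in> lin.span A" "b \<in> lin.span (B - A)"
        unfolding lin.span_Un by blast
      then have "?\<pi> x = ?\<pi> b" using A(4) by (auto simp: eq)
      then show "y \<in> ?\<pi> ` lin.span (B - A)" using x ab by auto
    qed
  qed
  then have "Q.S.dimension (card (B - A)) ?K (?\<pi> ` forms t)" using main[of "B - A"] B(3) by simp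
  then have "Q.S.dim ?K (?\<pi> ` forms t) = card (B - A)"
    using Q.S.dimI[OF sfK] by (simp add: over_def)
  also have "card (B - A) = card B - card A" using A(2) B(1) by (intro card_Diff_subset)
  finally show ?thesis using A(5) B(6) by (simp add: hilbert_function_def forms_def)
qed

section \<open>Evaluation and linear substitutions\<close>

interpretation ev: scalar_hom "\<lambda>c::'k::field. c"
  by unfold_locales simp_all

lemma eval3_subst: "eval3 F v = subst (\<lambda>c. c) (\<lambda>i. v $ i) F"
  by (simp add: eval3_def subst_def)

lemma eval3_simps [simp]:
  fixes F G :: "'k::field poly3"
  shows "eval3 0 v = (0::'k)" "eval3 1 v = (1::'k)" "eval3 (Const c) v = (c::'k)" "eval3 (Var i) v = v $ i"
    "eval3 (F + G) v = eval3 F v + eval3 G v" "eval3 (F - G) v = eval3 F v - eval3 G v"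
    "eval3 (- F) v = - eval3 F v"
    "eval3 (F * G) v = eval3 F v * eval3 G v" "eval3 (F ^ n) v = eval3 F v ^ n"
  unfolding eval3_subst
  by (rule ev.subst_0 ev.subst_1 ev.subst_Const ev.subst_Var ev.subst_add ev.subst_diff ev.subst_uminus
      ev.subst_mult ev.subst_power)+

lemma eval3_prod: "eval3 (prod f A) v = (\<Prod>a\<in>A. eval3 (f a :: 'k::field poly3) v)"
  unfolding eval3_subst by (rule ev.subst_prod)

lemma eval3_dvd_0: "D dvd (F :: 'k::field poly3) \<Longrightarrow> eval3 D v = 0 \<Longrightarrow> eval3 F v = 0"
  by auto

lemma form_subst_linear:
  fixes \<sigma> :: "3 \<Rightarrow> 'k::field poly3"
  assumes "form t G" "\<And>i. form 1 (\<sigma> i)" shows "form t (subst Const \<sigma> G)"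
  unfolding subst_def
proof (rule form_sum)
  fix e assume "e \<in> Poly_Mapping.keys G"
  then have "mdeg e = t" using assms(1) by (simp add: form_iff_mdeg)
  moreover have "form (\<Sum>i\<in>UNIV. Poly_Mapping.lookup e i * 1) (\<Prod>i\<in>UNIV. \<sigma> i ^ Poly_Mapping.lookup e i)"
    using form_power[OF assms(2)] by (intro form_prod) blast
  ultimately show "form t (Const (Poly_Mapping.lookup G e) * (\<Prod>i\<in>UNIV. \<sigma> i ^ Poly_Mapping.lookup e i))"
    by (intro form_Const_mult) (simp add: mdeg_def)
qed

interpretation cst: scalar_hom "Const :: 'k::field \<Rightarrow> 'k poly3"
  by unfold_locales (simp_all add: Const_add Const_mult)

subsection \<open>Partial derivatives\<close>

lemma partial_deriv_superset:
  fixes F :: "'k::field poly3"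
  assumes "finite S" "Poly_Mapping.keys F \<subseteq> S"
  shows "partial_deriv i F = (\<Sum>e\<in>S. Poly_Mapping.single (e - Poly_Mapping.single i 1)
                    (of_nat (Poly_Mapping.lookup e i) * Poly_Mapping.lookup F e))"
  unfolding partial_deriv_def using assms
  by (intro sum.mono_neutral_left) (auto simp: in_keys_iff)

lemma partial_deriv_add: "partial_deriv i (F + G :: 'k::field poly3) = partial_deriv i F + partial_deriv i G"
proof -
  let ?S = "Poly_Mapping.keys F \<union> Poly_Mapping.keys G"
  have "finite ?S" "Poly_Mapping.keys (F + G) \<subseteq> ?S"
    using Poly_Mapping.keys_add[of F G] by auto
  then show ?thesis
    by (simp add: partial_deriv_superset[of ?S] lookup_add single_add sum.distrib distrib_left)
qed

lemma partial_deriv_single: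
  "partial_deriv i (Poly_Mapping.single e (c::'k::field)) =
     Poly_Mapping.single (e - Poly_Mapping.single i 1) (of_nat (Poly_Mapping.lookup e i) * c)"
  by (subst partial_deriv_superset[of "{e}"]) auto

lemma partial_deriv_0: "partial_deriv i (0 :: 'k::field poly3) = 0"
  by (simp add: partial_deriv_def)

lemma partial_deriv_sum: "partial_deriv i (sum f A) = (\<Sum>a\<in>A. partial_deriv i (f a :: 'k::field poly3))"
  by (induction A rule: infinite_finite_induct) (auto simp: partial_deriv_0 partial_deriv_add)

lemma partial_deriv_mult_single:
  fixes c c' :: "'k::field"
  shows "partial_deriv i (Poly_Mapping.single e c * Poly_Mapping.single e' c') =
    partial_deriv i (Poly_Mapping.single e c) * Poly_Mapping.single e' c' +
    Poly_Mapping.single e c * partial_deriv i (Poly_Mapping.single e' c')"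
proof -
  let ?x = "Poly_Mapping.single i (1::nat)"
  \<comment> \<open>Subtraction of exponents is truncated. Where the exponent of the variable is
    \<open>0\<close>, the factor \<open>of_nat 0\<close> removes the term, so only the other case
    has to be shifted.\<close>
  have shift: "a - ?x + b = a + b - ?x" if "Poly_Mapping.lookup a i \<noteq> 0" for a b :: "3 \<Rightarrow>\<^sub>0 nat"
    using that by (intro poly_mapping_eqI) (auto simp: lookup_add lookup_minus lookup_single when_def)
  have 1: "Poly_Mapping.single (e - ?x + e') (of_nat (Poly_Mapping.lookup e i) * c * c') =
      Poly_Mapping.single (e + e' - ?x) (of_nat (Poly_Mapping.lookup e i) * c * c')"
  proof (cases "Poly_Mapping.lookup e i = 0")
    case False show ?thesis unfolding shift[OF False] ..
  qed simp
  have 2: "Poly_Mapping.single (e + (e' - ?x)) (c * (of_nat (Poly_Mapping.lookup e' i) * c')) =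
      Poly_Mapping.single (e + e' - ?x) (c * (of_nat (Poly_Mapping.lookup e' i) * c'))"
  proof (cases "Poly_Mapping.lookup e' i = 0")
    case False
    show ?thesis unfolding add.commute[of e "e' - ?x"] add.commute[of e e'] shift[OF False] ..
  qed simp
  show ?thesis
    unfolding mult_single partial_deriv_single 1 2
    by (simp add: lookup_add algebra_simps flip: single_add)
qed

lemma partial_deriv_mult:
  fixes F G :: "'k::field poly3"
  shows "partial_deriv i (F * G) = partial_deriv i F * G + F * partial_deriv i G"
proof -
  let ?s = "\<lambda>F e. Poly_Mapping.single e (Poly_Mapping.lookup F e) :: 'k poly3"
  let ?F = "\<Sum>e\<in>Poly_Mapping.keys F. ?s F e" and ?G = "\<Sum>e\<in>Poly_Mapping.keys G. ?s G e"
  have "partial_deriv i (?F * ?G) = partial_deriv i ?F * ?G + ?F * partial_deriv i ?G"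
    by (simp only: sum_product partial_deriv_sum partial_deriv_mult_single sum.distrib)
  then show ?thesis using poly3_expand[of F] poly3_expand[of G] by simp
qed

subsection \<open>Coordinates at a point\<close>

definition piv :: "'k::field ^ 3 \<Rightarrow> 3" where
  "piv p = (SOME k. p $ k \<noteq> 0)"

text \<open>A linear form with value \<open>1\<close> at a nonzero vector \<open>p\<close>. With it
  \<open>x_i = p_i h + LL p i\<close>, so \<open>h\<close> and the two forms \<open>LL p i\<close>
  with \<open>i \<noteq> piv p\<close> are linear coordinates adapted to the point.\<close>

definition hh :: "'k::field ^ 3 \<Rightarrow> 'k poly3" where
  "hh p = Const (inverse (p $ piv p)) * Var (piv p)"

definition LL :: "'k::field ^ 3 \<Rightarrow> 3 \<Rightarrow> 'k poly3" where
  "LL p i = Var i - Const (p $ i) * hh p"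

lemma piv: assumes "p \<noteq> 0" shows "p $ piv p \<noteq> 0"
  unfolding piv_def
proof (rule someI_ex, rule ccontr)
  assume "\<nexists>k. p $ k \<noteq> 0"
  then have "p = 0" by (simp add: Finite_Cartesian_Product.vec_eq_iff)
  with assms show False ..
qed

lemma form_hh: "form 1 (hh p)"
  unfolding hh_def by (intro form_Const_mult form_Var)

lemma form_LL: "form 1 (LL p i)"
  unfolding LL_def by (intro form_diff form_Const_mult form_hh form_Var)

lemma eval_hh: "p \<noteq> 0 \<Longrightarrow> eval3 (hh p) p = 1"
  using piv[of p] by (simp add: hh_def)

lemma eval_LL: "p \<noteq> 0 \<Longrightarrow> eval3 (LL p i) p = 0"
  by (simp add: LL_def eval_hh)

lemma LL_piv: "p \<noteq> 0 \<Longrightarrow> LL p (piv p) = 0"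
  using Const_inverse[OF piv[of p]] by (simp add: LL_def hh_def flip: mult.assoc)

text \<open>The identity \<open>x_i = p_i h + LL p i\<close> is deformed to
  \<open>p_i h + s LL p i\<close>. The coefficient of \<open>s ^ j\<close> is the part of order
  \<open>j\<close> at the point, so multiplicity at \<open>p\<close> becomes order at
  \<open>s = 0\<close> over a domain, where orders are additive.\<close>

definition theta :: "'k::field ^ 3 \<Rightarrow> 'k poly3 \<Rightarrow> 'k poly3 poly" where
  "theta p = subst (\<lambda>c. [:Const c:]) (\<lambda>i. [:Const (p $ i) * hh p, LL p i:])"

lemma theta_simps:
  "theta p 0 = 0" "theta p 1 = 1" "theta p (F + G) = theta p F + theta p G" "theta p (F - G) = theta p F - theta p G"
  "theta p (F * G) = theta p F * theta p G" "theta p (F ^ n) = theta p F ^ n" "theta p (Const c) = [:Const c:]"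
  "theta p (Var i) = [:Const (p $ i) * hh p, LL p i:]"
  by (simp_all add: theta_def homg.subst_0 homg.subst_1 homg.subst_add homg.subst_diff homg.subst_mult
      homg.subst_power homg.subst_Const homg.subst_Var)

lemma theta_hh: "p \<noteq> 0 \<Longrightarrow> theta p (hh p) = [:hh p:]"
  using LL_piv[of p] Const_inverse[OF piv[of p]]
  by (simp add: hh_def[of p] theta_simps flip: mult.assoc)

lemma theta_LL: "p \<noteq> 0 \<Longrightarrow> theta p (LL p i) = [:0, LL p i:]"
  by (simp add: LL_def[of p i] theta_simps theta_hh)

lemma theta_1: "poly (theta p G) 1 = G"
proof (induction G rule: poly3_induct)
qed (auto simp: theta_simps LL_def)

lemma coeff_theta_0: "coeff (theta p G) 0 = subst Const (\<lambda>i. Const (p $ i) * hh p) G"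
  by (induction G rule: poly3_induct)
     (auto simp: theta_simps cst.subst_Const cst.subst_Var cst.subst_add cst.subst_mult coeff_mult)

lemma Const_power: "Const (c ^ n :: 'k::field) = Const c ^ n"
  by (induction n) (simp_all add: Const_mult)

lemma Const_prod: "Const (prod f A :: 'k::field) = (\<Prod>a\<in>A. Const (f a))"
  by (induction A rule: infinite_finite_induct) (simp_all add: Const_mult)

lemma Const_sum: "Const (sum f A :: 'k::field) = (\<Sum>a\<in>A. Const (f a))"
  by (induction A rule: infinite_finite_induct) (simp_all add: Const_add)

text \<open>At \<open>s = 0\<close> every variable becomes \<open>p_i h\<close>, and homogeneity
  takes out the factor \<open>h ^ d\<close>.\<close>

lemma coeff_theta_0_form:
  assumes "form d G" shows "coeff (theta p G) 0 = Const (eval3 G p) * hh p ^ d"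
proof -
  have "coeff (theta p G) 0 = (\<Sum>e\<in>Poly_Mapping.keys G. Const (Poly_Mapping.lookup G e) *
      ((\<Prod>i\<in>UNIV. Const (p $ i) ^ Poly_Mapping.lookup e i) * hh p ^ mdeg e))"
    unfolding coeff_theta_0 subst_def mdeg_def
    by (simp add: power_mult_distrib prod.distrib power_sum)
  also have "\<dots> = (\<Sum>e\<in>Poly_Mapping.keys G. Const (Poly_Mapping.lookup G e) *
      ((\<Prod>i\<in>UNIV. Const (p $ i) ^ Poly_Mapping.lookup e i) * hh p ^ d))"
    using assms by (intro sum.cong refl) (simp add: form_iff_mdeg)
  also have "\<dots> = Const (eval3 G p) * hh p ^ d"
    by (simp add: eval3_def Const_sum Const_prod Const_mult Const_power sum_distrib_right mult.assoc)
  finally show ?thesis .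
qed

lemma hh_nonzero: "p \<noteq> 0 \<Longrightarrow> hh p \<noteq> 0"
  using eval_hh[of p] by auto

subsection \<open>Powers of the ideal of a point\<close>

definition ipow :: "'k::field ^ 3 \<Rightarrow> nat \<Rightarrow> 'k poly3 set" where
  "ipow p m = point_ideal p [^]\<^bsub>ideals_set PR\<^esub> m"

lemma fat_ideal_ipow: "fat_ideal p n m = (\<Inter>i\<in>{1..n}. ipow (p i) m)"
  by (simp add: fat_ideal_def ipow_def)

interpretation PRr: cring "PR :: 'k::field poly3 ring"
  by (rule cring_PR)

lemma ideal_point_ideal: "ideal (point_ideal p) PR"
  unfolding point_ideal_def by (rule PRr.genideal_ideal) simp

lemma monoid_ideals: "Group.monoid (ideals_set (PR :: 'k::field poly3 ring))"
  using PRr.ideals_set_is_comm_monoid by (rule comm_monoid.axioms)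

lemma ipow_0: "ipow p 0 = UNIV"
  by (simp add: ipow_def nat_pow_def ideals_set_def)

lemma ipow_Suc: "ipow p (Suc m) = ideal_prod PR (ipow p m) (point_ideal p)"
  by (simp add: ipow_def nat_pow_def ideals_set_def)

lemma ideal_ipow: "ideal (ipow p m) PR"
proof (induction m)
  case 0 then show ?case using PRr.oneideal by (simp add: ipow_0)
next
  case (Suc m) then show ?case
    unfolding ipow_Suc using ideal_point_ideal by (rule PRr.ideal_prod_is_ideal)
qed

lemma ipow_add: "ipow p (i + j) = ideal_prod PR (ipow p i) (ipow p j)"
proof -
  have "point_ideal p \<in> carrier (ideals_set PR)"
    using ideal_point_ideal by (simp add: ideals_set_def)
  from Group.monoid.nat_pow_mult[OF monoid_ideals this, of i j] show ?thesis
    by (simp add: ipow_def ideals_set_def)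
qed

lemma ipow_antimono: "i \<le> j \<Longrightarrow> ipow p j \<subseteq> ipow p i"
  using PRr.ideal_prod_inter[OF ideal_ipow[of p i] ideal_ipow[of p "j - i"]] ipow_add[of p i "j - i"]
  by auto

lemma ipow_mult: "a \<in> ipow p i \<Longrightarrow> b \<in> ipow p j \<Longrightarrow> a * b \<in> ipow p (i + j)"
  unfolding ipow_add using ideal_prod.prod[of a "ipow p i" b "ipow p j" PR] by simp

lemma ideal_PR_sum: "ideal I (PR :: 'k::field poly3 ring) \<Longrightarrow> (\<And>a. a \<in> A \<Longrightarrow> f a \<in> I) \<Longrightarrow> sum f A \<in> I"
  by (induction A rule: infinite_finite_induct) (auto simp: ideal_PR_iff)

lemma point_ideal_form: "form d G \<Longrightarrow> eval3 G p = 0 \<Longrightarrow> G \<in> point_ideal p"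
  unfolding point_ideal_def using PRr.genideal_self[of "{G. (\<exists>d. form d G) \<and> eval3 G p = 0}"] by auto

lemma ipow_1: "ipow p 1 = point_ideal p"
  using ipow_Suc[of p 0] PRr.ideal_prod_one[OF ideal_point_ideal[of p]]
    PRr.ideal_prod_commute[OF ideal_point_ideal[of p] PRr.oneideal]
  by (simp add: ipow_0)

text \<open>A factor \<open>s\<close> appears only together with some \<open>LL p i\<close>, and
  these lie in the ideal of the point.\<close>

lemma coeff_theta_ipow: "p \<noteq> 0 \<Longrightarrow> coeff (theta p G) j \<in> ipow p j"
proof (induction G arbitrary: j rule: poly3_induct)
  case (Const c)
  then show ?case using ideal_ipow[of p j] by (cases j) (auto simp: theta_simps ipow_0 ideal_PR_iff)
next
  case (Var i)
  have 1: "LL p i \<in> ipow p 1" unfolding ipow_1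
    using form_LL eval_LL[OF Var] by (rule point_ideal_form)
  show ?case
  proof (cases j)
    case (Suc j')
    then show ?thesis using 1 ideal_ipow[of p j]
      by (cases j') (auto simp: theta_simps ideal_PR_iff)
  qed (simp add: ipow_0)
next
  case (add F G)
  then show ?case using ideal_ipow[of p j] by (simp add: theta_simps ideal_PR_iff)
next
  case (mult F G)
  have "coeff (theta p F) i * coeff (theta p G) (j - i) \<in> ipow p j" if "i \<le> j" for i
    using ipow_mult[OF mult.IH(1)[OF mult.prems, of i] mult.IH(2)[OF mult.prems, of "j - i"]] that by simp
  then show ?case unfolding theta_simps coeff_mult by (intro ideal_PR_sum[OF ideal_ipow]) simp
qed

text \<open>Powers of the ideal are the order filtration. At \<open>s = 1\<close> a polynomial is
  the sum of its \<open>theta\<close> coefficients, which gives one inclusion; for the other, the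
  generators have zero constant coefficient and powers of \<open>s\<close> multiply.\<close>

lemma ipow_eq:
  assumes "p \<noteq> 0" shows "ipow p m = {G. monom 1 m dvd theta p G}"
proof
  show "{G. monom 1 m dvd theta p G} \<subseteq> ipow p m"
  proof
    fix G assume "G \<in> {G. monom 1 m dvd theta p G}"
    then have z: "coeff (theta p G) j = 0" if "j < m" for j
      using that by (auto simp: monom_1_dvd_iff')
    have "G = (\<Sum>j\<le>degree (theta p G). coeff (theta p G) j)"
      using theta_1[of p G] by (simp add: poly_altdef)
    also have "\<dots> \<in> ipow p m"
    proof (rule ideal_PR_sum[OF ideal_ipow])
      fix j show "coeff (theta p G) j \<in> ipow p m"
      proof (cases "j < m")
        case True then show ?thesis using z[of j] ideal_ipow[of p m] by (auto simp: ideal_PR_iff)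
      next
        case False
        then show ?thesis using coeff_theta_ipow[OF assms] ipow_antimono[of m j p] by fastforce
      qed
    qed
    finally show "G \<in> ipow p m" .
  qed
  show "ipow p m \<subseteq> {G. monom 1 m dvd theta p G}"
  proof (induction m)
    case 0
    then show ?case by simp
  next
    case (Suc m)
    have N: "ideal {G. monom 1 k dvd theta p G} PR" for k
      unfolding ideal_PR_iff by (auto simp: theta_simps)
    have 1: "point_ideal p \<subseteq> {G. monom 1 1 dvd theta p G}"
      unfolding point_ideal_def
    proof (rule PRr.genideal_minimal[OF N], rule subsetI)
      fix G assume "G \<in> {G. (\<exists>d. form d G) \<and> eval3 G p = 0}"
      then obtain d where "form d G" "eval3 G p = 0" by blast
      then have "coeff (theta p G) 0 = 0" by (simp add: coeff_theta_0_form)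
      then show "G \<in> {G. monom 1 1 dvd theta p G}" by (simp add: monom_1_dvd_iff')
    qed
    show ?case
    proof
      fix G assume "G \<in> ipow p (Suc m)"
      then show "G \<in> {G. monom 1 (Suc m) dvd theta p G}"
        unfolding ipow_Suc
      proof (induction rule: ideal_prod.induct)
        case (prod a b)
        then have "monom 1 m * monom 1 1 dvd theta p a * theta p b"
          using Suc.IH 1 by (intro mult_dvd_mono) auto
        then show ?case by (simp add: theta_simps mult_monom)
      next
        case (sum a b)
        then show ?case by (simp add: theta_simps)
      qed
    qed
  qed
qed

lemma point_ideal_form_iff:
  assumes "p \<noteq> 0" "form d G" shows "G \<in> point_ideal p \<longleftrightarrow> eval3 G p = 0"
  using coeff_theta_0_form[OF assms(2), of p] hh_nonzero[OF assms(1)]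
  unfolding ipow_1[symmetric] ipow_eq[OF assms(1)] by (simp add: monom_1_dvd_iff')

lemma one_notin_ipow: "p \<noteq> 0 \<Longrightarrow> m > 0 \<Longrightarrow> 1 \<notin> ipow p m"
  by (auto simp: ipow_eq theta_simps monom_1_dvd_iff')

section \<open>The number of conditions imposed by a fat point\<close>

lemma other_coordinates:
  obtains i j :: 3 where "i \<noteq> j" "i \<noteq> k" "j \<noteq> k" "UNIV = {k, i, j}"
proof -
  have ne: "(1::3) \<noteq> 2" "(2::3) \<noteq> 1" "(1::3) \<noteq> 3" "(3::3) \<noteq> 1" "(2::3) \<noteq> 3" "(3::3) \<noteq> 2" by simp_all
  consider "k = 1" | "k = 2" | "k = 3" using exhaust_3[of k] by blast
  then show ?thesis
  proof cases
    case 1 then show ?thesis using that[of 2 3] UNIV_3 ne by simp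
  next
    case 2 then show ?thesis using that[of 1 3] UNIV_3 ne by (simp add: insert_commute)
  next
    case 3 then show ?thesis using that[of 1 2] UNIV_3 ne by (simp add: insert_commute)
  qed
qed

definition local_var :: "'k::field ^ 3 \<Rightarrow> 3 \<Rightarrow> 'k poly3" where
  "local_var p l = (if l = piv p then hh p else LL p l)"

text \<open>Rewrites a polynomial in the adapted coordinates; substituting \<open>local_var\<close>
  undoes it.\<close>

definition to_local :: "'k::field ^ 3 \<Rightarrow> 'k poly3 \<Rightarrow> 'k poly3" where
  "to_local p = subst Const (\<lambda>l. Const (p $ l) * Var (piv p) + (if l = piv p then 0 else Var l))"

lemma subst_to_local:
  assumes "p \<noteq> 0" shows "subst Const (local_var p) (to_local p G) = G"
proof (induction G rule: poly3_induct)
  case (Var i)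
  have "Const (p $ piv p) * hh p = Var (piv p)"
    using Const_inverse[OF piv[OF assms]] by (simp add: hh_def flip: mult.assoc)
  then show ?case
    by (auto simp: to_local_def cst.subst_Var cst.subst_add cst.subst_mult cst.subst_Const cst.subst_0 local_var_def LL_def)
qed (simp_all add: to_local_def cst.subst_Const cst.subst_add cst.subst_mult)

lemma form_to_local: "form t G \<Longrightarrow> form t (to_local p G)"
  unfolding to_local_def
  by (rule form_subst_linear) (auto intro!: form_add form_Const_mult simp flip: One_nat_def)

lemma form_local_var: "form 1 (local_var p l)"
  by (simp add: local_var_def form_hh form_LL del: One_nat_def)

lemma theta_local_monomial:
  assumes "p \<noteq> 0"
  shows "theta p (\<Prod>l\<in>UNIV. local_var p l ^ f l) = monom (\<Prod>l\<in>UNIV. local_var p l ^ f l) (\<Sum>l\<in>UNIV - {piv p}. f l)"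
proof -
  have *: "theta p (local_var p l ^ n) = monom (local_var p l ^ n) (if l = piv p then 0 else n)" for l n
    using theta_hh[OF assms] theta_LL[OF assms, of l]
    by (auto simp: theta_simps local_var_def monom_power simp flip: monom_0 monom_Suc[of _ 0])
  have "theta p (\<Prod>l\<in>A. local_var p l ^ f l) = monom (\<Prod>l\<in>A. local_var p l ^ f l) (\<Sum>l\<in>A. if l = piv p then 0 else f l)"
    if "finite A" for A
    using that by (induction A rule: finite_induct) (auto simp: theta_simps(2,5) * mult_monom)
  from this[of UNIV] show ?thesis
    by (simp add: sum.If_cases Diff_eq)
qed

text \<open>In fixed total degree the pivot exponent is determined by the other two, so it is enough
  to count pairs with sum below \<open>m\<close>.\<close>

lemma card_local_exponents:
  "card {e :: 3 \<Rightarrow>\<^sub>0 nat. mdeg e = t \<and> (\<Sum>l\<in>UNIV - {k}. Poly_Mapping.lookup e l) < m} \<le> (m + 1) choose 2"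
proof -
  obtain i j where ij: "i \<noteq> j" "i \<noteq> k" "j \<noteq> k" "UNIV = {k, i, j}" using other_coordinates[of k] .
  then have U: "UNIV - {k} = {i, j}" by auto
  let ?S = "{e :: 3 \<Rightarrow>\<^sub>0 nat. mdeg e = t \<and> (\<Sum>l\<in>UNIV - {k}. Poly_Mapping.lookup e l) < m}"
  let ?f = "\<lambda>e :: 3 \<Rightarrow>\<^sub>0 nat. (Poly_Mapping.lookup e i, Poly_Mapping.lookup e j)"
  have deg: "mdeg e = Poly_Mapping.lookup e k + Poly_Mapping.lookup e i + Poly_Mapping.lookup e j" for e
    unfolding mdeg_def by (subst ij(4)) (use ij(1-3) in auto)
  have "inj_on ?f ?S"
  proof (rule inj_onI)
    fix e e' assume "e \<in> ?S" "e' \<in> ?S" "?f e = ?f e'"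
    then have "Poly_Mapping.lookup e l = Poly_Mapping.lookup e' l" if "l \<in> {k, i, j}" for l
      using that by (auto simp: deg)
    then show "e = e'" using ij(4) by (intro poly_mapping_eqI) blast
  qed
  moreover have "?f ` ?S \<subseteq> (SIGMA a:{..<m}. {..<m - a})"
    using ij(1) by (auto simp: U)
  ultimately have "card ?S \<le> card (SIGMA a:{..<m}. {..<m - a})"
    by (intro card_inj_on_le) auto
  also have "\<dots> = (\<Sum>a<m. Suc (m - Suc a))" by (auto intro!: sum.cong)
  also have "\<dots> = (\<Sum>a<m. Suc a)" by (rule sum.nat_diff_reindex[of Suc m])
  also have "\<dots> = (m + 1) choose 2" by (induction m) (auto simp: numeral_2_eq_2)
  finally show ?thesis .
qed

text \<open>In adapted coordinates a monomial of local degree at least \<open>m\<close> lies in the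
  \<open>m\<close>-th power, and at most \<open>(m + 1) choose 2\<close> monomials of degree
  \<open>t\<close> have smaller local degree.\<close>

lemma dim_forms_le_ipow:
  fixes p :: "'k::field ^ 3"
  assumes "p \<noteq> 0"
  shows "lin.dim (forms t :: 'k poly3 set) \<le> lin.dim (ipow p m \<inter> forms t) + ((m + 1) choose 2)"
proof -
  let ?c = "\<lambda>e. \<Sum>l\<in>UNIV - {piv p}. Poly_Mapping.lookup e l"
  let ?X = "\<lambda>e. \<Prod>l\<in>UNIV. local_var p l ^ Poly_Mapping.lookup e l"
  let ?S = "{e. mdeg e = t \<and> ?c e < m}"
  have fin: "finite ?S" using finite_exponents[of t] by (rule rev_finite_subset) auto
  have formX: "form (mdeg e) (?X e)" for e
  proof -
    have "form (\<Sum>l\<in>UNIV. Poly_Mapping.lookup e l * 1) (?X e)"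
      using form_power[OF form_local_var] by (intro form_prod) blast
    then show ?thesis by (simp add: mdeg_def)
  qed
  have "forms t \<subseteq> {x + y |x y. x \<in> ipow p m \<inter> forms t \<and> y \<in> lin.span (?X ` ?S)}"
  proof
    fix G :: "'k poly3" assume G: "G \<in> forms t"
    let ?H = "to_local p G" and ?K = "Poly_Mapping.keys (to_local p G)"
    have H: "mdeg e = t" if "e \<in> ?K" for e
      using form_to_local[of t G p] G that by (auto simp: form_iff_mdeg)
    let ?term = "\<lambda>e. Const (Poly_Mapping.lookup ?H e) * ?X e"
    have "G = (\<Sum>e\<in>?K. ?term e)"
      using subst_to_local[OF assms, of G] by (simp add: subst_def)
    also have "\<dots> = (\<Sum>e\<in>{e\<in>?K. \<not> ?c e < m}. ?term e) + (\<Sum>e\<in>{e\<in>?K. ?c e < m}. ?term e)"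
      by (subst sum.union_disjoint[symmetric]) (auto intro: sum.cong)
    finally have eq: "G = (\<Sum>e\<in>{e\<in>?K. \<not> ?c e < m}. ?term e) + (\<Sum>e\<in>{e\<in>?K. ?c e < m}. ?term e)" .
    have "(\<Sum>e\<in>{e\<in>?K. \<not> ?c e < m}. ?term e) \<in> ipow p m"
    proof (rule ideal_PR_sum[OF ideal_ipow])
      fix e assume "e \<in> {e\<in>?K. \<not> ?c e < m}"
      then have "monom 1 m dvd theta p (?X e)"
        unfolding theta_local_monomial[OF assms] by (auto simp: monom_1_dvd_iff')
      then show "?term e \<in> ipow p m" using assms by (simp add: ipow_eq theta_simps(5,7) dvd_smult)
    qed
    moreover have "(\<Sum>e\<in>{e\<in>?K. \<not> ?c e < m}. ?term e) \<in> forms t"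
      using H formX by (auto intro!: form_sum form_Const_mult)
    moreover have "(\<Sum>e\<in>{e\<in>?K. ?c e < m}. ?term e) \<in> lin.span (?X ` ?S)"
      using H by (intro lin.span_sum lin.span_scale lin.span_base) auto
    ultimately show "G \<in> {x + y |x y. x \<in> ipow p m \<inter> forms t \<and> y \<in> lin.span (?X ` ?S)}"
      using eq by blast
  qed
  moreover have f: "lin.fin_dim (ipow p m \<inter> forms t)" "lin.fin_dim (lin.span (?X ` ?S))"
    using lin.fin_dim_subset[OF fin_dim_forms] fin unfolding lin.fin_dim_def by (blast, blast)
  ultimately have "lin.dim (forms t :: 'k poly3 set) \<le>
      lin.dim {x + y |x y. x \<in> ipow p m \<inter> forms t \<and> y \<in> lin.span (?X ` ?S)}"
    by (intro lin.fin_dim_mono lin.fin_dim_sums)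
  also have "\<dots> \<le> lin.dim (ipow p m \<inter> forms t) + lin.dim (lin.span (?X ` ?S))"
    using lin.dim_sums_Int[OF f lin.subspace_inter[OF subspace_ideal[OF ideal_ipow] subspace_forms] lin.subspace_span]
    by simp
  also have "lin.dim (lin.span (?X ` ?S)) \<le> card ?S"
    using lin.dim_le_card'[of "?X ` ?S"] card_image_le[OF fin, of ?X] fin by simp
  also have "card ?S \<le> (m + 1) choose 2" by (rule card_local_exponents)
  finally show ?thesis by simp
qed

section \<open>Smooth points and local parameters\<close>

text \<open>Apart from its constant coefficient the expansion at \<open>p\<close> consists of
  multiples of the forms \<open>LL p l\<close>, and the one at the pivot is zero.\<close>

lemma point_decomposition:
  assumes "p \<noteq> 0" "UNIV = {piv p, i, j}"
  shows "\<exists>a b. G = coeff (theta p G) 0 + LL p i * a + LL p j * b"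
proof (induction G rule: poly3_induct)
  case (Const c)
  show ?case by (rule exI[of _ 0], rule exI[of _ 0]) (simp add: theta_simps)
next
  case (Var l)
  have "l \<in> {piv p, i, j}" using assms(2) by blast
  moreover have "Var l = coeff (theta p (Var l)) 0 + LL p l" by (simp add: theta_simps LL_def)
  ultimately show ?case using LL_piv[OF assms(1)]
    by (metis (no_types) add.right_neutral insert_iff mult_1_right mult_zero_right singletonD add.commute add_0)
next
  case (add F G)
  then obtain a b c d where "F = coeff (theta p F) 0 + LL p i * a + LL p j * b"
    "G = coeff (theta p G) 0 + LL p i * c + LL p j * d" by blast
  then have "F + G = coeff (theta p (F + G)) 0 + LL p i * (a + c) + LL p j * (b + d)"
    unfolding theta_simps coeff_add distrib_left by (metis (no_types, lifting) add.assoc add.commute)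
  then show ?case by blast
next
  case (mult F G)
  then obtain a b c d where 1: "F = coeff (theta p F) 0 + LL p i * a + LL p j * b"
    "G = coeff (theta p G) 0 + LL p i * c + LL p j * d" by blast
  define f g where "f = coeff (theta p F) 0" and "g = coeff (theta p G) 0"
  have "F * G = (f + LL p i * a + LL p j * b) * (g + LL p i * c + LL p j * d)"
    using 1 by (simp add: f_def g_def)
  also have "\<dots> = f * g + LL p i * (a * (g + LL p i * c + LL p j * d) + f * c)
      + LL p j * (b * (g + LL p i * c + LL p j * d) + f * d)" by (simp add: algebra_simps)
  finally show ?case unfolding theta_simps by (simp add: coeff_mult f_def g_def) blast
qed

lemma form_point_decomposition:
  assumes "p \<noteq> 0" "UNIV = {piv p, i, j}" "form t A" "eval3 A p = 0"
  shows "\<exists>a b. form (t - 1) a \<and> form (t - 1) b \<and> A = LL p i * a + LL p j * b"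
proof -
  obtain a b where ab: "A = LL p i * a + LL p j * b"
    using point_decomposition[OF assms(1,2), of A] coeff_theta_0_form[OF assms(3), of p] assms(4) by auto
  show ?thesis
  proof (cases t)
    case 0
    then obtain c where "A = Const c" using form_0_eq_Const assms(3) by blast
    then have "A = 0" using assms(4) by simp
    then show ?thesis by (intro exI[of _ 0]) simp
  next
    case (Suc t')
    have "A = hcomp t A" using hcomp_form[OF assms(3)] by simp
    also have "\<dots> = LL p i * hcomp t' a + LL p j * hcomp t' b"
      using hcomp_mult_form[OF form_LL[of p i], of t' a] hcomp_mult_form[OF form_LL[of p j], of t' b]
      unfolding ab Suc by (simp add: hcomp_add)
    finally show ?thesis using form_hcomp Suc by (metis diff_Suc_1)
  qed
qed

lemma linear_form_prime:
  assumes "form 1 (u :: 'k::field poly3)" "u \<noteq> 0" shows "prime_elem u"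
proof (rule irreducible_poly3_prime, rule irreducibleI)
  show "\<not> u dvd 1" using form_not_unit[OF assms(1)] by simp
  fix a b assume u: "u = a * b"
  then obtain i j where ij: "form i a" "form j b" "i + j = 1" using form_factors[of 1 a b] assms by blast
  then consider "i = 0" | "j = 0" by linarith
  then show "a dvd 1 \<or> b dvd 1"
  proof cases
    case 1
    then obtain c where "a = Const c" using ij form_0_eq_Const by blast
    then show ?thesis using u assms(2) is_unit_Const[of c] by auto
  next
    case 2
    then obtain c where "b = Const c" using ij form_0_eq_Const by blast
    then show ?thesis using u assms(2) is_unit_Const[of c] by auto
  qed
qed (rule assms(2))

lemma linear_dvd_linear:
  assumes "form 1 (u :: 'k::field poly3)" "form 1 w" "u dvd w"
  shows "\<exists>c. w = Const c * u"
proof (cases "w = 0")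
  case True then show ?thesis by (intro exI[of _ 0]) simp
next
  case False
  obtain c where c: "w = u * c" using assms(3) by blast
  obtain i j where ij: "form i u" "form j c" "i + j = 1"
    using form_factors[of 1 u c] assms(2) False c by metis
  have "i = 1" using form_degree_unique[OF ij(1) assms(1)] False c by auto
  then show ?thesis using ij(2,3) form_0_eq_Const[of c] c by (auto simp: mult.commute)
qed

text \<open>The unit vectors off the pivot separate the two local coordinates and so prove them
  independent.\<close>

lemma eval_axis_LL:
  assumes "i \<noteq> piv p" shows "eval3 (LL p l) (axis i 1) = (if l = i then 1 else 0)"
  using assms by (auto simp: LL_def hh_def axis_def)

lemma nonzerodiv_on_prime:
  assumes "prime_elem (u :: 'k::field poly3)" "\<not> u dvd F" shows "nonzerodiv_on F u"
  unfolding nonzerodiv_on_def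
proof (intro allI impI)
  fix A assume "F dvd u * A"
  then obtain C where C: "u * A = F * C" by blast
  then have "u dvd C" using assms by (metis dvd_triv_left prime_elem_dvd_mult_iff)
  then obtain C' where "C = u * C'" by blast
  then have "u * A = u * (F * C')" using C by (simp add: mult_ac)
  then have "A = F * C'" using assms(1) by auto
  then show "F dvd A" by simp
qed

text \<open>A linear form whose restriction generates the maximal ideal of the local ring of the
  curve at \<open>p\<close>: one fixed \<open>E\<close>, nonzero at \<open>p\<close>, makes every
  form that vanishes there a multiple of \<open>u\<close> modulo \<open>F\<close>. Degrees are
  recorded because all fractions are homogeneous. Being a nonzerodivisor, \<open>u\<close> can be
  cancelled.\<close>

definition local_param :: "'k::field poly3 \<Rightarrow> 'k ^ 3 \<Rightarrow> 'k poly3 \<Rightarrow> bool" where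
  "local_param F p u \<longleftrightarrow> form 1 u \<and> eval3 u p = 0 \<and> nonzerodiv_on F u \<and>
     (\<exists>e E. form (Suc e) E \<and> eval3 E p \<noteq> 0 \<and>
       (\<forall>t A. form t A \<and> eval3 A p = 0 \<longrightarrow> (\<exists>a. form (e + t) a \<and> F dvd E * A - u * a)))"

text \<open>By the Leibniz rule all partial derivatives of the product vanish where both factors do.
  Consequently a smooth point lies on one component only.\<close>

lemma smooth_not_in_square:
  assumes "eval3 (A :: 'k::field poly3) p = 0" "eval3 B p = 0" shows "\<not> smooth_point (A * B) p"
  using assms by (simp add: smooth_point_def partial_deriv_mult)

text \<open>If both coefficients vanished at the point, so would all partial derivatives of
  \<open>F\<close>, by the Leibniz rule. Interchanging \<open>i\<close> and \<open>j\<close> makes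
  \<open>E\<close> the nonzero one.\<close>

lemma smooth_decomposition:
  assumes "smooth_point F p" "form d F"
  obtains i j B E where "i \<noteq> j" "i \<noteq> piv p" "j \<noteq> piv p" "UNIV = {piv p, i, j}"
    "F = LL p i * B + LL p j * E" "form (d - 1) B" "form (d - 1) E" "eval3 E p \<noteq> 0"
proof -
  have p: "p \<noteq> 0" "eval3 F p = 0" using assms(1) by (auto simp: smooth_point_def)
  obtain i j where ij: "i \<noteq> j" "i \<noteq> piv p" "j \<noteq> piv p" "UNIV = {piv p, i, j}"
    using other_coordinates[of "piv p"] .
  obtain B E where BE: "F = LL p i * B + LL p j * E" "form (d - 1) B" "form (d - 1) E"
    using form_point_decomposition[OF p(1) ij(4) assms(2) p(2)] by blast
  obtain l where "eval3 (partial_deriv l F) p \<noteq> 0" using assms(1) by (auto simp: smooth_point_def)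
  then have "eval3 B p \<noteq> 0 \<or> eval3 E p \<noteq> 0"
    unfolding BE(1) using eval_LL[OF p(1)] by (auto simp: partial_deriv_add partial_deriv_mult)
  then show ?thesis
  proof
    assume "eval3 E p \<noteq> 0" then show ?thesis using that ij BE by blast
  next
    assume "eval3 B p \<noteq> 0"
    moreover have "F = LL p j * E + LL p i * B" using BE(1) by (simp add: add.commute)
    moreover have "UNIV = {piv p, j, i}" using ij(4) by (simp add: insert_commute)
    ultimately show ?thesis using that ij(1-3) BE(2,3) by metis
  qed
qed

text \<open>On the curve \<open>LL p j * E = - LL p i * B\<close> with \<open>E\<close> nonzero at
  \<open>p\<close>. So \<open>LL p j\<close> can be eliminated, and the line \<open>LL p i\<close>,
  which is not the tangent, is a parameter.\<close>

lemma local_param_exists: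
  fixes F :: "'k::field poly3"
  assumes sm: "smooth_point F p" and F: "form d F"
  shows "\<exists>u. local_param F p u"
proof -
  obtain i j B E where *: "i \<noteq> j" "i \<noteq> piv p" "j \<noteq> piv p" "UNIV = {piv p, i, j}"
    "F = LL p i * B + LL p j * E" "form (d - 1) B" "form (d - 1) E" "eval3 E p \<noteq> 0"
    using smooth_decomposition[OF sm F] .
  have p: "p \<noteq> 0" using sm by (auto simp: smooth_point_def)
  let ?u = "LL p i" and ?w = "LL p j"
  have u0: "?u \<noteq> 0" using eval_axis_LL[OF *(2), of i] by auto
  have pr: "prime_elem ?u" using linear_form_prime[OF form_LL u0] .
  have ndvd: "\<not> ?u dvd F"
  proof
    assume "?u dvd F"
    then have "?u dvd ?w * E" unfolding *(5) by (metis dvd_add_right_iff dvd_triv_left)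
    then have "?u dvd ?w \<or> ?u dvd E" using pr by (simp add: prime_elem_dvd_mult_iff)
    moreover have "\<not> ?u dvd ?w"
      using eval3_dvd_0[of ?u ?w "axis j 1"] eval_axis_LL[OF *(3)] *(1) by auto
    moreover have "\<not> ?u dvd E"
      using eval3_dvd_0[of ?u E p] eval_LL[OF p] *(8) by auto
    ultimately show False by blast
  qed
  have nz: "nonzerodiv_on F ?u" using nonzerodiv_on_prime[OF pr ndvd] .
  \<comment> \<open>The factor \<open>hh p\<close> is nonzero at the point; it raises the degree of
    \<open>E\<close> from \<open>d - 1\<close> to a successor, as \<open>local_param\<close>
    requires.\<close>
  have dec: "\<exists>a. form (d - 1 + t) a \<and> F dvd hh p * E * A - ?u * a" if A: "form t A" "eval3 A p = 0" for t A
  proof (cases "t = 0")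
    case True
    then have "A = 0" using form_0_eq_Const[of A] A by auto
    then show ?thesis by (intro exI[of _ 0]) simp
  next
    case False
    obtain a b where ab: "form (t - 1) a" "form (t - 1) b" "A = ?u * a + ?w * b"
      using form_point_decomposition[OF p *(4) A] by blast
    have "hh p * E * A - ?u * (hh p * (E * a - B * b)) = F * (hh p * b)"
      unfolding ab(3) by (subst *(5)) (simp add: algebra_simps)
    moreover have "form (1 + (d - 1 + (t - 1))) (hh p * (E * a - B * b))"
      by (rule form_mult[OF form_hh form_diff[OF form_mult[OF *(7) ab(1)] form_mult[OF *(6) ab(2)]]])
    moreover have "1 + (d - 1 + (t - 1)) = d - 1 + t" using False by simp
    ultimately show ?thesis by (metis dvd_triv_left)
  qed
  have "form (Suc (d - 1)) (hh p * E)" using form_mult[OF form_hh *(7)] by simp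
  moreover have "eval3 (hh p * E) p \<noteq> 0" using eval_hh[OF p] *(8) by simp
  ultimately have "local_param F p ?u"
    unfolding local_param_def using form_LL[of p i] eval_LL[OF p, of i] nz dec by meson
  then show ?thesis ..
qed

text \<open>The coefficient of \<open>s\<close> in \<open>theta p F\<close> is, up to a power of
  \<open>hh p\<close>, the equation of the tangent line; it is nonzero because \<open>E\<close> does
  not vanish at \<open>p\<close>.\<close>

lemma smooth_not_ipow_2:
  fixes F :: "'k::field poly3"
  assumes sm: "smooth_point F p" and F: "form d F"
  shows "F \<notin> ipow p 2"
proof -
  obtain i j B E where *: "i \<noteq> j" "i \<noteq> piv p" "j \<noteq> piv p" "UNIV = {piv p, i, j}"
    "F = LL p i * B + LL p j * E" "form (d - 1) B" "form (d - 1) E" "eval3 E p \<noteq> 0"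
    using smooth_decomposition[OF sm F] .
  have p: "p \<noteq> 0" using sm by (auto simp: smooth_point_def)
  let ?h = "hh p ^ (d - 1)"
  have "coeff (theta p F) 1 = ?h * (Const (eval3 B p) * LL p i + Const (eval3 E p) * LL p j)"
    unfolding *(5) using coeff_theta_0_form[OF *(6), of p] coeff_theta_0_form[OF *(7), of p]
    by (simp add: theta_simps theta_LL[OF p] coeff_pCons algebra_simps)
  moreover have "eval3 (Const (eval3 B p) * LL p i + Const (eval3 E p) * LL p j) (axis j 1) \<noteq> 0"
    using *(1,8) eval_axis_LL[OF *(3)] by simp
  then have "Const (eval3 B p) * LL p i + Const (eval3 E p) * LL p j \<noteq> 0" by force
  ultimately have "coeff (theta p F) 1 \<noteq> 0" using hh_nonzero[OF p] by simp
  then show ?thesis unfolding ipow_eq[OF p]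
    by (auto simp: monom_1_dvd_iff' intro!: exI[of _ 1])
qed

text \<open>Orders at \<open>s = 0\<close> add up, and that of \<open>F\<close> is at most one by
  \<open>smooth_not_ipow_2\<close>. Hence dividing by the cubic lowers a multiplicity by no more
  than one.\<close>

lemma ipow_cancel_smooth:
  assumes sm: "smooth_point F p" and F: "form d F" and FB: "F * B \<in> ipow p (Suc m)"
  shows "B \<in> ipow p m"
proof -
  have p: "p \<noteq> 0" "eval3 F p = 0" using sm by (auto simp: smooth_point_def)
  have m1: "monom (1::'a poly3) n = [:- 0, 1:] ^ n" for n by (simp add: monom_altdef)
  have nz: "theta p F \<noteq> 0" using smooth_not_ipow_2[OF sm F] by (auto simp: ipow_eq[OF p(1)])
  have oF: "order 0 (theta p F) \<le> 1"
    using smooth_not_ipow_2[OF sm F] nz order_divides[of "0::'a poly3" 2 "theta p F"]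
    unfolding ipow_eq[OF p(1)] m1 by simp
  show ?thesis
  proof (cases "theta p B = 0")
    case True then show ?thesis by (simp add: ipow_eq[OF p(1)])
  next
    case False
    then have "Suc m \<le> order 0 (theta p F * theta p B)"
      using FB nz order_divides[of "0::'a poly3" "Suc m" "theta p F * theta p B"]
      unfolding ipow_eq[OF p(1)] m1 by (simp add: theta_simps(5) del: power_Suc)
    also have "\<dots> = order 0 (theta p F) + order 0 (theta p B)"
      using False nz by (simp add: order_mult)
    finally have "m \<le> order 0 (theta p B)" using oF by simp
    then show ?thesis
      using order_divides[of "0::'a poly3" m "theta p B"] unfolding ipow_eq[OF p(1)] m1 by simp
  qed
qed

section \<open>Orders of vanishing along the curve\<close>

text \<open>Forms of degree \<open>t\<close> whose restriction to the curve has order at least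
  \<open>j\<close> at \<open>p\<close>, measured by the parameter \<open>u\<close>, with the
  denominator \<open>U\<close> cleared. The equation between degrees keeps the congruence
  homogeneous.\<close>

definition vord :: "'k::field poly3 \<Rightarrow> 'k ^ 3 \<Rightarrow> 'k poly3 \<Rightarrow> nat \<Rightarrow> nat \<Rightarrow> 'k poly3 set" where
  "vord F p u j t = {A. form t A \<and> (\<exists>d e U a. form d U \<and> eval3 U p \<noteq> 0 \<and> form e a \<and> e + j = d + t \<and>
     F dvd U * A - u ^ j * a)}"

lemma vordI:
  "form t A \<Longrightarrow> form d U \<Longrightarrow> eval3 U p \<noteq> 0 \<Longrightarrow> form e a \<Longrightarrow> e + j = d + t \<Longrightarrow> F dvd U * A - u ^ j * a \<Longrightarrow>
   A \<in> vord F p u j t"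
  unfolding vord_def by blast

lemma vordE:
  assumes "A \<in> vord F p u j t"
  obtains d e U a where "form t A" "form d U" "eval3 U p \<noteq> 0" "form e a" "e + j = d + t" "F dvd U * A - u ^ j * a"
  using assms unfolding vord_def by blast

lemma vord_form: "A \<in> vord F p u j t \<Longrightarrow> form t A"
  by (simp add: vord_def)

lemma vord_0: "form t A \<Longrightarrow> A \<in> vord F p u 0 t"
  by (rule vordI[of t A 0 1 p t A]) auto

lemma vord_mult:
  assumes "A \<in> vord F p u i s" "B \<in> vord F p u j t"
  shows "A * B \<in> vord F p u (i + j) (s + t)"
proof -
  obtain d e U a where A: "form s A" "form d U" "eval3 U p \<noteq> 0" "form e a" "e + i = d + s" "F dvd U * A - u ^ i * a"
    using vordE[OF assms(1)] .
  obtain d' e' U' b where B: "form t B" "form d' U'" "eval3 U' p \<noteq> 0" "form e' b" "e' + j = d' + t" "F dvd U' * B - u ^ j * b"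
    using vordE[OF assms(2)] .
  have "(U * U') * (A * B) - u ^ (i + j) * (a * b) =
      (U * A - u ^ i * a) * (U' * B) + (U' * B - u ^ j * b) * (u ^ i * a)"
    by (simp add: algebra_simps power_add)
  moreover have "F dvd \<dots>" using A(6) B(6) by (intro dvd_add dvd_mult2)
  ultimately show ?thesis
    using A B by (intro vordI[of "s + t" _ "d + d'" "U * U'" p "e + e'" "a * b"]) (auto intro: form_mult)
qed

lemma subspace_vord:
  fixes F :: "'k::field poly3" assumes "p \<noteq> 0" shows "lin.subspace (vord F p u j t)"
proof (rule lin.subspaceI)
  \<comment> \<open>The denominator \<open>hh p ^ j\<close> only balances the degrees.\<close>
  show "0 \<in> vord F p u j t"
    by (rule vordI[of t 0 j "hh p ^ j" p t 0]) (auto simp: eval_hh[OF assms] form_power[OF form_hh[of p], where n = j, simplified])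
next
  fix A B assume "A \<in> vord F p u j t" "B \<in> vord F p u j t"
  then obtain d e U a d' e' U' b where
    A: "form t A" "form d U" "eval3 U p \<noteq> 0" "form e a" "e + j = d + t" "F dvd U * A - u ^ j * a" and
    B: "form t B" "form d' U'" "eval3 U' p \<noteq> 0" "form e' b" "e' + j = d' + t" "F dvd U' * B - u ^ j * b"
    by (elim vordE)
  have "(U * U') * (A + B) - u ^ j * (U' * a + U * b) = (U * A - u ^ j * a) * U' + (U' * B - u ^ j * b) * U"
    by (simp add: algebra_simps)
  moreover have "F dvd \<dots>" using A(6) B(6) by (intro dvd_add dvd_mult2)
  moreover have "form (d' + e) (U' * a + U * b)"
    using form_mult[OF B(2) A(4)] form_mult[OF A(2) B(4)] A(5) B(5)
    by (intro form_add) (auto simp: add.commute[of _ e'] intro: back_subst[of "\<lambda>n. form n (U * b)"])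
  ultimately show "A + B \<in> vord F p u j t"
    using A B by (intro vordI[of t _ "d + d'" "U * U'" p "d' + e" "U' * a + U * b"]) (auto intro: form_mult form_add)
next
  fix c A assume "A \<in> vord F p u j t"
  from vord_mult[OF vord_0[OF form_Const] this, of c]
  show "Const c * A \<in> vord F p u j t" by simp
qed

lemma vord_antimono:
  assumes "form 1 u" "i \<le> j" shows "vord F p u j t \<subseteq> vord F p u i t"
proof
  fix A assume "A \<in> vord F p u j t"
  then obtain d e U a where A: "form t A" "form d U" "eval3 U p \<noteq> 0" "form e a" "e + j = d + t" "F dvd U * A - u ^ j * a"
    by (rule vordE)
  have "u ^ j * a = u ^ i * (u ^ (j - i) * a)"
    using assms(2) by (simp flip: power_add mult.assoc)
  moreover have "form ((j - i) * 1 + e) (u ^ (j - i) * a)"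
    using A(4) assms(1) by (intro form_mult form_power)
  ultimately show "A \<in> vord F p u i t"
    using A assms(2) by (intro vordI[of t A d U p "(j - i) * 1 + e" "u ^ (j - i) * a"]) (auto simp: mult.assoc)
qed

lemma vord_multiple:
  assumes "p \<noteq> 0" "form t (F * B)" shows "F * B \<in> vord F p u j t"
  using assms form_power[OF form_hh[of p], where n = j]
  by (intro vordI[of t _ j "hh p ^ j" p t 0]) (auto simp: eval_hh)

lemma vord_cancel:
  assumes "form b B" "eval3 B p \<noteq> 0" "form t A" "B * A \<in> vord F p u j (b + t)"
  shows "A \<in> vord F p u j t"
proof -
  obtain d e U a where A: "form d U" "eval3 U p \<noteq> 0" "form e a" "e + j = d + (b + t)" "F dvd U * (B * A) - u ^ j * a"
    using vordE[OF assms(4)] .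
  then show ?thesis
    using assms by (intro vordI[of t A "d + b" "U * B" p e a]) (auto intro: form_mult simp: mult.assoc)
qed

lemma vord_1:
  assumes "local_param F p u" "form t A" "eval3 A p = 0" shows "A \<in> vord F p u 1 t"
proof -
  obtain e E where E: "form (Suc e) E" "eval3 E p \<noteq> 0"
    "\<And>t A. form t A \<Longrightarrow> eval3 A p = 0 \<Longrightarrow> \<exists>a. form (e + t) a \<and> F dvd E * A - u * a"
    using assms(1) unfolding local_param_def by blast
  then obtain a where "form (e + t) a" "F dvd E * A - u * a" using assms by blast
  then show ?thesis using E(1,2) assms(2) by (intro vordI[of t A "Suc e" E p "e + t" a]) auto
qed

lemma vord_power:
  assumes "local_param F p u" "form 1 l" "eval3 l p = 0" shows "l ^ j \<in> vord F p u j j"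
proof (induction j)
  case 0 then show ?case by (simp add: vord_0)
next
  case (Suc j) then show ?case using vord_mult[OF vord_1[OF assms] Suc.IH] by simp
qed

text \<open>Against \<open>u ^ j\<close> the leading coefficients of \<open>A\<close> and
  \<open>B\<close> are the values of \<open>a / U\<close> and \<open>b / U'\<close> at
  \<open>p\<close>. A combination in which they cancel has a numerator vanishing at
  \<open>p\<close>, which yields one more factor \<open>u\<close>. So raising an order by one costs
  at most one dimension.\<close>

lemma vord_step:
  assumes L: "local_param F p u"
    and "A \<in> vord F p u j t" "B \<in> vord F p u j t"
  shows "\<exists>c d. (c \<noteq> 0 \<or> d \<noteq> 0) \<and> Const c * A + Const d * B \<in> vord F p u (Suc j) t"
proof -
  obtain d e U a where A: "form t A" "form d U" "eval3 U p \<noteq> 0" "form e a" "e + j = d + t" "F dvd U * A - u ^ j * a"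
    using vordE[OF assms(2)] .
  obtain d' e' U' b where B: "form t B" "form d' U'" "eval3 U' p \<noteq> 0" "form e' b" "e' + j = d' + t" "F dvd U' * B - u ^ j * b"
    using vordE[OF assms(3)] .
  obtain eE E where E: "form (Suc eE) E" "eval3 E p \<noteq> 0"
    "\<And>t A. form t A \<Longrightarrow> eval3 A p = 0 \<Longrightarrow> \<exists>a. form (eE + t) a \<and> F dvd E * A - u * a"
    using L unfolding local_param_def by blast
  define x y where "x = eval3 U' p * eval3 a p" and "y = eval3 U p * eval3 b p"
  obtain c1 c2 where c: "c1 \<noteq> 0 \<or> c2 \<noteq> 0" "c1 * x + c2 * y = 0"
  proof (cases "y = 0 \<and> x = 0")
    case True then show ?thesis using that[of 1 0] by simp
  next
    case False then show ?thesis using that[of y "-x"] by (auto simp: mult.commute)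
  qed
  define w where "w = Const c1 * (U' * a) + Const c2 * (U * b)"
  have fw: "form (d' + e) w"
    unfolding w_def using form_mult[OF B(2) A(4)] form_mult[OF A(2) B(4)] A(5) B(5)
    by (intro form_add form_Const_mult) (auto intro: back_subst[of "\<lambda>n. form n (U * b)"])
  have "eval3 w p = 0" using c(2) by (simp add: w_def x_def y_def)
  then obtain v where v: "form (eE + (d' + e)) v" "F dvd E * w - u * v" using E(3)[OF fw] by blast
  have "(E * (U * U')) * (Const c1 * A + Const c2 * B) - u ^ Suc j * v =
      (U * A - u ^ j * a) * (E * U' * Const c1) + (U' * B - u ^ j * b) * (E * U * Const c2) + (E * w - u * v) * u ^ j"
    by (simp add: algebra_simps w_def)
  moreover have "F dvd \<dots>" using A(6) B(6) v(2) by (intro dvd_add dvd_mult2)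
  ultimately have dv: "F dvd (E * (U * U')) * (Const c1 * A + Const c2 * B) - u ^ Suc j * v" by (simp only:)
  have "Const c1 * A + Const c2 * B \<in> vord F p u (Suc j) t"
  proof (rule vordI[OF _ form_mult[OF E(1) form_mult[OF A(2) B(2)]] _ v(1) _ dv])
    show "form t (Const c1 * A + Const c2 * B)" using A(1) B(1) by (intro form_add form_Const_mult)
  qed (use A B E in auto)
  then show ?thesis using c(1) by blast
qed

lemma nonzerodiv_on_mult: "nonzerodiv_on F A \<Longrightarrow> nonzerodiv_on F B \<Longrightarrow> nonzerodiv_on F (A * B :: 'k::field poly3)"
  unfolding nonzerodiv_on_def mult.assoc by blast

lemma nonzerodiv_on_1: "nonzerodiv_on F (1 :: 'k::field poly3)"
  unfolding nonzerodiv_on_def mult_1_left by blast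

lemma nonzerodiv_onD: "nonzerodiv_on F A \<Longrightarrow> F dvd A * B \<Longrightarrow> F dvd (B :: 'k::field poly3)"
  unfolding nonzerodiv_on_def by blast

lemma nonzerodiv_on_power: "nonzerodiv_on F A \<Longrightarrow> nonzerodiv_on F (A ^ n :: 'k::field poly3)"
  by (induction n) (auto simp: nonzerodiv_on_1 nonzerodiv_on_mult)

text \<open>After cancelling \<open>u ^ j\<close> modulo \<open>F\<close>, evaluation at
  \<open>p\<close> gives a contradiction: \<open>F\<close> and \<open>u\<close> vanish there, while
  \<open>U\<close> and \<open>g\<close> do not.\<close>

lemma vord_exact:
  assumes L: "local_param F p u" and F: "eval3 F p = 0" and g: "eval3 g p \<noteq> 0"
  shows "u ^ j * g \<notin> vord F p u (Suc j) t"
proof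
  assume "u ^ j * g \<in> vord F p u (Suc j) t"
  then obtain d e U a where A: "eval3 U p \<noteq> 0" "F dvd U * (u ^ j * g) - u ^ Suc j * a"
    by (rule vordE)
  have "U * (u ^ j * g) - u ^ Suc j * a = u ^ j * (U * g - u * a)" by (simp add: algebra_simps)
  then have "F dvd U * g - u * a"
    using A(2) L nonzerodiv_onD[OF nonzerodiv_on_power[of F u j]] unfolding local_param_def by metis
  then have "eval3 (U * g - u * a) p = 0" using F by (rule eval3_dvd_0)
  then show False using A(1) g L by (auto simp: local_param_def)
qed

lemma hcomp_mult: "hcomp d (A * B) = (\<Sum>i\<le>d. hcomp i A * hcomp (d - i) B)"
  by (simp add: hcomp_def homg_mult coeff_mult)

text \<open>Powers of the ideal contain inhomogeneous elements, so the claim is made for every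
  component. The polynomials with this property form an ideal for each \<open>j\<close>, these
  ideals multiply correctly, and the one for \<open>j = 1\<close> contains the generators.\<close>

lemma hcomp_ipow_vord:
  assumes L: "local_param F p u" and p: "p \<noteq> 0" and "G \<in> ipow p j"
  shows "hcomp d G \<in> vord F p u j d"
proof -
  let ?V = "\<lambda>j. {G. \<forall>d. hcomp d G \<in> vord F p u j d}"
  have mult: "A * B \<in> ?V (i + j)" if "A \<in> ?V i" "B \<in> ?V j" for A B i j
  proof -
    have "hcomp k A * hcomp (d - k) B \<in> vord F p u (i + j) d" if "k \<le> d" for k d
      using vord_mult[of "hcomp k A" F p u i k "hcomp (d - k) B" j "d - k"] \<open>A \<in> ?V i\<close> \<open>B \<in> ?V j\<close> that
      by simp
    then have "hcomp d (A * B) \<in> vord F p u (i + j) d" for d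
      unfolding hcomp_mult by (intro lin.subspace_sum[OF subspace_vord[OF p]]) simp
    then show ?thesis by simp
  qed
  have add: "A + B \<in> ?V j" if "A \<in> ?V j" "B \<in> ?V j" for A B j
    using that lin.subspace_add[OF subspace_vord[OF p], of _ F u j] by (simp add: hcomp_add)
  have U: "A \<in> ?V 0" for A using vord_0[OF form_hcomp] by blast
  have id: "ideal (?V j) PR" for j
  proof -
    have "0 \<in> ?V j" using lin.subspace_0[OF subspace_vord[OF p]] by simp
    moreover have "\<forall>a\<in>?V j. \<forall>b\<in>?V j. a + b \<in> ?V j" using add by blast
    moreover have "\<forall>a\<in>?V j. \<forall>r. r * a \<in> ?V j" using mult[OF U, of _ j] by simp
    ultimately show ?thesis unfolding ideal_PR_iff by blast
  qed
  have 1: "point_ideal p \<subseteq> ?V 1"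
    unfolding point_ideal_def
  proof (rule PRr.genideal_minimal[OF id], rule subsetI)
    fix G assume "G \<in> {G. (\<exists>d. form d G) \<and> eval3 G p = 0}"
    then obtain e where e: "form e G" "eval3 G p = 0" by blast
    show "G \<in> ?V 1"
      using vord_1[OF L e] lin.subspace_0[OF subspace_vord[OF p]] by (simp add: hcomp_form[OF e(1)])
  qed
  have "ipow p j \<subseteq> ?V j"
  proof (induction j)
    case 0 then show ?case using U by blast
  next
    case (Suc j)
    show ?case
    proof
      fix G assume "G \<in> ipow p (Suc j)"
      then show "G \<in> ?V (Suc j)" unfolding ipow_Suc
      proof (induction rule: ideal_prod.induct)
        case (prod a b) then show ?case using mult[of a j b 1] Suc.IH 1 by auto
      next
        case (sum a b) then show ?case using add[of a "Suc j" b] by simp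
      qed
    qed
  qed
  then show ?thesis using assms(3) by blast
qed

lemma ipow_forms_subset_vord:
  assumes "local_param F p u" "p \<noteq> 0" shows "ipow p j \<inter> forms t \<subseteq> vord F p u j t"
proof
  fix A assume "A \<in> ipow p j \<inter> forms t"
  then show "A \<in> vord F p u j t"
    using hcomp_ipow_vord[OF assms, of A j t] hcomp_form[of t A t] by simp
qed

subsection \<open>Complete intersections are saturated\<close>

text \<open>The first two variables generate the ideal of the point \<open>(0 : 0 : 1)\<close>.
  Setting them to zero kills the right side and leaves \<open>Var 3\<close> times the image of
  \<open>e\<close>, which is therefore zero.\<close>

lemma in_ideal_of_two_variables:
  fixes e :: "'k::field poly3"
  assumes "Var 3 * e = Var 1 * a + Var 2 * b"
  obtains c d where "e = Var 1 * c + Var 2 * d"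
proof -
  let ?p = "axis 3 1 :: 'k ^ 3"
  have p: "?p \<noteq> 0" by simp
  have ne: "(1::3) \<noteq> 2" "(2::3) \<noteq> 1" "(1::3) \<noteq> 3" "(3::3) \<noteq> 1" "(2::3) \<noteq> 3" "(3::3) \<noteq> 2" by simp_all
  have pv: "piv ?p = 3" using piv[OF p] by (auto simp: axis_def split: if_splits)
  have ax: "?p $ i = (if i = 3 then 1 else 0)" for i by (simp add: axis_def)
  have h: "hh ?p = Var 3" unfolding hh_def pv ax by simp
  have L: "LL ?p 1 = Var 1" "LL ?p 2 = Var 2" unfolding LL_def h ax using ne by simp_all
  have U: "UNIV = {piv ?p, 1, 2}" unfolding pv UNIV_3 by auto
  let ?s = "subst Const (\<lambda>i. Const (?p $ i) * hh ?p)"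
  have "?s (Var 3 * e) = ?s (Var 1 * a + Var 2 * b)" using assms by simp
  then have "Var 3 * ?s e = 0"
    unfolding cst.subst_mult cst.subst_add cst.subst_Var h ax using ne by simp
  moreover have "Var 3 \<noteq> (0 :: 'k poly3)"
  proof
    assume "Var 3 = (0 :: 'k poly3)"
    then have "eval3 (Var 3) ?p = eval3 0 ?p" by simp
    then show False by (simp add: axis_def)
  qed
  ultimately have "coeff (theta ?p e) 0 = 0" by (simp add: coeff_theta_0)
  then show ?thesis using point_decomposition[OF p U, of e] that by (auto simp: L)
qed

text \<open>Comparing the representations of \<open>x g\<close>, \<open>y g\<close> and
  \<open>z g\<close> in pairs, each syzygy is a multiple \<open>e1\<close>, \<open>e2\<close>,
  \<open>e3\<close> of the Koszul relation between \<open>F\<close> and \<open>H\<close>. These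
  satisfy \<open>z e1 = y e2 - x e3\<close>, which puts \<open>e1\<close> into the ideal of
  \<open>x\<close> and \<open>y\<close>.\<close>

lemma koszul_saturation:
  fixes F H g :: "'k::field poly3"
  assumes nz: "nonzerodiv_on F H" and F0: "F \<noteq> 0" and H0: "H \<noteq> 0"
    and x: "Var 1 * g = a * F + b * H" and y: "Var 2 * g = c * F + d * H" and z: "Var 3 * g = a' * F + b' * H"
  shows "\<exists>r s. g = r * F + s * H"
proof -
  define X Y Z where "X = (Var 1 :: 'k poly3)" and "Y = (Var 2 :: 'k poly3)" and "Z = (Var 3 :: 'k poly3)"
  note xyz = x[folded X_def] y[folded Y_def] z[folded Z_def]
  have koszul: "\<exists>e. Q * r1 - P * r2 = H * e \<and> P * s2 - Q * s1 = F * e"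
    if "P * g = r1 * F + s1 * H" "Q * g = r2 * F + s2 * H" for P Q r1 r2 s1 s2
  proof -
    have "Q * (P * g) = P * (Q * g)" by (simp add: mult_ac)
    then have eq: "(Q * r1 - P * r2) * F = H * (P * s2 - Q * s1)" unfolding that by (simp add: algebra_simps)
    then have "F dvd P * s2 - Q * s1" using nonzerodiv_onD[OF nz] by (metis dvd_triv_right)
    then obtain e where e: "P * s2 - Q * s1 = F * e" by blast
    then have "F * (Q * r1 - P * r2) = F * (H * e)" using eq by (simp add: mult_ac)
    then show ?thesis using F0 e by auto
  qed
  obtain e1 where e1: "Y * a - X * c = H * e1" "X * d - Y * b = F * e1" using koszul[OF xyz(1,2)] by blast
  obtain e2 where e2: "Z * a - X * a' = H * e2" using koszul[OF xyz(1,3)] by blast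
  obtain e3 where e3: "Z * c - Y * a' = H * e3" using koszul[OF xyz(2,3)] by blast
  have "H * (Z * e1) = Z * (H * e1)" by (simp add: mult_ac)
  also have "\<dots> = Y * (H * e2) - X * (H * e3)" unfolding e1(1)[symmetric] e2[symmetric] e3[symmetric]
    by (simp add: algebra_simps)
  also have "\<dots> = H * (X * (- e3) + Y * e2)" by (simp add: algebra_simps)
  finally have "Var 3 * e1 = Var 1 * (- e3) + Var 2 * e2" using H0 by (simp add: X_def Y_def Z_def)
  then obtain u v where uv: "e1 = X * u + Y * v" using in_ideal_of_two_variables X_def Y_def by metis
  have X: "prime_elem X" unfolding X_def
  proof (rule linear_form_prime[OF form_Var])
    show "Var 1 \<noteq> (0 :: 'k poly3)"
    proof
      assume "Var 1 = (0 :: 'k poly3)"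
      then have "eval3 (Var 1) (axis 1 1 :: 'k ^ 3) = eval3 0 (axis 1 1)" by simp
      then show False by (simp add: axis_def)
    qed
  qed
  have XY: "\<not> X dvd Y"
    using eval3_dvd_0[of X Y "axis 2 1"] by (auto simp: X_def Y_def axis_def)
  \<comment> \<open>Changing the representation of \<open>x g\<close> by \<open>v\<close> times the
    Koszul relation makes both coefficients divisible by \<open>x\<close>.\<close>
  have "Y * (a - H * v) = X * (c + H * u)" using e1(1) unfolding uv by (simp add: algebra_simps)
  then have "X dvd a - H * v" using X XY by (metis dvd_triv_left prime_elem_dvd_mult_iff)
  then obtain r where r: "a - H * v = X * r" by blast
  have "X * (d - F * u) = Y * (b + F * v)" using e1(2) unfolding uv by (simp add: algebra_simps)
  then have "X dvd b + F * v" using X XY by (metis dvd_triv_left prime_elem_dvd_mult_iff)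
  then obtain s where s: "b + F * v = X * s" by blast
  have "X * g = (a - H * v) * F + (b + F * v) * H" unfolding xyz(1) by (simp add: algebra_simps)
  also have "\<dots> = X * (r * F + s * H)" unfolding r s by (simp add: algebra_simps)
  finally have "g = r * F + s * H" using X by auto
  then show ?thesis by blast
qed

text \<open>The degree \<open>N\<close> can be lowered one at a time: once the products of
  \<open>M * g\<close> with the three variables lie in the ideal, so does
  \<open>M * g\<close>.\<close>

lemma complete_intersection_saturated:
  fixes F H g :: "'k::field poly3"
  assumes "nonzerodiv_on F H" "F \<noteq> 0" "H \<noteq> 0"
    and "\<And>M. form N M \<Longrightarrow> \<exists>r s. M * g = r * F + s * H"
  shows "\<exists>r s. g = r * F + s * H"
  using assms(4)
proof (induction N)
  case 0
  then show ?case using form_1 by (metis mult_1)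
next
  case (Suc N)
  have "\<exists>r s. M * g = r * F + s * H" if "form N M" for M
  proof -
    have "\<exists>r s. Var i * (M * g) = r * F + s * H" for i
      using Suc.prems[OF form_mult[OF form_Var[of i] that, simplified]] by (simp add: mult.assoc)
    then show ?thesis using koszul_saturation[OF assms(1-3)] by meson
  qed
  then show ?case by (rule Suc.IH)
qed

lemma form_quotient:
  assumes "form d \<Phi>" "\<Phi> \<noteq> 0" "form s (\<Phi> * b :: 'k::field poly3)" "d \<le> s" shows "form (s - d) b"
proof (cases "b = 0")
  case False
  then obtain i j where "form i \<Phi>" "form j b" "i + j = s" using form_factors[OF assms(3)] assms(2) by auto
  then show ?thesis using form_degree_unique[OF assms(1)] assms(2) by fastforce
qed simp

lemma form_quotient_small:
  assumes "form d \<Phi>" "\<Phi> \<noteq> 0" "form s (\<Phi> * b :: 'k::field poly3)" "s < d" shows "b = 0"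
proof (rule ccontr)
  assume "b \<noteq> 0"
  then obtain i j where "form i \<Phi>" "form j b" "i + j = s" using form_factors[OF assms(3)] assms(2) by auto
  then show False using form_degree_unique[OF assms(1)] assms(2,4) by fastforce
qed

text \<open>Euler characteristic of the Koszul complex of two forms of degrees \<open>d\<close> and
  \<open>t\<close>: it makes \<open>d * t\<close> the value of the Hilbert function of a complete
  intersection in large degree.\<close>

lemma choose_2_identity:
  "((d + x + 2) choose 2) + ((t + x + 2) choose 2) + d * t = ((x + 2) choose 2) + ((t + d + x + 2) choose 2)"
proof -
  have c: "real ((a + 2) choose 2) = (real a + 2) * (real a + 1) / 2" for a
    by (induction a) (auto simp: numeral_2_eq_2 field_simps)
  have "real (((d + x + 2) choose 2) + ((t + x + 2) choose 2) + d * t) =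
      real (((x + 2) choose 2) + ((t + d + x + 2) choose 2))"
    unfolding of_nat_add c by (simp add: field_simps)
  then show ?thesis by (simp only: of_nat_eq_iff)
qed

text \<open>A common multiple of \<open>A\<close> and \<open>\<Phi>\<close> is a multiple of their
  product, as \<open>A\<close> is a nonzerodivisor modulo \<open>\<Phi>\<close>. So the intersection
  is known, and with it the dimension of the sum. The bound \<open>d \<le> s\<close> keeps the
  degrees natural.\<close>

lemma dim_ideal_sum:
  fixes A \<Phi> :: "'k::field poly3"
  assumes \<Phi>: "form d \<Phi>" "\<Phi> \<noteq> 0" and A: "form t A" "A \<noteq> 0" and nz: "nonzerodiv_on \<Phi> A" and s: "d \<le> s"
  shows "lin.dim {x + y |x y. x \<in> (*) A ` forms s \<and> y \<in> (*) \<Phi> ` forms (t + s - d)} + d * t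
      = lin.dim (forms (t + s) :: 'k poly3 set)"
proof -
  let ?X = "(*) A ` forms s" and ?Y = "(*) \<Phi> ` forms (t + s - d)"
  have XY: "?X \<subseteq> forms (t + s)" "?Y \<subseteq> forms (t + s)"
    using form_mult[OF A(1)] form_mult[OF \<Phi>(1), of "t + s - d"] s by auto
  have f: "lin.fin_dim ?X" "lin.fin_dim ?Y"
    using XY lin.fin_dim_subset[OF fin_dim_forms] by blast+
  have sub: "lin.subspace ?X" "lin.subspace ?Y"
    using subspace_mult_image subspace_forms by blast+
  have Int: "?X \<inter> ?Y = (*) (A * \<Phi>) ` forms (s - d)"
  proof
    show "?X \<inter> ?Y \<subseteq> (*) (A * \<Phi>) ` forms (s - d)"
    proof
      fix G assume "G \<in> ?X \<inter> ?Y"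
      then have "\<exists>b. form s b \<and> G = A * b" "\<exists>c. G = \<Phi> * c" by auto
      then obtain b c where b: "G = A * b" "form s b" and c: "G = \<Phi> * c" by metis
      then have "\<Phi> dvd b" using nonzerodiv_onD[OF nz, of b] by (metis dvd_triv_left)
      then obtain b' where b': "b = \<Phi> * b'" by blast
      then have "form (s - d) b'" using form_quotient[OF \<Phi>] b(2) s by blast
      then show "G \<in> (*) (A * \<Phi>) ` forms (s - d)" using b b' by (auto simp: mult_ac)
    qed
    show "(*) (A * \<Phi>) ` forms (s - d) \<subseteq> ?X \<inter> ?Y"
    proof
      fix G assume "G \<in> (*) (A * \<Phi>) ` forms (s - d)"
      then have "\<exists>c. form (s - d) c \<and> G = A * \<Phi> * c" by auto
      then obtain c where c: "G = A * \<Phi> * c" "form (s - d) c" by metis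
      have "G = A * (\<Phi> * c)" "form s (\<Phi> * c)" using c form_mult[OF \<Phi>(1) c(2)] s by (simp_all add: mult_ac)
      moreover have "G = \<Phi> * (A * c)" "form (t + s - d) (A * c)"
        using c form_mult[OF A(1) c(2)] s by (simp_all add: mult_ac)
      ultimately show "G \<in> ?X \<inter> ?Y" by auto
    qed
  qed
  have "lin.dim {x + y |x y. x \<in> ?X \<and> y \<in> ?Y} + lin.dim (?X \<inter> ?Y) = lin.dim ?X + lin.dim ?Y"
    by (rule lin.dim_sums_Int[OF f sub])
  then have "lin.dim {x + y |x y. x \<in> ?X \<and> y \<in> ?Y} + ((s - d + 2) choose 2)
      = ((s + 2) choose 2) + ((t + s - d + 2) choose 2)"
    unfolding Int using A(2) \<Phi>(2) by (simp add: dim_mult_image dim_forms)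
  then show ?thesis
    using choose_2_identity[of d "s - d" t] s by (simp add: dim_forms)
qed

text \<open>If all the lines \<open>LL p i\<close> contained \<open>q\<close>, then \<open>q\<close>
  would be \<open>h(q)\<close> times \<open>p\<close>.\<close>

lemma separating_line:
  fixes p q :: "'k::field ^ 3"
  assumes "p \<noteq> 0" "q \<noteq> 0" "\<not> same_point p q"
  obtains l where "form 1 l" "eval3 l p = 0" "eval3 l q \<noteq> 0"
proof -
  have "\<exists>i. eval3 (LL p i) q \<noteq> 0"
  proof (rule ccontr)
    assume "\<nexists>i. eval3 (LL p i) q \<noteq> 0"
    then have "q $ i = eval3 (hh p) q * p $ i" for i by (simp add: LL_def mult.commute)
    then have eq: "q = eval3 (hh p) q *s p" by (simp add: Finite_Cartesian_Product.vec_eq_iff)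
    moreover have "eval3 (hh p) q \<noteq> 0" using eq assms(2) by (metis vector_smult_lzero)
    ultimately show False using assms(3) unfolding same_point_def by blast
  qed
  then show ?thesis using that form_LL eval_LL[OF assms(1)] by blast
qed

section \<open>Prescribed orders at the marked points; Bezout and Noether\<close>

locale marked_cubic =
  fixes F :: "'k::field poly3" and p :: "nat \<Rightarrow> 'k ^ 3" and n :: nat
  assumes form_F: "form 3 F" and F_nonzero: "F \<noteq> 0"
    and smooth: "\<And>i. i \<in> {1..n} \<Longrightarrow> smooth_point F (p i)"
    and distinct: "\<And>i j. i \<in> {1..n} \<Longrightarrow> j \<in> {1..n} \<Longrightarrow> i \<noteq> j \<Longrightarrow> \<not> same_point (p i) (p j)"
begin

definition par :: "nat \<Rightarrow> 'k poly3" where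
  "par i = (SOME u. local_param F (p i) u)"

lemma par: "i \<in> {1..n} \<Longrightarrow> local_param F (p i) (par i)"
  unfolding par_def using local_param_exists[OF smooth form_F] by (rule someI_ex)

lemma point_nonzero: "i \<in> {1..n} \<Longrightarrow> p i \<noteq> 0"
  using smooth by (auto simp: smooth_point_def)

lemma on_curve: "i \<in> {1..n} \<Longrightarrow> eval3 F (p i) = 0"
  using smooth by (auto simp: smooth_point_def)

lemma form_par: "i \<in> {1..n} \<Longrightarrow> form 1 (par i)"
  using par unfolding local_param_def by blast

text \<open>The forms of degree \<open>t\<close> whose restriction to the curve vanishes along the divisor
  \<open>\<Sum>i\<in>S. D i \<cdot> p\<^sub>i\<close>.\<close>

definition VV :: "nat set \<Rightarrow> (nat \<Rightarrow> nat) \<Rightarrow> nat \<Rightarrow> 'k poly3 set" where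
  "VV S D t = forms t \<inter> (\<Inter>i\<in>S. vord F (p i) (par i) (D i) t)"

lemma VV_iff: "A \<in> VV S D t \<longleftrightarrow> form t A \<and> (\<forall>i\<in>S. A \<in> vord F (p i) (par i) (D i) t)"
  by (auto simp: VV_def)

lemma fin_dim_VV: "lin.fin_dim (VV S D t)"
  using lin.fin_dim_subset[OF fin_dim_forms] unfolding VV_def by blast

lemma subspace_VV: "S \<subseteq> {1..n} \<Longrightarrow> lin.subspace (VV S D t)"
  unfolding VV_def using point_nonzero
  by (intro lin.subspace_inter subspace_forms lin.subspace_Int subspace_vord) blast

lemma VV_antimono:
  assumes "S \<subseteq> {1..n}" "\<And>i. i \<in> S \<Longrightarrow> D i \<le> D' i" shows "VV S D' t \<subseteq> VV S D t"
proof
  fix A assume A: "A \<in> VV S D' t"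
  have "A \<in> vord F (p i) (par i) (D i) t" if i: "i \<in> S" for i
  proof (rule subsetD[OF vord_antimono[OF form_par assms(2)[OF i]]])
    show "i \<in> {1..n}" using i assms(1) by blast
    show "A \<in> vord F (p i) (par i) (D' i) t" using A i by (simp add: VV_iff)
  qed
  then show "A \<in> VV S D t" using A by (simp add: VV_iff)
qed

lemma VV_0: "VV S (\<lambda>_. 0) t = forms t"
  by (auto simp: VV_iff vord_0)

lemma VV_cong: "(\<And>i. i \<in> S \<Longrightarrow> D i = D' i) \<Longrightarrow> VV S D t = VV S D' t"
  by (auto simp: VV_iff)

lemma VV_mult: "A \<in> VV S D s \<Longrightarrow> B \<in> VV S D' t \<Longrightarrow> A * B \<in> VV S (\<lambda>i. D i + D' i) (s + t)"
  unfolding VV_iff using form_mult vord_mult by blast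

lemma VV_mult_form: "form s A \<Longrightarrow> B \<in> VV S D t \<Longrightarrow> A * B \<in> VV S D (s + t)"
  using VV_mult[of A S "\<lambda>_. 0" s B D t] by (simp add: VV_0)

lemma dim_VV_step:
  assumes S: "S \<subseteq> {1..n}" and i: "i \<in> S"
  shows "lin.dim (VV S D t) \<le> lin.dim (VV S (D(i := Suc (D i))) t) + 1"
proof (rule lin.dim_le_Suc[OF fin_dim_VV subspace_VV[OF S] subspace_VV[OF S]])
  show "VV S (D(i := Suc (D i))) t \<subseteq> VV S D t" by (rule VV_antimono[OF S]) auto
  fix A B assume AB: "A \<in> VV S D t" "B \<in> VV S D t"
  have "i \<in> {1..n}" using i S by blast
  from vord_step[OF par[OF this], of A "D i" t B] AB i
  obtain c d where cd: "c \<noteq> 0 \<or> d \<noteq> 0" "Const c * A + Const d * B \<in> vord F (p i) (par i) (Suc (D i)) t"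
    unfolding VV_iff by blast
  have "Const c * A + Const d * B \<in> VV S D t"
    using AB lin.subspace_add[OF subspace_VV[OF S]] lin.subspace_scale[OF subspace_VV[OF S]] by blast
  with cd(2) have "Const c * A + Const d * B \<in> VV S (D(i := Suc (D i))) t"
    by (auto simp: VV_iff)
  with cd(1) show "\<exists>c d. (c \<noteq> 0 \<or> d \<noteq> 0) \<and> Const c * A + Const d * B \<in> VV S (D(i := Suc (D i))) t"
    by blast
qed

lemma finite_index: "S \<subseteq> {1..n} \<Longrightarrow> finite S"
  by (rule finite_subset) auto

lemma dim_VV_le:
  assumes S: "S \<subseteq> {1..n}" and "\<And>i. i \<in> S \<Longrightarrow> D i \<le> D' i"
  shows "lin.dim (VV S D t) + sum D S \<le> lin.dim (VV S D' t) + sum D' S"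
  using assms(2)
proof (induction "sum D' S - sum D S" arbitrary: D)
  case 0
  have le: "sum D S \<le> sum D' S" using 0(2) by (intro sum_mono) simp
  have "D i = D' i" if "i \<in> S" for i
    using sum_mono_inv[of D S D' i] 0 le that finite_index[OF S] by simp
  then show ?case using VV_cong[of S D D' t] le 0(1) by simp
next
  case (Suc k)
  have "\<exists>i\<in>S. D i < D' i"
  proof (rule ccontr)
    assume "\<not> (\<exists>i\<in>S. D i < D' i)"
    then have "sum D' S \<le> sum D S" by (intro sum_mono) auto
    with Suc(2) show False by simp
  qed
  then obtain i where i: "i \<in> S" "D i < D' i" by blast
  let ?D = "D(i := Suc (D i))"
  have s: "sum ?D S = Suc (sum D S)"
    using i(1) finite_index[OF S] by (simp add: sum.remove[of S i] sum.remove[of S i D])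
  have "lin.dim (VV S ?D t) + sum ?D S \<le> lin.dim (VV S D' t) + sum D' S"
    using Suc(2,3) i s by (intro Suc(1)) auto
  with dim_VV_step[OF S i(1), of D t] s show ?case by simp
qed

lemma dim_forms_le_VV:
  "S \<subseteq> {1..n} \<Longrightarrow> lin.dim (forms t :: 'k poly3 set) \<le> lin.dim (VV S D t) + sum D S"
  using dim_VV_le[of S "\<lambda>_. 0" D t] by (simp add: VV_0)

text \<open>The witness is \<open>par i ^ D i\<close> times powers of lines that pass through the
  other points and miss \<open>p i\<close>, filled up to degree \<open>t\<close> by a form nonzero
  at \<open>p i\<close>. It shows that the conditions are independent in this range.\<close>

lemma VV_strict:
  assumes S: "S \<subseteq> {1..n}" and i: "i \<in> S" and t: "sum D S \<le> t"
  shows "\<exists>A \<in> VV S D t. A \<notin> vord F (p i) (par i) (Suc (D i)) t"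
proof -
  have fin: "finite S" using finite_index[OF S] .
  have "\<exists>l. form 1 l \<and> eval3 l (p j) = 0 \<and> eval3 l (p i) \<noteq> 0" if "j \<in> S - {i}" for j
  proof -
    have ji: "j \<in> {1..n}" "i \<in> {1..n}" "j \<noteq> i" using that i S by auto
    obtain l where "form 1 l" "eval3 l (p j) = 0" "eval3 l (p i) \<noteq> 0"
      using separating_line[OF point_nonzero[OF ji(1)] point_nonzero[OF ji(2)] distinct[OF ji]] .
    then show ?thesis by blast
  qed
  then have "\<forall>j\<in>S - {i}. \<exists>l. form 1 l \<and> eval3 l (p j) = 0 \<and> eval3 l (p i) \<noteq> 0" by blast
  from bchoice[OF this] obtain l
    where l: "\<And>j. j \<in> S - {i} \<Longrightarrow> form 1 (l j) \<and> eval3 (l j) (p j) = 0 \<and> eval3 (l j) (p i) \<noteq> 0"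
    by blast
  define g where "g = (\<Prod>j\<in>S - {i}. l j ^ D j) * hh (p i) ^ (t - sum D S)"
  have iS: "i \<in> {1..n}" using i S by blast
  have fh: "form (t - sum D S) (hh (p i) ^ (t - sum D S))"
    using form_power[OF form_hh[of "p i"], of "t - sum D S"] by simp
  have fl: "form (\<Sum>j\<in>B. D j) (\<Prod>j\<in>B. l j ^ D j)" if "B \<subseteq> S - {i}" for B
    using form_power[of 1] l that by (intro form_prod) fastforce
  have tot: "D i + (sum D (S - {i}) + (t - sum D S)) = t"
    using t sum.remove[OF fin i, of D] by simp
  have fg: "form (sum D (S - {i}) + (t - sum D S)) g"
    unfolding g_def using fl[of "S - {i}"] fh by (intro form_mult) auto
  have fu: "form (D i) (par i ^ D i)" using form_power[OF form_par[OF iS], of "D i"] by simp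
  have "eval3 g (p i) \<noteq> 0"
    using l fin eval_hh[OF point_nonzero[OF iS]] by (simp add: g_def eval3_prod)
  then have 1: "par i ^ D i * g \<notin> vord F (p i) (par i) (Suc (D i)) t"
    by (rule vord_exact[OF par[OF iS] on_curve[OF iS]])
  have "par i ^ D i * g \<in> vord F (p i) (par i) (D i + 0) (D i + (sum D (S - {i}) + (t - sum D S)))"
    using par[OF iS] fg unfolding local_param_def
    by (intro vord_mult vord_power[OF par[OF iS]] vord_0) auto
  moreover have "par i ^ D i * g \<in> vord F (p j) (par j) (D j) t" if j: "j \<in> S - {i}" for j
  proof -
    have jS: "j \<in> {1..n}" using j S by blast
    have eq: "par i ^ D i * g = l j ^ D j * (par i ^ D i * (\<Prod>k\<in>S - {i} - {j}. l k ^ D k) * hh (p i) ^ (t - sum D S))"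
      unfolding g_def using prod.remove[of "S - {i}" j "\<lambda>j. l j ^ D j"] fin j by (simp add: mult_ac)
    have "form (D i + sum D (S - {i} - {j}) + (t - sum D S))
       (par i ^ D i * (\<Prod>k\<in>S - {i} - {j}. l k ^ D k) * hh (p i) ^ (t - sum D S))"
      using fl[of "S - {i} - {j}"] fh fu by (intro form_mult) auto
    then have "par i ^ D i * g \<in> vord F (p j) (par j) (D j + 0) (D j + (D i + sum D (S - {i} - {j}) + (t - sum D S)))"
      unfolding eq using l[OF j] by (intro vord_mult vord_power[OF par[OF jS]] vord_0) auto
    moreover have "D j + (D i + sum D (S - {i} - {j}) + (t - sum D S)) = t"
      using tot sum.remove[of "S - {i}" j D] fin j by simp
    ultimately show ?thesis by simp
  qed
  moreover have "form t (par i ^ D i * g)" using form_mult[OF fu fg] unfolding tot .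
  ultimately have "par i ^ D i * g \<in> VV S D t" unfolding VV_iff tot by auto
  with 1 show ?thesis by blast
qed

text \<open>Each unit of order costs at most one dimension by \<open>dim_VV_step\<close> and at
  least one by \<open>VV_strict\<close>.\<close>

lemma dim_VV_large:
  assumes S: "S \<subseteq> {1..n}" and "sum D S \<le> t"
  shows "lin.dim (forms t :: 'k poly3 set) = lin.dim (VV S D t) + sum D S"
  using assms(2)
proof (induction "sum D S" arbitrary: D)
  case 0
  then have "D i = 0" if "i \<in> S" for i using that finite_index[OF S] by simp
  then show ?case using VV_cong[of S D "\<lambda>_. 0" t] 0 by (simp add: VV_0)
next
  case (Suc k)
  then obtain i where i: "i \<in> S" "D i > 0" by (metis gr0I nat.simps(3) sum.neutral)
  let ?D = "D(i := D i - 1)"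
  have s: "sum D S = Suc (sum ?D S)"
    using i finite_index[OF S] by (simp add: sum.remove[of S i] sum.remove[of S i D])
  have DD: "?D(i := Suc (?D i)) = D" using i by auto
  have IH: "lin.dim (forms t :: 'k poly3 set) = lin.dim (VV S ?D t) + sum ?D S"
    using Suc s by (intro Suc(1)) auto
  have sub: "VV S D t \<subseteq> VV S ?D t" by (rule VV_antimono[OF S]) auto
  obtain A where A: "A \<in> VV S ?D t" "A \<notin> vord F (p i) (par i) (D i) t"
    using VV_strict[OF S i(1), of ?D t] Suc s i by auto
  then have "A \<notin> VV S D t" using i unfolding VV_iff by blast
  then have "VV S D t \<noteq> VV S ?D t" using A(1) by blast
  then have "lin.dim (VV S D t) < lin.dim (VV S ?D t)"
    using lin.fin_dim_subspace_eq[OF fin_dim_VV subspace_VV[OF S] subspace_VV[OF S] sub] by force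
  then show ?case using dim_VV_step[OF S i(1), of ?D t] IH s unfolding DD by simp
qed

text \<open>Multiplication by \<open>\<Psi>\<close>, a unit at the points of \<open>S\<close>, turns
  \<open>\<Phi> * B\<close> into a multiple of \<open>F\<close>, which has every order on the
  curve.\<close>

lemma VV_dvd:
  assumes S: "S \<subseteq> {1..n}" and F: "F = \<Phi> * \<Psi>" and \<Psi>: "\<And>i. i \<in> S \<Longrightarrow> eval3 \<Psi> (p i) \<noteq> 0"
    and B: "form t (\<Phi> * B)"
  shows "\<Phi> * B \<in> VV S D t"
proof -
  obtain e where e: "form e \<Psi>"
    using form_factors[of 3 \<Phi> \<Psi>] form_F F_nonzero F by metis
  have "\<Phi> * B \<in> vord F (p i) (par i) (D i) t" if "i \<in> S" for i
  proof (rule vord_cancel[OF e \<Psi>[OF that] B])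
    have eq: "\<Psi> * (\<Phi> * B) = F * B" by (simp add: F mult_ac)
    have i: "i \<in> {1..n}" using that S by blast
    show "\<Psi> * (\<Phi> * B) \<in> vord F (p i) (par i) (D i) (e + t)"
      using form_mult[OF e B] unfolding eq by (rule vord_multiple[OF point_nonzero[OF i]])
  qed
  then show ?thesis using B by (simp add: VV_iff)
qed

lemma VV_sum_subset:
  assumes S: "S \<subseteq> {1..n}" and F: "F = \<Phi> * \<Psi>" and \<Psi>: "\<And>i. i \<in> S \<Longrightarrow> eval3 \<Psi> (p i) \<noteq> 0"
    and \<Phi>: "form d \<Phi>" and A: "A \<in> VV S D t" and s: "d \<le> s"
  shows "{x + y |x y. x \<in> (*) A ` forms s \<and> y \<in> (*) \<Phi> ` forms (t + s - d)} \<subseteq> VV S D (t + s)"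
proof -
  have "A * B \<in> VV S D (t + s)" if "form s B" for B
    using VV_mult_form[OF that A] by (simp add: mult.commute add.commute)
  moreover have "\<Phi> * B \<in> VV S D (t + s)" if "form (t + s - d) B" for B
    using VV_dvd[OF S F \<Psi>, of "t + s" B D] form_mult[OF \<Phi> that] s by simp
  ultimately show ?thesis using lin.subspace_add[OF subspace_VV[OF S]] by fastforce
qed

text \<open>In large degree the forms in the ideal of \<open>A\<close> and \<open>\<Phi>\<close>
  have codimension \<open>d * t\<close>. All of them satisfy the conditions \<open>D\<close>, which
  there are \<open>sum D S\<close> independent ones.\<close>

lemma bezout:
  assumes S: "S \<subseteq> {1..n}" and F: "F = \<Phi> * \<Psi>" and \<Psi>: "\<And>i. i \<in> S \<Longrightarrow> eval3 \<Psi> (p i) \<noteq> 0"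
    and \<Phi>: "form d \<Phi>" and A: "A \<in> VV S D t" "A \<noteq> 0" and nz: "nonzerodiv_on \<Phi> A"
  shows "sum D S \<le> d * t"
proof -
  \<comment> \<open>At least \<open>d\<close> for the codimension of the ideal, at least
    \<open>sum D S\<close> for the independence of the conditions.\<close>
  let ?s = "d + sum D S"
  let ?W = "{x + y |x y. x \<in> (*) A ` forms ?s \<and> y \<in> (*) \<Phi> ` forms (t + ?s - d)}"
  have "lin.dim ?W + d * t = lin.dim (forms (t + ?s) :: 'k poly3 set)"
  proof (rule dim_ideal_sum[OF \<Phi> _ _ A(2) nz])
    show "\<Phi> \<noteq> 0" using F F_nonzero by auto
    show "form t A" using A(1) by (simp add: VV_iff)
  qed simp
  moreover have "lin.dim ?W \<le> lin.dim (VV S D (t + ?s))"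
    using VV_sum_subset[OF S F \<Psi> \<Phi> A(1), of ?s] by (intro lin.fin_dim_mono[OF fin_dim_VV]) auto
  moreover have "lin.dim (forms (t + ?s) :: 'k poly3 set) = lin.dim (VV S D (t + ?s)) + sum D S"
    by (rule dim_VV_large[OF S]) simp
  ultimately show ?thesis by simp
qed

text \<open>Max Noether's theorem for a form whose divisor on the curve is exactly \<open>D\<close>.\<close>

lemma noether:
  assumes S: "S \<subseteq> {1..n}" and A: "A \<in> VV S D t" "A \<noteq> 0" and nz: "nonzerodiv_on F A"
    and D: "sum D S = 3 * t" and G: "G \<in> VV S D s"
  shows "\<exists>r b. G = r * F + b * A"
proof (rule complete_intersection_saturated[OF nz F_nonzero A(2)])
  \<comment> \<open>Chosen so that \<open>t + ?s = ?N + s\<close> is the degree of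
    \<open>M * G\<close>, with \<open>?s\<close> at least \<open>3\<close> and the total degree at
    least \<open>3 * t\<close>.\<close>
  let ?N = "3 + 4 * t" let ?s = "3 + 3 * t + s"
  fix M :: "'k poly3" assume M: "form ?N M"
  let ?W = "{x + y |x y. x \<in> (*) A ` forms ?s \<and> y \<in> (*) F ` forms (t + ?s - 3)}"
  have s: "?N + s = t + ?s" by simp
  have "M * G \<in> VV S D (t + ?s)" using VV_mult_form[OF M G] unfolding s .
  \<comment> \<open>Both spaces have codimension \<open>3 * t\<close> in this degree, so the
    inclusion is an equality.\<close>
  moreover have "?W = VV S D (t + ?s)"
  proof (rule lin.fin_dim_subspace_eq[OF fin_dim_VV subspace_VV[OF S]])
    show "lin.subspace ?W"
      using subspace_mult_image subspace_forms by (intro lin.subspace_sums) blast+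
    show "?W \<subseteq> VV S D (t + ?s)"
      using VV_sum_subset[OF S, of F 1 3 A D t ?s] form_F A(1) by simp
    have "lin.dim ?W + 3 * t = lin.dim (forms (t + ?s) :: 'k poly3 set)"
      using F_nonzero A nz by (intro dim_ideal_sum[OF form_F]) (auto simp: VV_iff)
    moreover have "lin.dim (forms (t + ?s) :: 'k poly3 set) = lin.dim (VV S D (t + ?s)) + sum D S"
      using D by (intro dim_VV_large[OF S]) simp
    ultimately show "lin.dim (VV S D (t + ?s)) \<le> lin.dim ?W" using D by simp
  qed
  ultimately have "M * G \<in> ?W" by simp
  then obtain b c where "M * G = A * b + F * c" by blast
  then have "M * G = c * F + b * A" by (simp add: mult.commute)
  then show "\<exists>r b. M * G = r * F + b * A" by blast
qed

lemma noether_form: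
  assumes S: "S \<subseteq> {1..n}" and A: "A \<in> VV S D t" "A \<noteq> 0" and nz: "nonzerodiv_on F A"
    and D: "sum D S = 3 * t" and G: "G \<in> VV S D (t + s)"
  shows "\<exists>b. form s b \<and> F dvd G - A * b"
proof -
  obtain r b where "G = r * F + b * A" using noether[OF assms] by blast
  then have rb: "G = F * r + A * b" by (simp add: mult.commute)
  have "hcomp (t + s) G = hcomp (t + s) (F * r) + A * hcomp s b"
    using hcomp_mult_form[of t A s b] A unfolding rb hcomp_add by (simp add: VV_iff)
  moreover have "F dvd hcomp (t + s) (F * r)" unfolding hcomp_mult_form'[OF form_F] by simp
  moreover have "hcomp (t + s) G = G" using G hcomp_form[of "t + s" G "t + s"] by (simp add: VV_iff)
  ultimately show ?thesis using form_hcomp by (metis add_diff_cancel_right')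
qed

end

section \<open>Factorisation of a squarefree form\<close>

lemma not_irreducible_factors:
  assumes "F \<noteq> 0" "\<not> F dvd (1 :: 'k::field poly3)" "\<not> irreducible F"
  shows "\<exists>a b. F = a * b \<and> \<not> a dvd 1 \<and> \<not> b dvd 1"
proof (rule ccontr)
  assume *: "\<not> ?thesis"
  have "irreducible F"
  proof (rule irreducibleI[OF assms(1,2)])
    fix a b assume "F = a * b"
    with * show "a dvd 1 \<or> b dvd 1" by metis
  qed
  with assms(3) show False ..
qed

lemma irreducible_form_factor:
  fixes F :: "'k::field poly3"
  assumes "form d F" "F \<noteq> 0" "d > 0"
  shows "\<exists>\<Phi> e. irreducible \<Phi> \<and> \<Phi> dvd F \<and> form e \<Phi> \<and> e > 0"
  using assms
proof (induction d arbitrary: F rule: less_induct)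
  case (less d)
  show ?case
  proof (cases "irreducible F")
    case True
    then show ?thesis using less.prems by (intro exI[of _ F] exI[of _ d]) simp
  next
    case False
    have "\<exists>a b. F = a * b \<and> \<not> a dvd 1 \<and> \<not> b dvd 1"
      using not_irreducible_factors[OF less.prems(2) form_not_unit[OF less.prems(1,3)] False] .
    then obtain a b where ab: "F = a * b" "\<not> a dvd 1" "\<not> b dvd 1" by blast
    obtain i j where ij: "form i a" "form j b" "i + j = d"
      using form_factors[of d a b] less.prems ab(1) by metis
    have pos: "k > 0" if "form k x" "\<not> x dvd 1" "x \<noteq> 0" for k and x :: "'k poly3"
    proof (rule ccontr)
      assume "\<not> k > 0"
      then obtain c where "x = Const c" using form_0_eq_Const[of x] \<open>form k x\<close> by auto
      then show False using is_unit_Const[of c] that by auto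
    qed
    have nz: "a \<noteq> 0" "b \<noteq> 0" using ab(1) less.prems(2) by auto
    have "i > 0" "j > 0" using pos ij ab nz by blast+
    then obtain \<Phi> e where "irreducible \<Phi>" "\<Phi> dvd a" "form e \<Phi>" "e > 0"
      using less.IH[of i a] ij nz by auto
    then show ?thesis using ab(1) by (meson dvd_mult2)
  qed
qed

text \<open>Irreducible forms are split off one by one. Squarefreeness keeps an associate of a
  factor from occurring again, so a set records the factors and none of its members divides
  another.\<close>

lemma squarefree_form_factorization:
  fixes F :: "'k::field poly3"
  assumes "form d F" "F \<noteq> 0" "squarefree F"
  shows "\<exists>C c. finite C \<and> c \<noteq> 0 \<and> F = Const c * \<Prod>C \<and> (\<forall>\<Phi>\<in>C. irreducible \<Phi> \<and> (\<exists>e>0. form e \<Phi>)) \<and>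
    (\<forall>\<Phi>\<in>C. \<forall>\<Psi>\<in>C. \<Phi> \<noteq> \<Psi> \<longrightarrow> \<not> \<Phi> dvd \<Psi>)"
  using assms
proof (induction d arbitrary: F rule: less_induct)
  case (less d)
  show ?case
  proof (cases "d = 0")
    case True
    then obtain c where c: "F = Const c" using form_0_eq_Const less.prems(1) by blast
    then have "c \<noteq> 0" using less.prems(2) by auto
    then show ?thesis using c by (intro exI[of _ "{}"] exI[of _ c]) simp
  next
    case False
    then obtain \<Phi> e where \<Phi>: "irreducible \<Phi>" "\<Phi> dvd F" "form e \<Phi>" "e > 0"
      using irreducible_form_factor[OF less.prems(1,2)] by auto
    obtain G where G: "F = \<Phi> * G" using \<Phi>(2) by blast
    obtain i j where ij: "form i \<Phi>" "form j G" "i + j = d"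
      using form_factors[of d \<Phi> G] less.prems G by metis
    have nz: "\<Phi> \<noteq> 0" "G \<noteq> 0" using G less.prems(2) by auto
    have "i = e" using form_degree_unique[OF ij(1) \<Phi>(3) nz(1)] .
    then have lt: "j < d" using ij \<Phi>(4) by simp
    have sq: "squarefree G"
      unfolding squarefree_def
    proof (intro allI impI)
      fix x assume "x ^ 2 dvd G"
      then have "x ^ 2 dvd F" unfolding G by (rule dvd_mult)
      then show "x dvd 1" using less.prems(3) unfolding squarefree_def by blast
    qed
    have nd: "\<not> \<Phi> dvd G"
    proof
      assume "\<Phi> dvd G"
      then have "\<Phi> ^ 2 dvd F" unfolding G power2_eq_square by (rule mult_dvd_mono[OF dvd_refl])
      then have "\<Phi> dvd 1" using less.prems(3) unfolding squarefree_def by blast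
      then show False using irreducible_not_unit[OF \<Phi>(1)] by simp
    qed
    obtain C c where C: "finite C" "c \<noteq> 0" "G = Const c * \<Prod>C"
      "\<forall>\<Phi>\<in>C. irreducible \<Phi> \<and> (\<exists>e>0. form e \<Phi>)" "\<forall>\<Phi>\<in>C. \<forall>\<Psi>\<in>C. \<Phi> \<noteq> \<Psi> \<longrightarrow> \<not> \<Phi> dvd \<Psi>"
      using less.IH[OF lt ij(2) nz(2) sq] by metis
    have dv: "\<Psi> dvd G" if "\<Psi> \<in> C" for \<Psi>
      unfolding C(3) using C(1) that by (intro dvd_mult dvd_prodI)
    have nin: "\<Phi> \<notin> C" using dv nd by blast
    have nd1: "\<not> \<Phi> dvd \<Psi>" if "\<Psi> \<in> C" for \<Psi>
      using dv[OF that] nd dvd_trans by blast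
    have nd2: "\<not> \<Psi> dvd \<Phi>" if "\<Psi> \<in> C" for \<Psi>
    proof
      assume "\<Psi> dvd \<Phi>"
      then obtain x where x: "\<Phi> = \<Psi> * x" by blast
      have "\<not> \<Psi> dvd 1" using C(4) that irreducible_not_unit by blast
      then have "x dvd 1" using irreducibleD[OF \<Phi>(1) x] by blast
      then obtain y where y: "x * y = 1" by (metis dvdE)
      have "\<Phi> * y = \<Psi> * (x * y)" unfolding x by (rule mult.assoc)
      then have "\<Psi> = \<Phi> * y" unfolding y by simp
      then show False using nd1[OF that] by simp
    qed
    have "F = Const c * \<Prod>(insert \<Phi> C)" using C(1) nin by (simp add: G C(3) mult_ac)
    then show ?thesis
      using C(1,2,4,5) nd1 nd2 \<Phi> by (intro exI[of _ "insert \<Phi> C"] exI[of _ c]) auto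
  qed
qed

lemma prime_elem_dvd_prod_finite:
  assumes "prime_elem (q :: 'k::field poly3)" "finite C" "q dvd \<Prod>C" shows "\<exists>x\<in>C. q dvd x"
  using assms(2,3)
proof (induction C rule: finite_induct)
  case empty then show ?case using assms(1) by (auto simp: prime_elem_def)
next
  case (insert x C) then show ?case using assms(1) by (auto simp: prime_elem_dvd_mult_iff)
qed

lemma prime_prod_dvd:
  fixes C :: "'k::field poly3 set"
  assumes "finite C" "\<And>q. q \<in> C \<Longrightarrow> prime_elem q" "\<And>q r. q \<in> C \<Longrightarrow> r \<in> C \<Longrightarrow> q \<noteq> r \<Longrightarrow> \<not> q dvd r"
    and "\<And>q. q \<in> C \<Longrightarrow> q dvd A"
  shows "\<Prod>C dvd A"
  using assms
proof (induction C rule: finite_induct)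
  case (insert q C)
  have "\<Prod>C dvd A" by (rule insert.IH) (use insert.prems in simp_all)
  then obtain x where x: "A = \<Prod>C * x" by blast
  have "\<not> q dvd \<Prod>C" 
  proof
    assume "q dvd \<Prod>C"
    with prime_elem_dvd_prod_finite[OF insert.prems(1)[OF insertI1] insert.hyps(1)]
    obtain y where y: "y \<in> C" "q dvd y" by metis
    then have "q \<noteq> y" using insert.hyps(2) by metis
    then show False using insert.prems(2)[OF insertI1 insertI2[OF y(1)]] y(2) by metis
  qed
  moreover have "q dvd \<Prod>C * x" using insert.prems(3)[OF insertI1] unfolding x .
  ultimately have "q dvd x" using prime_elem_dvd_multD[OF insert.prems(1)[OF insertI1]] by metis
  then have "q * \<Prod>C dvd A" unfolding x by (subst mult.commute) (rule mult_dvd_mono[OF dvd_refl])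
  then show ?case using insert.hyps by simp
qed simp

lemma dim_Int_ge:
  fixes U J W :: "'k::field poly3 set"
  assumes "lin.fin_dim W" "lin.subspace W" "lin.subspace U" "lin.subspace J" "U \<subseteq> W" "J \<subseteq> W"
  shows "lin.dim U + lin.dim J \<le> lin.dim (U \<inter> J) + lin.dim W"
proof -
  have f: "lin.fin_dim U" "lin.fin_dim J" using assms lin.fin_dim_subset by blast+
  have "{x + y |x y. x \<in> U \<and> y \<in> J} \<subseteq> W" using assms(2,5,6) lin.subspace_add by blast
  then have "lin.dim {x + y |x y. x \<in> U \<and> y \<in> J} \<le> lin.dim W" by (rule lin.fin_dim_mono[OF assms(1)])
  with lin.dim_sums_Int[OF f assms(3,4)] show ?thesis by simp
qed

text \<open>The loss at each index is measured in its own ambient space \<open>W i\<close> around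
  \<open>U\<close>. Two choices are needed: all forms, and the forms of given order on the
  curve.\<close>

lemma dim_INT_ge:
  fixes U :: "'k::field poly3 set"
  assumes "finite S" "lin.subspace U"
    and W: "\<And>i. i \<in> S \<Longrightarrow> lin.fin_dim (W i)" "\<And>i. i \<in> S \<Longrightarrow> lin.subspace (W i)" "\<And>i. i \<in> S \<Longrightarrow> U \<subseteq> W i"
    and J: "\<And>i. i \<in> S \<Longrightarrow> lin.subspace (J i)" "\<And>i. i \<in> S \<Longrightarrow> J i \<subseteq> W i"
      "\<And>i. i \<in> S \<Longrightarrow> lin.dim (W i) \<le> lin.dim (J i) + k"
  shows "lin.dim U \<le> lin.dim (U \<inter> (\<Inter>i\<in>S. J i)) + card S * k"
  using assms
proof (induction S rule: finite_induct)
  case (insert i S)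
  let ?U = "U \<inter> (\<Inter>i\<in>S. J i)"
  have s: "lin.subspace ?U" using insert by (intro lin.subspace_inter lin.subspace_Int) auto
  have "lin.dim ?U + lin.dim (J i) \<le> lin.dim (?U \<inter> J i) + lin.dim (W i)"
    using insert.prems by (intro dim_Int_ge s) auto
  moreover have "lin.dim (W i) \<le> lin.dim (J i) + k" using insert.prems by simp
  moreover have "lin.dim U \<le> lin.dim ?U + card S * k" using insert by simp
  moreover have "?U \<inter> J i = U \<inter> (\<Inter>i\<in>insert i S. J i)" by auto
  ultimately show ?case using insert.hyps by simp
qed simp

section \<open>Components of an evenly marked cubic\<close>

locale cubic = marked_cubic F p n
  for F :: "'k::field poly3" and p :: "nat \<Rightarrow> 'k ^ 3" and n :: nat +
  fixes C :: "'k::field poly3 set" and c :: 'k and dg :: "'k poly3 \<Rightarrow> nat"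
  assumes finite_C: "finite C" and c_nonzero: "c \<noteq> 0" and F_eq: "F = Const c * \<Prod>C"
    and irred: "\<And>\<Phi>. \<Phi> \<in> C \<Longrightarrow> irreducible \<Phi>"
    and form_C: "\<And>\<Phi>. \<Phi> \<in> C \<Longrightarrow> form (dg \<Phi>) \<Phi>" and dg_pos: "\<And>\<Phi>. \<Phi> \<in> C \<Longrightarrow> dg \<Phi> > 0"
    and pairwise_C: "\<And>\<Phi> \<Psi>. \<Phi> \<in> C \<Longrightarrow> \<Psi> \<in> C \<Longrightarrow> \<Phi> \<noteq> \<Psi> \<Longrightarrow> \<not> \<Phi> dvd \<Psi>"
    and even: "\<And>\<Phi>. \<Phi> \<in> C \<Longrightarrow> 3 * card {i \<in> {1..n}. eval3 \<Phi> (p i) = 0} = n * dg \<Phi>"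
    and n9: "n \<ge> 9"
begin

definition on :: "'k poly3 \<Rightarrow> nat set" where
  "on \<Phi> = {i \<in> {1..n}. eval3 \<Phi> (p i) = 0}"

lemma on_subset: "on \<Phi> \<subseteq> {1..n}"
  by (auto simp: on_def)

lemma finite_on: "finite (on \<Phi>)"
  using finite_index[OF on_subset] .

lemma even_on: "\<Phi> \<in> C \<Longrightarrow> 3 * card (on \<Phi>) = n * dg \<Phi>"
  using even by (simp add: on_def)

lemma prime_C: "\<Phi> \<in> C \<Longrightarrow> prime_elem \<Phi>"
  by (rule irreducible_poly3_prime[OF irred])

lemma sum_dg: "sum dg C = 3"
proof (rule form_degree_unique[OF _ form_F F_nonzero])
  have "form (0 + sum dg C) (Const c * \<Prod>C)"
    using form_C by (intro form_mult form_Const form_prod)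
  then show "form (sum dg C) F" unfolding F_eq by simp
qed

definition cof :: "'k poly3 \<Rightarrow> 'k poly3" where
  "cof \<Phi> = Const c * \<Prod>(C - {\<Phi>})"

lemma F_cof: "\<Phi> \<in> C \<Longrightarrow> F = \<Phi> * cof \<Phi>"
  using finite_C prod.remove[of C \<Phi> "\<lambda>x. x"] by (simp add: F_eq cof_def mult_ac)

text \<open>Otherwise two factors of \<open>F\<close> would vanish at a smooth point.\<close>

lemma cof_nonzero: "\<Phi> \<in> C \<Longrightarrow> i \<in> on \<Phi> \<Longrightarrow> eval3 (cof \<Phi>) (p i) \<noteq> 0"
  using smooth_not_in_square[of \<Phi> "p i" "cof \<Phi>"] smooth[of i] F_cof[of \<Phi>] by (auto simp: on_def)

lemma on_disjoint:
  assumes "\<Phi> \<in> C" "\<Psi> \<in> C" "\<Phi> \<noteq> \<Psi>" shows "on \<Phi> \<inter> on \<Psi> = {}"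
proof -
  have "False" if "i \<in> on \<Phi>" "i \<in> on \<Psi>" for i
  proof -
    have "\<Psi> dvd \<Prod>(C - {\<Phi>})" using assms finite_C by (intro dvd_prodI) auto
    then have "\<Psi> dvd cof \<Phi>" unfolding cof_def by (rule dvd_mult)
    then have "eval3 (cof \<Phi>) (p i) = 0" using that(2) by (auto simp: on_def dest: eval3_dvd_0)
    then show False using cof_nonzero[OF assms(1) that(1)] by simp
  qed
  then show ?thesis by blast
qed

lemma Union_on: "(\<Union>\<Phi>\<in>C. on \<Phi>) = {1..n}"
proof
  show "{1..n} \<subseteq> (\<Union>\<Phi>\<in>C. on \<Phi>)"
  proof
    fix i assume i: "i \<in> {1..n}"
    have "eval3 F (p i) = c * (\<Prod>\<Phi>\<in>C. eval3 \<Phi> (p i))" by (simp add: F_eq eval3_prod)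
    then obtain \<Phi> where "\<Phi> \<in> C" "eval3 \<Phi> (p i) = 0"
      using on_curve[OF i] c_nonzero finite_C by auto
    then show "i \<in> (\<Union>\<Phi>\<in>C. on \<Phi>)" using i by (auto simp: on_def)
  qed
qed (use on_subset in blast)

lemma sum_on: "sum D {1..n} = (\<Sum>\<Phi>\<in>C. sum D (on \<Phi>))"
  unfolding Union_on[symmetric]
  by (rule sum.UNION_disjoint) (use finite_C finite_on on_disjoint in auto)

lemma all_dvd: "(\<And>\<Phi>. \<Phi> \<in> C \<Longrightarrow> \<Phi> dvd A) \<Longrightarrow> F dvd A"
proof -
  assume "\<And>\<Phi>. \<Phi> \<in> C \<Longrightarrow> \<Phi> dvd A"
  then have "\<Prod>C dvd A"
    by (intro prime_prod_dvd[OF finite_C prime_C pairwise_C])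
  then obtain x where "A = \<Prod>C * x" by blast
  then have "F * (Const (inverse c) * x) = (Const c * Const (inverse c)) * A"
    by (simp add: F_eq mult_ac)
  then have "A = F * (Const (inverse c) * x)"
    unfolding Const_inverse[OF c_nonzero] by simp
  then show "F dvd A" by simp
qed

lemma dvd_F: "\<Phi> \<in> C \<Longrightarrow> \<Phi> dvd F"
  using F_cof by (metis dvd_triv_left)

lemma nonzerodiv_if_none_dvd:
  assumes "\<And>\<Phi>. \<Phi> \<in> C \<Longrightarrow> \<not> \<Phi> dvd A" shows "nonzerodiv_on F A"
  unfolding nonzerodiv_on_def
proof (intro allI impI)
  fix B assume "F dvd A * B"
  then have "\<Phi> dvd B" if "\<Phi> \<in> C" for \<Phi>
    using dvd_trans[OF dvd_F[OF that]] prime_elem_dvd_multD[OF prime_C[OF that]] assms[OF that] by metis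
  then show "F dvd B" by (rule all_dvd)
qed

lemma bezout_component:
  assumes "\<Phi> \<in> C" "A \<in> VV (on \<Phi>) D t" "\<not> \<Phi> dvd A"
  shows "sum D (on \<Phi>) \<le> dg \<Phi> * t"
proof (rule bezout[OF on_subset F_cof[OF assms(1)] cof_nonzero[OF assms(1)] form_C[OF assms(1)] assms(2)])
  show "A \<noteq> 0" using assms(3) by auto
  show "nonzerodiv_on \<Phi> A"
    unfolding nonzerodiv_on_def using prime_elem_dvd_multD[OF prime_C[OF assms(1)]] assms(3) by metis
qed

lemma VV_restrict: "A \<in> VV {1..n} D t \<Longrightarrow> A \<in> VV (on \<Phi>) D t"
  using on_subset unfolding VV_iff by blast

text \<open>If \<open>\<Phi>\<close> but not \<open>\<Psi>\<close> divided \<open>A\<close>, the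
  quotient \<open>A'\<close> would keep its orders at the points on \<open>\<Psi>\<close>, where
  \<open>\<Phi>\<close> is nonzero, while the degree drops by \<open>dg \<Phi>\<close>; Bezout on
  \<open>\<Psi>\<close> forbids this. Thus a section of degree at most \<open>0\<close> on every
  component cannot vanish on only some of them, which is what makes reducible cubics behave like
  irreducible ones.\<close>

lemma dvd_if_one_dvd:
  assumes A: "A \<in> VV {1..n} D t" and D: "\<And>\<Phi>. \<Phi> \<in> C \<Longrightarrow> dg \<Phi> * t \<le> sum D (on \<Phi>)"
    and \<Phi>: "\<Phi> \<in> C" "\<Phi> dvd A"
  shows "F dvd A"
proof (rule ccontr)
  assume nd: "\<not> F dvd A"
  then obtain \<Psi> where \<Psi>: "\<Psi> \<in> C" "\<not> \<Psi> dvd A" using all_dvd[of A] by metis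
  obtain A' where A': "A = \<Phi> * A'" using \<Phi>(2) by blast
  have nz: "\<Phi> \<noteq> 0" "A' \<noteq> 0" using nd A' by auto
  have fA: "form t A" using A by (simp add: VV_iff)
  have le: "dg \<Phi> \<le> t"
    using form_quotient_small[OF form_C[OF \<Phi>(1)] nz(1)] fA A' nz(2) by force
  have fA': "form (t - dg \<Phi>) A'" using form_quotient[OF form_C[OF \<Phi>(1)] nz(1) _ le] fA A' by blast
  have "A' \<in> VV (on \<Psi>) D (t - dg \<Phi>)"
    unfolding VV_iff
  proof (intro conjI ballI fA')
    fix i assume i: "i \<in> on \<Psi>"
    have "\<Phi> \<noteq> \<Psi>" using \<Psi>(2) \<Phi>(2) by metis
    then have "i \<notin> on \<Phi>" using on_disjoint[OF \<Phi>(1) \<Psi>(1)] i by blast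
    then have "eval3 \<Phi> (p i) \<noteq> 0" using i by (auto simp: on_def)
    moreover have "\<Phi> * A' \<in> vord F (p i) (par i) (D i) (dg \<Phi> + (t - dg \<Phi>))"
      using VV_restrict[OF A, of \<Psi>] i le A' by (auto simp: VV_iff)
    ultimately show "A' \<in> vord F (p i) (par i) (D i) (t - dg \<Phi>)"
      using vord_cancel[OF form_C[OF \<Phi>(1)] _ fA'] by blast
  qed
  moreover have "\<not> \<Psi> dvd A'" using \<Psi>(2) A' by auto
  ultimately have "sum D (on \<Psi>) \<le> dg \<Psi> * (t - dg \<Phi>)" by (rule bezout_component[OF \<Psi>(1)])
  also have "\<dots> < dg \<Psi> * t" using dg_pos[OF \<Phi>(1)] dg_pos[OF \<Psi>(1)] le by simp
  finally show False using D[OF \<Psi>(1)] by simp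
qed

lemma nonzerodiv_if_not_dvd:
  assumes "A \<in> VV {1..n} D t" "\<And>\<Phi>. \<Phi> \<in> C \<Longrightarrow> dg \<Phi> * t \<le> sum D (on \<Phi>)" "\<not> F dvd A"
  shows "nonzerodiv_on F A"
  using nonzerodiv_if_none_dvd[of A] dvd_if_one_dvd[OF assms(1,2)] assms(3) by metis

lemma dvd_if_excess:
  assumes "A \<in> VV {1..n} D t" "\<And>\<Phi>. \<Phi> \<in> C \<Longrightarrow> dg \<Phi> * t \<le> sum D (on \<Phi>)"
    and \<Phi>: "\<Phi> \<in> C" "dg \<Phi> * t < sum D (on \<Phi>)"
  shows "F dvd A"
proof (rule dvd_if_one_dvd[OF assms(1,2) \<Phi>(1)])
  show "\<Phi> dvd A"
    using bezout_component[OF \<Phi>(1) VV_restrict[OF assms(1)]] \<Phi>(2) by fastforce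
qed

lemma component_through:
  assumes "i \<in> {1..n}" obtains \<Phi> where "\<Phi> \<in> C" "i \<in> on \<Phi>"
  using assms Union_on by blast

lemma sum_upd_less:
  fixes D :: "nat \<Rightarrow> nat"
  assumes "finite S" "i \<in> S" shows "sum (D(i := Suc (D i))) S = Suc (sum D S)"
  using assms by (simp add: sum.remove[of S i] sum.remove[of S i D])

text \<open>The extra zero makes the degree negative on the component through \<open>p i\<close>. In
  degree \<open>0\<close> a section that is not identically zero therefore has no order beyond
  \<open>D\<close> at any marked point.\<close>

lemma dvd_if_excess_point:
  assumes A: "A \<in> VV {1..n} (D(i := Suc (D i))) t" and D: "\<And>\<Phi>. \<Phi> \<in> C \<Longrightarrow> dg \<Phi> * t \<le> sum D (on \<Phi>)"
    and i: "i \<in> {1..n}"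
  shows "F dvd A"
proof -
  obtain \<Phi> where \<Phi>: "\<Phi> \<in> C" "i \<in> on \<Phi>" using component_through[OF i] .
  have "sum D (on \<Psi>) \<le> sum (D(i := Suc (D i))) (on \<Psi>)" for \<Psi> by (rule sum_mono) auto
  then have "dg \<Psi> * t \<le> sum (D(i := Suc (D i))) (on \<Psi>)" if "\<Psi> \<in> C" for \<Psi>
    using D[OF that] le_trans by blast
  moreover have "dg \<Phi> * t < sum (D(i := Suc (D i))) (on \<Phi>)"
    using sum_upd_less[OF finite_on \<Phi>(2), of D] D[OF \<Phi>(1)] by simp
  ultimately show ?thesis using dvd_if_excess[OF A _ \<Phi>(1)] by blast
qed

end

section \<open>Sections on the cubic in positive, negative and zero degree\<close>

text \<open>The lines through \<open>p\<close> form a space of dimension two: if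
  \<open>LL p i\<close> is a multiple of \<open>a\<close>, evaluation at \<open>axis i 1\<close>
  excludes this for \<open>LL p j\<close>.\<close>

lemma LL_not_all_multiples:
  fixes p :: "'k::field ^ 3"
  obtains l where "\<And>x. LL p l \<noteq> Const x * a"
proof -
  obtain i j where ij: "i \<noteq> j" "i \<noteq> piv p" "j \<noteq> piv p" "UNIV = {piv p, i, j}"
    using other_coordinates[of "piv p"] .
  show ?thesis
  proof (cases "\<exists>x. LL p i = Const x * a")
    case True
    then obtain x where x: "LL p i = Const x * a" by metis
    have "LL p j \<noteq> Const y * a" for y
    proof
      assume y: "LL p j = Const y * a"
      have "x * eval3 a (axis i 1) = 1" "y * eval3 a (axis i 1) = 0"
        using arg_cong[OF x, of "\<lambda>G. eval3 G (axis i 1)"] arg_cong[OF y, of "\<lambda>G. eval3 G (axis i 1)"]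
          eval_axis_LL[OF ij(2)] ij(1) by auto
      then have "y = 0" by auto
      then have "LL p j = 0" using y by simp
      then show False using eval_axis_LL[OF ij(3), of j] by simp
    qed
    then show ?thesis using that by metis
  next
    case False then show ?thesis using that by metis
  qed
qed

text \<open>Modulo multiples of a cubic the forms of degree \<open>t + 3\<close> have dimension
  \<open>3 * (t + 3)\<close>, the degree of the line bundle on a curve of arithmetic genus
  one.\<close>

lemma choose_shift: "((t + 3 + 2) choose 2) = ((t + 2) choose 2) + 3 * (t + 3)"
  by (simp add: numeral_eq_Suc)

context cubic
begin

lemma VV_D: "A \<in> VV S D t \<Longrightarrow> i \<in> S \<Longrightarrow> A \<in> vord F (p i) (par i) (D i) t"
  unfolding VV_iff by blast

abbreviation F_forms :: "nat \<Rightarrow> 'k poly3 set" where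
  "F_forms t \<equiv> (*) F ` forms t"

lemma dim_F_forms: "lin.dim (F_forms t) = (t + 2) choose 2"
  using dim_mult_image[OF F_nonzero] by (simp add: dim_forms)

lemma F_forms_subset: "F_forms t \<subseteq> forms (t + 3)"
  using form_mult[OF form_F] by (auto simp: add.commute)

lemma F_forms_VV: "S \<subseteq> {1..n} \<Longrightarrow> F_forms t \<subseteq> VV S D (t + 3)"
  using VV_dvd[of S F 1 "t + 3" _ D] F_forms_subset[of t] by auto

lemma dvd_in_F_forms: "form (t + 3) A \<Longrightarrow> F dvd A \<Longrightarrow> A \<in> F_forms t"
proof -
  assume "form (t + 3) A" "F dvd A"
  then obtain x where x: "A = F * x" "form (t + 3) (F * x)" by (metis dvdE)
  then have "form t x" using form_quotient[OF form_F F_nonzero x(2)] by simp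
  then show "A \<in> F_forms t" using x(1) by auto
qed

lemma subspace_F_forms: "lin.subspace (F_forms t)"
  using subspace_mult_image subspace_forms by blast

lemma fin_dim_F_forms: "lin.fin_dim (F_forms t)"
  using lin.fin_dim_subset[OF fin_dim_forms F_forms_subset] .

text \<open>A squeeze: raising the orders from \<open>m\<close> to \<open>D\<close> costs at most
  one dimension per unit and ends inside the multiples of \<open>F\<close>, whose codimension is
  \<open>3 * (t + 3) = sum D {1..n}\<close>. Hence the conditions of order \<open>m\<close> already
  have their full effect.\<close>

lemma full_if_all_dvd:
  assumes D: "\<And>i. i \<in> {1..n} \<Longrightarrow> m \<le> D i" "sum D {1..n} = 3 * (t + 3)"
    and "\<And>A. A \<in> VV {1..n} D (t + 3) \<Longrightarrow> F dvd A"
  shows "lin.dim (forms (t + 3) :: 'k poly3 set) = lin.dim (VV {1..n} (\<lambda>_. m) (t + 3)) + n * m"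
proof (rule antisym)
  show "lin.dim (forms (t + 3) :: 'k poly3 set) \<le> lin.dim (VV {1..n} (\<lambda>_. m) (t + 3)) + n * m"
    using dim_forms_le_VV[of "{1..n}" "t + 3" "\<lambda>_. m"] by simp
  have "VV {1..n} D (t + 3) \<subseteq> F_forms t"
  proof
    fix A assume A: "A \<in> VV {1..n} D (t + 3)"
    show "A \<in> F_forms t"
      by (rule dvd_in_F_forms[OF _ assms(3)[OF A]]) (use A in \<open>simp add: VV_iff\<close>)
  qed
  then have "lin.dim (VV {1..n} D (t + 3)) \<le> (t + 2) choose 2"
    using lin.fin_dim_mono[OF fin_dim_F_forms] by (simp add: dim_F_forms)
  moreover have "lin.dim (VV {1..n} (\<lambda>_. m) (t + 3)) + n * m \<le> lin.dim (VV {1..n} D (t + 3)) + 3 * (t + 3)"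
    using dim_VV_le[of "{1..n}" "\<lambda>_. m" D "t + 3"] D by simp
  ultimately show "lin.dim (VV {1..n} (\<lambda>_. m) (t + 3)) + n * m \<le> lin.dim (forms (t + 3) :: 'k poly3 set)"
    using choose_shift[of t] by (simp add: dim_forms)
qed

lemma sum_total:
  assumes "\<And>\<Phi>. \<Phi> \<in> C \<Longrightarrow> sum D (on \<Phi>) = dg \<Phi> * t" shows "sum D {1..n} = 3 * t"
proof -
  have "sum D {1..n} = (\<Sum>\<Phi>\<in>C. dg \<Phi> * t)" unfolding sum_on using assms by (intro sum.cong refl)
  also have "\<dots> = sum dg C * t" by (rule sum_distrib_right[symmetric])
  finally show ?thesis unfolding sum_dg .
qed

text \<open>Two sections whose divisors differ by \<open>p\<^sub>i - p\<^sub>j\<close> would give a rational function \<open>f\<close>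
  on the curve mapping the pencil of lines through \<open>p\<^sub>i\<close> to the pencil through \<open>p\<^sub>j\<close>; the identity
  \<open>a (f b) = b (f a)\<close> between conics holds modulo a cubic, hence holds in the plane.\<close>

lemma no_degree_one_pencil:
  assumes i: "i \<in> {1..n}" and j: "j \<in> {1..n}" and ij: "i \<noteq> j"
    and even1: "\<And>\<Phi>. \<Phi> \<in> C \<Longrightarrow> sum (E(i := Suc (E i))) (on \<Phi>) = dg \<Phi> * t"
    and even2: "\<And>\<Phi>. \<Phi> \<in> C \<Longrightarrow> sum (E(j := Suc (E j))) (on \<Phi>) = dg \<Phi> * t"
    and A1: "A1 \<in> VV {1..n} (E(i := Suc (E i))) t" and n1: "\<not> F dvd A1"
    and A2: "A2 \<in> VV {1..n} (E(j := Suc (E j))) t" and n2: "\<not> F dvd A2"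
  shows False
proof -
  let ?D1 = "E(i := Suc (E i))" and ?D2 = "E(j := Suc (E j))"
  have nz1: "nonzerodiv_on F A1" using nonzerodiv_if_not_dvd[OF A1 _ n1] even1 by simp
  have nz2: "nonzerodiv_on F A2" using nonzerodiv_if_not_dvd[OF A2 _ n2] even2 by simp
  have A10: "A1 \<noteq> 0" using n1 by auto
  have sum1: "sum ?D1 {1..n} = 3 * t" using even1 by (rule sum_total)
  have transfer: "\<exists>c. form 1 c \<and> F dvd A2 * a - A1 * c \<and> eval3 c (p j) = 0"
    if a: "form 1 a" "eval3 a (p i) = 0" for a
  proof -
    \<comment> \<open>Only at \<open>p i\<close> is the order of \<open>A2\<close> guaranteed to be
      one short of \<open>?D1\<close>, and the line \<open>a\<close> supplies the missing unit. At
      the other points \<open>?D2\<close> is at least \<open>?D1\<close>.\<close>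
    have "A2 * a \<in> vord F (p k) (par k) (?D1 k) (t + 1)" if k: "k \<in> {1..n}" for k
    proof (cases "k = i")
      case True
      have "A2 * a \<in> vord F (p i) (par i) (E i + 1) (t + 1)"
        using VV_D[OF A2 i] ij by (intro vord_mult vord_1[OF par[OF i] a]) simp
      then show ?thesis using True by simp
    next
      case False
      have "A2 * a \<in> vord F (p k) (par k) (?D2 k + 0) (t + 1)"
        by (rule vord_mult[OF VV_D[OF A2 k] vord_0[OF a(1)]])
      moreover have "?D1 k \<le> ?D2 k + 0" using False by simp
      ultimately show ?thesis using vord_antimono[OF form_par[OF k]] by blast
    qed
    moreover have "form (t + 1) (A2 * a)" using A2 a by (intro form_mult) (auto simp: VV_iff)
    ultimately have "A2 * a \<in> VV {1..n} ?D1 (t + 1)" unfolding VV_iff by metis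
    from noether_form[OF order_refl A1 A10 nz1 sum1 this]
    obtain c where c: "form 1 c" "F dvd A2 * a - A1 * c" by metis
    \<comment> \<open>The product \<open>A2 * a\<close> has order above \<open>E j\<close> at
      \<open>p j\<close>. If \<open>c\<close> were nonzero there, \<open>A1\<close> would acquire an
      extra zero at \<open>p j\<close>, which degree \<open>0\<close> forbids.\<close>
    have "eval3 c (p j) = 0"
    proof (rule ccontr)
      assume ne: "eval3 c (p j) \<noteq> 0"
      obtain x where x: "A2 * a - A1 * c = F * x" using c(2) by (metis dvdE)
      have fA1: "form t A1" using A1 by (simp add: VV_iff)
      have f1: "form (t + 1) (F * x)" unfolding x[symmetric]
        using A1 A2 a c(1) by (intro form_diff form_mult) (auto simp: VV_iff)
      have "A2 * a \<in> vord F (p j) (par j) (Suc (E j) + 0) (t + 1)"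
        using VV_D[OF A2 j] a by (intro vord_mult vord_0) auto
      moreover have "F * x \<in> vord F (p j) (par j) (Suc (E j)) (t + 1)"
        using vord_multiple[OF point_nonzero[OF j] f1] .
      ultimately have "A2 * a - F * x \<in> vord F (p j) (par j) (Suc (E j)) (t + 1)"
        using lin.subspace_diff[OF subspace_vord[OF point_nonzero[OF j]]] by simp
      moreover have "A2 * a - F * x = c * A1" using x by (simp add: algebra_simps)
      ultimately have "A1 \<in> vord F (p j) (par j) (Suc (E j)) t"
        using vord_cancel[OF c(1) ne fA1] by (simp add: add.commute)
      then have "A1 \<in> VV {1..n} (?D1(j := Suc (?D1 j))) t"
        using A1 ij unfolding VV_iff by (simp split: if_splits)
      then have "F dvd A1" using even1 j by (intro dvd_if_excess_point[where D = ?D1 and i = j]) auto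
      with n1 show False ..
    qed
    with c show ?thesis by metis
  qed
  obtain a where a: "form 1 a" "eval3 a (p i) = 0" "eval3 a (p j) \<noteq> 0"
    using separating_line[OF point_nonzero[OF i] point_nonzero[OF j] distinct[OF i j ij]] .
  obtain l where l: "\<And>x. LL (p i) l \<noteq> Const x * a"
    using LL_not_all_multiples[of "p i" a] by metis
  define b where "b = LL (p i) l"
  have b: "form 1 b" "eval3 b (p i) = 0"
    unfolding b_def using form_LL eval_LL[OF point_nonzero[OF i]] by metis+
  obtain c where c: "form 1 c" "F dvd A2 * a - A1 * c" "eval3 c (p j) = 0" using transfer[OF a(1,2)] by metis
  obtain d where d: "form 1 d" "F dvd A2 * b - A1 * d" using transfer[OF b] by metis
  have "A1 * (c * b - d * a) = (A2 * b - A1 * d) * a - (A2 * a - A1 * c) * b"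
    by (simp add: algebra_simps)
  then have "F dvd A1 * (c * b - d * a)" using c(2) d(2) by (simp add: dvd_diff dvd_mult2)
  then have "F dvd c * b - d * a" using nonzerodiv_onD[OF nz1] by metis
  then obtain x where x: "c * b - d * a = F * x" by (metis dvdE)
  have "form (1 + 1) (F * x)" unfolding x[symmetric]
    by (intro form_diff form_mult c d b a)
  then have "x = 0" by (rule form_quotient_small[OF form_F F_nonzero]) simp
  then have "a dvd c * b" using x by simp
  moreover have a0: "a \<noteq> 0" using a(3) by auto
  ultimately have "a dvd c \<or> a dvd b"
    using prime_elem_dvd_multD[OF linear_form_prime[OF a(1)]] by metis
  moreover have "\<not> a dvd b" using linear_dvd_linear[OF a(1) b(1)] l unfolding b_def by metis
  ultimately obtain y where y: "c = Const y * a" using linear_dvd_linear[OF a(1) c(1)] by metis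
  \<comment> \<open>The line \<open>c\<close> passes through \<open>p j\<close>, and
    \<open>a\<close> does not.\<close>
  then have "y = 0" using c(3) a(3) by simp
  then have "F dvd A2 * a" using c(2) y by simp
  then have "F dvd a" using nonzerodiv_onD[OF nz2] by metis
  then obtain z where z: "a = F * z" by (metis dvdE)
  have "z = 0" by (rule form_quotient_small[OF form_F F_nonzero, of 1]) (use a(1) z in simp_all)
  then show False using z a0 by simp
qed

lemma card_on: "\<Phi> \<in> C \<Longrightarrow> 3 \<le> card (on \<Phi>)"
proof -
  assume \<Phi>: "\<Phi> \<in> C"
  have "9 * 1 \<le> n * dg \<Phi>" using n9 dg_pos[OF \<Phi>] by (intro mult_le_mono) auto
  then show ?thesis using even_on[OF \<Phi>] by simp
qed

lemma C_nonempty: "C \<noteq> {}"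
  using sum_dg by auto

lemma sum_const_on: "\<Phi> \<in> C \<Longrightarrow> 3 * (\<Sum>i\<in>on \<Phi>. m) = n * m * dg \<Phi>"
  using even_on[of \<Phi>] by (simp add: mult.commute mult.left_commute)

text \<open>The excess degree of each component is concentrated at one marked point
  \<open>q \<Phi>\<close>, which gives \<open>D\<close> with sum \<open>dg \<Phi> * ?t\<close> on
  every component. If the resulting class of degree \<open>0\<close> has a section, moving one unit
  of \<open>D\<close> to another point of the same component gives a class without one, by
  \<open>no_degree_one_pencil\<close>. Either way \<open>full_if_all_dvd\<close> applies.\<close>

lemma positive_case:
  assumes t: "n * m < 3 * (t + 3)"
  shows "lin.dim (forms (t + 3) :: 'k poly3 set) = lin.dim (VV {1..n} (\<lambda>_. m) (t + 3)) + n * m"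
proof -
  let ?t = "t + 3"
  have lt: "m * card (on \<Phi>) < dg \<Phi> * ?t" if "\<Phi> \<in> C" for \<Phi>
  proof -
    have "3 * (m * card (on \<Phi>)) = n * m * dg \<Phi>" using sum_const_on[OF that, of m] by (simp add: mult.commute)
    also have "\<dots> < 3 * ?t * dg \<Phi>" using t dg_pos[OF that] by (intro mult_strict_right_mono)
    also have "3 * ?t * dg \<Phi> = 3 * (dg \<Phi> * ?t)" by (simp only: mult_ac)
    finally show ?thesis by linarith
  qed
  have "\<exists>i. i \<in> on \<Phi>" if "\<Phi> \<in> C" for \<Phi>
    using card_on[OF that] by (metis card.empty equals0I not_numeral_le_zero)
  then have "\<forall>\<Phi>\<in>C. \<exists>i. i \<in> on \<Phi>" by blast
  from bchoice[OF this] obtain q where q: "\<And>\<Phi>. \<Phi> \<in> C \<Longrightarrow> q \<Phi> \<in> on \<Phi>" by blast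
  define x where "x \<Phi> = dg \<Phi> * ?t - m * card (on \<Phi>)" for \<Phi>
  define D where "D i = m + (\<Sum>\<Phi>\<in>C. if q \<Phi> = i then x \<Phi> else 0)" for i
  have q_on: "q \<Psi> \<in> on \<Phi> \<longleftrightarrow> \<Psi> = \<Phi>" if "\<Phi> \<in> C" "\<Psi> \<in> C" for \<Phi> \<Psi>
    using q[OF that(2)] q[OF that(1)] on_disjoint[OF that] by blast
  have sumD: "sum D (on \<Phi>) = dg \<Phi> * ?t" if \<Phi>: "\<Phi> \<in> C" for \<Phi>
  proof -
    have "sum D (on \<Phi>) = m * card (on \<Phi>) + (\<Sum>i\<in>on \<Phi>. \<Sum>\<Psi>\<in>C. if q \<Psi> = i then x \<Psi> else 0)"
      by (simp add: D_def sum.distrib mult.commute)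
    also have "(\<Sum>i\<in>on \<Phi>. \<Sum>\<Psi>\<in>C. if q \<Psi> = i then x \<Psi> else 0) = (\<Sum>\<Psi>\<in>C. \<Sum>i\<in>on \<Phi>. if q \<Psi> = i then x \<Psi> else 0)"
      by (rule sum.swap)
    also have "\<dots> = (\<Sum>\<Psi>\<in>C. if \<Psi> = \<Phi> then x \<Phi> else 0)"
      using q_on[OF \<Phi>] by (intro sum.cong refl) (simp add: finite_on)
    also have "\<dots> = x \<Phi>" using \<Phi> finite_C by simp
    finally show ?thesis using lt[OF \<Phi>] by (simp add: x_def)
  qed
  obtain \<Phi> where \<Phi>: "\<Phi> \<in> C" using C_nonempty by blast
  define i where "i = q \<Phi>"
  have i: "i \<in> on \<Phi>" "i \<in> {1..n}" using q[OF \<Phi>] on_subset[of \<Phi>] unfolding i_def by blast+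
  \<comment> \<open>Even distribution and \<open>n \<ge> 9\<close> put at least three marked points
    on each component. The second point lies on the same component, so all degrees stay
    \<open>0\<close> when the unit is moved.\<close>
  have "\<not> on \<Phi> \<subseteq> {i}" using card_on[OF \<Phi>] card_mono[of "{i}" "on \<Phi>"] by auto
  then obtain j where j: "j \<in> on \<Phi>" "j \<noteq> i" by blast
  then have jn: "j \<in> {1..n}" using on_subset[of \<Phi>] by blast
  have xi: "x \<Phi> \<le> (\<Sum>\<Psi>\<in>C. if q \<Psi> = i then x \<Psi> else 0)"
    using member_le_sum[of \<Phi> C "\<lambda>\<Psi>. if q \<Psi> = i then x \<Psi> else 0"] \<Phi> finite_C by (simp add: i_def)
  moreover have "x \<Phi> > 0" using lt[OF \<Phi>] by (simp add: x_def)
  ultimately have Di: "D i \<ge> Suc m" by (simp add: D_def)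
  \<comment> \<open>One unit is taken away at \<open>p i\<close>; the orders are still at least
    \<open>m\<close> because the excess \<open>x \<Phi>\<close> is positive.\<close>
  define E where "E = D(i := D i - 1)"
  have D1: "E(i := Suc (E i)) = D" using Di by (auto simp: E_def)
  have mD: "m \<le> D k" for k by (simp add: D_def)
  have mE: "m \<le> E k" for k using mD[of k] Di by (cases "k = i") (auto simp: E_def)
  have sumE: "sum (E(j := Suc (E j))) (on \<Psi>) = dg \<Psi> * ?t" if "\<Psi> \<in> C" for \<Psi>
  proof (cases "\<Psi> = \<Phi>")
    case True
    have "sum D (on \<Phi>) = Suc (sum E (on \<Phi>))"
      using sum_upd_less[OF finite_on i(1), of E] unfolding D1 .
    then show ?thesis using sum_upd_less[OF finite_on j(1), of E] sumD[OF \<Phi>] True by simp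
  next
    case False
    then have "i \<notin> on \<Psi>" "j \<notin> on \<Psi>" using on_disjoint[OF \<Phi> that] i j by blast+
    then have "sum (E(j := Suc (E j))) (on \<Psi>) = sum D (on \<Psi>)"
      unfolding E_def by (intro sum.cong refl) auto
    then show ?thesis using sumD[OF that] by simp
  qed
  have tot: "sum D' {1..n} = 3 * ?t" if "\<And>\<Phi>. \<Phi> \<in> C \<Longrightarrow> sum D' (on \<Phi>) = dg \<Phi> * ?t" for D'
    using that by (rule sum_total)
  have totD: "sum D {1..n} = 3 * ?t" by (rule tot) (rule sumD)
  have totE: "sum (E(j := Suc (E j))) {1..n} = 3 * ?t" by (rule tot) (rule sumE)
  show ?thesis
  proof (cases "\<forall>A\<in>VV {1..n} D ?t. F dvd A")
    case True
    show ?thesis by (rule full_if_all_dvd[OF mD totD]) (rule bspec[OF True])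
  next
    case False
    then obtain A1 where A1: "A1 \<in> VV {1..n} D ?t" "\<not> F dvd A1" by metis
    show ?thesis
    proof (rule full_if_all_dvd[OF _ totE])
      show "m \<le> (E(j := Suc (E j))) k" for k using mE[of k] mE[of j] by simp
      fix A2 assume A2: "A2 \<in> VV {1..n} (E(j := Suc (E j))) ?t"
      show "F dvd A2"
      proof (rule ccontr)
        assume "\<not> F dvd A2"
        then show False
          using no_degree_one_pencil[OF i(2) jn j(2)[symmetric], of E ?t A1 A2] A1 A2 sumD sumE
          unfolding D1 by metis
      qed
    qed
  qed
qed

lemma negative_case:
  assumes "3 * t < n * m" "A \<in> VV {1..n} (\<lambda>_. m) t" shows "F dvd A"
proof (rule all_dvd, rule ccontr)
  fix \<Phi> assume \<Phi>: "\<Phi> \<in> C" "\<not> \<Phi> dvd A"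
  have "(\<Sum>i\<in>on \<Phi>. m) \<le> dg \<Phi> * t" using bezout_component[OF \<Phi>(1) VV_restrict[OF assms(2)] \<Phi>(2)] .
  then have "3 * (\<Sum>i\<in>on \<Phi>. m) \<le> 3 * (dg \<Phi> * t)" by (rule mult_le_mono2)
  also have "3 * (dg \<Phi> * t) = 3 * t * dg \<Phi>" by (simp only: mult_ac)
  finally have "n * m * dg \<Phi> \<le> 3 * t * dg \<Phi>" unfolding sum_const_on[OF \<Phi>(1)] .
  moreover have "3 * t * dg \<Phi> < n * m * dg \<Phi>" using assms(1) dg_pos[OF \<Phi>(1)] by (intro mult_strict_right_mono)
  ultimately show False by simp
qed

lemma sum_const_zero:
  assumes "3 * t = n * m" "\<Phi> \<in> C" shows "(\<Sum>i\<in>on \<Phi>. m) = dg \<Phi> * t"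
proof -
  have "3 * (\<Sum>i\<in>on \<Phi>. m) = 3 * (dg \<Phi> * t)"
    unfolding sum_const_on[OF assms(2)] assms(1)[symmetric] by (simp only: mult_ac)
  then show ?thesis by (simp only: mult_cancel1) simp
qed

lemma zero_case_nonzerodiv:
  assumes "3 * t = n * m" "A \<in> VV {1..n} (\<lambda>_. m) t" "\<not> F dvd A" shows "nonzerodiv_on F A"
  by (rule nonzerodiv_if_not_dvd[OF assms(2) _ assms(3)]) (simp only: sum_const_zero[OF assms(1)])

text \<open>Two sections have a nontrivial combination with one more zero at \<open>p 1\<close>, and
  this combination must vanish on the curve.\<close>

lemma zero_case:
  assumes t: "3 * (t + 3) = n * m"
  shows "lin.dim (VV {1..n} (\<lambda>_. m) (t + 3)) \<le> ((t + 2) choose 2) + 1"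
proof -
  have S: "{1..n} \<subseteq> {1..n}" by simp
  have "lin.dim (VV {1..n} (\<lambda>_. m) (t + 3)) \<le> lin.dim (F_forms t) + 1"
  proof (rule lin.dim_le_Suc[OF fin_dim_VV subspace_VV[OF S] subspace_F_forms F_forms_VV[OF S]])
    fix A B assume AB: "A \<in> VV {1..n} (\<lambda>_. m) (t + 3)" "B \<in> VV {1..n} (\<lambda>_. m) (t + 3)"
    have 1: "1 \<in> {1..n}" using n9 by simp
    have "A \<in> vord F (p 1) (par 1) m (t + 3)" "B \<in> vord F (p 1) (par 1) m (t + 3)"
      using AB 1 unfolding VV_iff by blast+
    from vord_step[OF par[OF 1] this] obtain c d where cd: "c \<noteq> 0 \<or> d \<noteq> 0"
      "Const c * A + Const d * B \<in> vord F (p 1) (par 1) (Suc m) (t + 3)" by metis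
    let ?G = "Const c * A + Const d * B"
    have G: "?G \<in> VV {1..n} (\<lambda>_. m) (t + 3)"
      using AB lin.subspace_add[OF subspace_VV[OF S]] lin.subspace_scale[OF subspace_VV[OF S]] by blast
    then have "?G \<in> VV {1..n} ((\<lambda>_. m)(1 := Suc m)) (t + 3)" using cd(2) by (auto simp: VV_iff)
    then have "F dvd ?G"
      using dvd_if_excess_point[where D = "\<lambda>_. m" and i = 1 and t = "t + 3"] sum_const_zero[OF t] 1 by simp
    moreover have "form (t + 3) ?G" using G by (simp add: VV_iff)
    ultimately have "?G \<in> F_forms t" by (intro dvd_in_F_forms)
    with cd(1) show "\<exists>c d. (c \<noteq> 0 \<or> d \<noteq> 0) \<and> Const c * A + Const d * B \<in> F_forms t" by metis
  qed
  then show ?thesis by (simp add: dim_F_forms)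
qed

end

section \<open>Multiplicities in the plane and the forms in the fat ideal\<close>

lemma ipow_cancel_nonvanishing:
  assumes p: "p \<noteq> 0" and A: "hh p ^ s * A \<in> ipow p m" shows "A \<in> ipow p m"
proof -
  have "theta p (hh p ^ s * A) = smult (hh p ^ s) (theta p A)"
  proof -
    have "[:hh p:] ^ s = [:hh p ^ s:]" by (induction s) (simp_all add: pCons_one)
    then show ?thesis unfolding theta_simps(5,6) theta_hh[OF p] by simp
  qed
  then show ?thesis using A hh_nonzero[OF p] unfolding ipow_eq[OF p] by (simp add: monom_1_dvd_iff')
qed

context cubic
begin

definition IF :: "nat \<Rightarrow> nat \<Rightarrow> 'k poly3 set" where
  "IF m t = fat_ideal p n m \<inter> forms t"

lemma IF_iff: "A \<in> IF m t \<longleftrightarrow> form t A \<and> (\<forall>i\<in>{1..n}. A \<in> ipow (p i) m)"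
  by (auto simp: IF_def fat_ideal_ipow)

lemma subspace_ipow_forms: "lin.subspace (ipow q m \<inter> forms t)"
  using subspace_ideal[OF ideal_ipow] subspace_forms by (rule lin.subspace_inter)

lemma IF_eq: "IF m t = forms t \<inter> (\<Inter>i\<in>{1..n}. ipow (p i) m \<inter> forms t)"
  by (auto simp: IF_iff)

lemma subspace_IF: "lin.subspace (IF m t)"
  unfolding IF_eq by (intro lin.subspace_inter subspace_forms lin.subspace_Int subspace_ipow_forms)

lemma IF_forms: "IF m t \<subseteq> forms t"
  by (auto simp: IF_def)

lemma fin_dim_IF: "lin.fin_dim (IF m t)"
  using lin.fin_dim_subset[OF fin_dim_forms IF_forms] .

lemma IF_VV: "IF m t \<subseteq> VV {1..n} (\<lambda>_. m) t"
proof
  fix A assume A: "A \<in> IF m t"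
  have "A \<in> vord F (p i) (par i) m t" if i: "i \<in> {1..n}" for i
    using ipow_forms_subset_vord[OF par[OF i] point_nonzero[OF i], of m t] A i by (auto simp: IF_iff)
  then show "A \<in> VV {1..n} (\<lambda>_. m) t" using A by (simp add: VV_iff IF_iff)
qed

lemma IF_0: "IF 0 t = forms t"
  by (auto simp: IF_iff ipow_0)

lemma dim_IF_ge: "(t + 2) choose 2 \<le> lin.dim (IF m t) + n * ((m + 1) choose 2)"
proof -
  have "lin.dim (forms t :: 'k poly3 set) \<le> lin.dim (forms t \<inter> (\<Inter>i\<in>{1..n}. ipow (p i) m \<inter> forms t)) + card {1..n} * ((m + 1) choose 2)"
  proof (rule dim_INT_ge[where W = "\<lambda>_. forms t"])
    fix i assume "i \<in> {1..n}"
    show "lin.dim (forms t :: 'k poly3 set) \<le> lin.dim (ipow (p i) m \<inter> forms t) + (m + 1 choose 2)"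
      by (rule dim_forms_le_ipow[OF point_nonzero]) fact
  qed (use fin_dim_forms subspace_forms subspace_ipow_forms in auto)
  then show ?thesis unfolding IF_eq[symmetric] by (simp add: dim_forms)
qed

text \<open>Multiplicity \<open>m\<close> imposes at most \<open>(m + 1) choose 2\<close>
  conditions, and in degree \<open>m + t\<close> exactly \<open>m\<close> of codimension is already
  visible on the curve, which leaves at most \<open>m choose 2\<close>. Multiplication by
  \<open>hh (p i) ^ m\<close>, nonzero at the point, brings this comparison down to degree
  \<open>t\<close>.\<close>

lemma dim_vord_le_ipow:
  assumes i: "i \<in> {1..n}"
  shows "lin.dim (vord F (p i) (par i) m t) \<le> lin.dim (ipow (p i) m \<inter> forms t) + (m choose 2)"
proof -
  let ?T = "m + t" and ?h = "hh (p i) ^ m"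
  let ?W = "vord F (p i) (par i) m ?T" and ?J = "ipow (p i) m \<inter> forms ?T" and ?U = "vord F (p i) (par i) m t"
  have nz: "p i \<noteq> 0" using point_nonzero[OF i] .
  have VVi: "VV {i} (\<lambda>_. m) ?T = ?W" by (auto simp: VV_iff vord_form)
  have fh: "form m ?h" using form_power[OF form_hh[of "p i"], of m] by simp
  have h0: "?h \<noteq> 0" using hh_nonzero[OF nz] by simp
  have fW: "lin.fin_dim ?W" using fin_dim_VV[of "{i}" "\<lambda>_. m" ?T] unfolding VVi .
  have sub: "(*) ?h ` ?U \<subseteq> ?W"
  proof
    fix G assume "G \<in> (*) ?h ` ?U"
    then obtain A where "G = ?h * A" "A \<in> ?U" by (elim imageE)
    then show "G \<in> ?W" using vord_mult[OF vord_0[OF fh], of A F "p i" "par i" m t] by simp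
  qed
  have JW: "?J \<subseteq> ?W" using ipow_forms_subset_vord[OF par[OF i] nz] .
  have "lin.dim ((*) ?h ` ?U) + lin.dim ?J \<le> lin.dim ((*) ?h ` ?U \<inter> ?J) + lin.dim ?W"
    by (rule dim_Int_ge[OF fW subspace_vord[OF nz] subspace_mult_image[OF subspace_vord[OF nz]] subspace_ipow_forms sub JW])
  moreover have "lin.dim ((*) ?h ` ?U) = lin.dim ?U" by (rule dim_mult_image[OF h0])
  moreover have "(*) ?h ` ?U \<inter> ?J \<subseteq> (*) ?h ` (ipow (p i) m \<inter> forms t)"
  proof
    fix G assume G: "G \<in> (*) ?h ` ?U \<inter> ?J"
    then obtain A where A: "G = ?h * A" "A \<in> ?U" by (elim IntE imageE)
    then have "A \<in> ipow (p i) m" using ipow_cancel_nonvanishing[OF nz] G by blast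
    then show "G \<in> (*) ?h ` (ipow (p i) m \<inter> forms t)" using A vord_form[OF A(2)] by auto
  qed
  then have "lin.dim ((*) ?h ` ?U \<inter> ?J) \<le> lin.dim ((*) ?h ` (ipow (p i) m \<inter> forms t))"
  proof (rule lin.fin_dim_mono[rotated])
    have "(*) ?h ` (ipow (p i) m \<inter> forms t) \<subseteq> forms ?T" using form_mult[OF fh] by auto
    then show "lin.fin_dim ((*) ?h ` (ipow (p i) m \<inter> forms t))" by (rule lin.fin_dim_subset[OF fin_dim_forms])
  qed
  moreover have "lin.dim ((*) ?h ` (ipow (p i) m \<inter> forms t)) = lin.dim (ipow (p i) m \<inter> forms t)"
    by (rule dim_mult_image[OF h0])
  moreover have "lin.dim (forms ?T :: 'k poly3 set) = lin.dim ?W + m"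
    using dim_VV_large[of "{i}" "\<lambda>_. m" ?T] i unfolding VVi by simp
  moreover have "lin.dim (forms ?T :: 'k poly3 set) \<le> lin.dim ?J + ((m + 1) choose 2)"
    by (rule dim_forms_le_ipow[OF nz])
  moreover have "(m + 1) choose 2 = (m choose 2) + m" by (simp add: numeral_2_eq_2)
  ultimately show ?thesis by linarith
qed

text \<open>The price of passing from order \<open>m\<close> on the curve to multiplicity
  \<open>m\<close> in the plane, summed over the points. It is what forces sections to lift in
  \<open>has_section_lifts\<close>.\<close>

lemma dim_VV_le_IF:
  "lin.dim (VV {1..n} (\<lambda>_. m) t) \<le> lin.dim (IF m t) + n * (m choose 2)"
proof -
  let ?V = "VV {1..n} (\<lambda>_. m) t"
  have "lin.dim ?V \<le> lin.dim (?V \<inter> (\<Inter>i\<in>{1..n}. ipow (p i) m \<inter> forms t)) + card {1..n} * (m choose 2)"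
  proof (rule dim_INT_ge[where W = "\<lambda>i. vord F (p i) (par i) m t"])
    fix i assume i: "i \<in> {1..n}"
    show "lin.fin_dim (vord F (p i) (par i) m t)"
      using lin.fin_dim_subset[OF fin_dim_forms] vord_form by (metis mem_forms subsetI)
    show "lin.subspace (vord F (p i) (par i) m t)" by (rule subspace_vord[OF point_nonzero[OF i]])
    show "?V \<subseteq> vord F (p i) (par i) m t" using VV_D[OF _ i] by blast
    show "ipow (p i) m \<inter> forms t \<subseteq> vord F (p i) (par i) m t"
      by (rule ipow_forms_subset_vord[OF par[OF i] point_nonzero[OF i]])
    show "lin.dim (vord F (p i) (par i) m t) \<le> lin.dim (ipow (p i) m \<inter> forms t) + (m choose 2)"
      by (rule dim_vord_le_ipow[OF i])
  qed (use subspace_VV subspace_ipow_forms in auto)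
  moreover have "?V \<inter> (\<Inter>i\<in>{1..n}. ipow (p i) m \<inter> forms t) = IF m t"
    using IF_VV[of m t] n9 by (auto simp: IF_iff)
  ultimately show ?thesis by simp
qed

text \<open>\<open>F\<close> has multiplicity exactly one at every marked point, so multiplying or
  dividing by it shifts \<open>m\<close> by one.\<close>

lemma IF_F_forms: "IF (Suc m) (t + 3) \<inter> F_forms t = (*) F ` IF m t"
proof
  show "IF (Suc m) (t + 3) \<inter> F_forms t \<subseteq> (*) F ` IF m t"
  proof
    fix G assume G: "G \<in> IF (Suc m) (t + 3) \<inter> F_forms t"
    then obtain B where B: "G = F * B" "B \<in> forms t" by (elim IntE imageE)
    have "B \<in> ipow (p i) m" if i: "i \<in> {1..n}" for i
      using ipow_cancel_smooth[OF smooth[OF i] form_F, of B m] G B i by (auto simp: IF_iff)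
    then have "B \<in> IF m t" using B by (simp add: IF_iff)
    then show "G \<in> (*) F ` IF m t" unfolding B(1) by (rule imageI)
  qed
  show "(*) F ` IF m t \<subseteq> IF (Suc m) (t + 3) \<inter> F_forms t"
  proof
    fix G assume "G \<in> (*) F ` IF m t"
    then obtain B where B: "G = F * B" "B \<in> IF m t" by (elim imageE)
    have fB: "form t B" using B by (simp add: IF_iff)
    have "G \<in> ipow (p i) (Suc m)" if i: "i \<in> {1..n}" for i
    proof -
      have "F \<in> ipow (p i) 1" unfolding ipow_1 by (rule point_ideal_form[OF form_F on_curve[OF i]])
      then have "F * B \<in> ipow (p i) (1 + m)" using B i by (intro ipow_mult) (auto simp: IF_iff)
      then show ?thesis using B by simp
    qed
    moreover have "form (t + 3) G" using form_mult[OF form_F fB] B by (simp add: add.commute)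
    ultimately have "G \<in> IF (Suc m) (t + 3)" by (simp add: IF_iff)
    moreover have "G \<in> F_forms t" unfolding B(1) using fB by (intro imageI) simp
    ultimately show "G \<in> IF (Suc m) (t + 3) \<inter> F_forms t" by blast
  qed
qed

lemma dim_F_IF: "lin.dim (IF (Suc m) (t + 3) \<inter> F_forms t) = lin.dim (IF m t)"
  unfolding IF_F_forms by (rule dim_mult_image[OF F_nonzero])

lemma dim_IF_all_dvd:
  assumes "\<And>A. A \<in> IF (Suc m) (t + 3) \<Longrightarrow> F dvd A"
  shows "lin.dim (IF (Suc m) (t + 3)) = lin.dim (IF m t)"
proof -
  have "A \<in> F_forms t" if "A \<in> IF (Suc m) (t + 3)" for A
    by (rule dvd_in_F_forms[OF _ assms[OF that]]) (use that in \<open>simp add: IF_iff\<close>)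
  then have "IF (Suc m) (t + 3) \<inter> F_forms t = IF (Suc m) (t + 3)" by blast
  then show ?thesis using dim_F_IF[of m t] by simp
qed

text \<open>Restriction to the curve: the kernel is \<open>F\<close> times the residual system
  \<open>IF m t\<close>, and the image lies in \<open>VV\<close> modulo the multiples of
  \<open>F\<close>.\<close>

lemma dim_IF_step:
  "lin.dim (IF (Suc m) (t + 3)) + ((t + 2) choose 2) \<le> lin.dim (IF m t) + lin.dim (VV {1..n} (\<lambda>_. Suc m) (t + 3))"
  using dim_Int_ge[OF fin_dim_VV subspace_VV[OF order_refl] subspace_IF subspace_F_forms IF_VV F_forms_VV[OF order_refl], of "Suc m" t]
  by (simp add: dim_F_IF dim_F_forms)

text \<open>Restriction bounds the dimension from above, the count of conditions bounds it from
  below, and the two bounds agree. Because \<open>n \<ge> 9\<close>, the residual pair is again of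
  positive degree, so the induction continues.\<close>

lemma dim_IF_positive:
  assumes "n * m < 3 * t" shows "lin.dim (IF m t) + n * ((m + 1) choose 2) = (t + 2) choose 2"
  using assms
proof (induction m arbitrary: t)
  case 0 then show ?case by (simp add: IF_0 dim_forms numeral_2_eq_2)
next
  case (Suc m)
  have "n \<le> n * Suc m" by simp
  then have "t \<ge> 3" using Suc.prems n9 by linarith
  then obtain s where t: "t = s + 3" by (metis le_add_diff_inverse2)
  have "n * m < 3 * s" using Suc.prems n9 by (simp add: t)
  then have IH: "lin.dim (IF m s) + n * ((m + 1) choose 2) = (s + 2) choose 2" by (rule Suc.IH)
  have "lin.dim (forms t :: 'k poly3 set) = lin.dim (VV {1..n} (\<lambda>_. Suc m) t) + n * Suc m"
    using positive_case[of "Suc m" s] Suc.prems unfolding t by simp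
  then have V: "(t + 2) choose 2 = lin.dim (VV {1..n} (\<lambda>_. Suc m) t) + n * Suc m"
    unfolding dim_forms .
  have "lin.dim (IF (Suc m) t) + ((s + 2) choose 2) \<le> lin.dim (IF m s) + lin.dim (VV {1..n} (\<lambda>_. Suc m) t)"
    using dim_IF_step[of m s] unfolding t .
  moreover have "n * ((Suc m + 1) choose 2) = n * ((m + 1) choose 2) + n * Suc m"
    by (simp add: numeral_2_eq_2 algebra_simps)
  ultimately show ?case using IH V dim_IF_ge[of t "Suc m"] by linarith
qed

lemma dim_IF_negative:
  assumes "3 * (t + 3) < n * Suc m" shows "lin.dim (IF (Suc m) (t + 3)) = lin.dim (IF m t)"
  by (rule dim_IF_all_dvd, rule negative_case[OF assms], rule subsetD[OF IF_VV])

lemma dim_IF_negative_small: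
  assumes "3 * t < n * m" "t < 3" shows "lin.dim (IF m t) = 0"
proof -
  have "A = 0" if "A \<in> IF m t" for A
  proof -
    have "F dvd A" by (rule negative_case[OF assms(1) subsetD[OF IF_VV that]])
    then obtain x where x: "A = F * x" by (metis dvdE)
    have "form t (F * x)" using that x by (simp add: IF_iff)
    then have "x = 0" using assms(2) by (rule form_quotient_small[OF form_F F_nonzero])
    then show ?thesis using x by simp
  qed
  then have "IF m t \<subseteq> lin.span {}" by auto
  then show ?thesis using lin.dim_le_card[of "IF m t" "{}"] by simp
qed

text \<open>The line bundle \<open>O\<^sub>C(tL - mX)\<close>, of degree \<open>0\<close> on every component, has a nonzero section.\<close>

definition has_section :: "nat \<Rightarrow> nat \<Rightarrow> bool" where
  "has_section m t \<longleftrightarrow> (\<exists>A\<in>VV {1..n} (\<lambda>_. m) t. \<not> F dvd A)"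

text \<open>Stronger than \<open>has_section\<close>: multiplicity \<open>m\<close> in the plane is
  required, not only order \<open>m\<close> along the curve.\<close>

definition lifts :: "nat \<Rightarrow> nat \<Rightarrow> bool" where
  "lifts m t \<longleftrightarrow> (\<exists>A\<in>IF m t. \<not> F dvd A)"

lemma lifts_has_section: "lifts m t \<Longrightarrow> has_section m t"
  unfolding lifts_def has_section_def using subsetD[OF IF_VV[of m t]] by metis

lemma dim_IF_zero:
  assumes t: "3 * (t + 3) = n * Suc m"
  shows "lin.dim (IF (Suc m) (t + 3)) = lin.dim (IF m t) + (if lifts (Suc m) (t + 3) then 1 else 0)"
proof (cases "lifts (Suc m) (t + 3)")
  case False
  then have "\<forall>A\<in>IF (Suc m) (t + 3). F dvd A" unfolding lifts_def by simp
  then have "lin.dim (IF (Suc m) (t + 3)) = lin.dim (IF m t)"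
    by (intro dim_IF_all_dvd) (erule bspec)
  then show ?thesis using False by simp
next
  case True
  then obtain A where A: "A \<in> IF (Suc m) (t + 3)" "\<not> F dvd A" unfolding lifts_def by metis
  let ?J = "IF (Suc m) (t + 3) \<inter> F_forms t"
  have "A \<notin> ?J" using A(2) by auto
  then have ne: "?J \<noteq> IF (Suc m) (t + 3)" using A(1) by blast
  have "lin.dim ?J < lin.dim (IF (Suc m) (t + 3))"
    using lin.fin_dim_subspace_eq[OF fin_dim_IF subspace_IF lin.subspace_inter[OF subspace_IF subspace_F_forms] Int_lower1] ne
    by (metis not_le)
  then show ?thesis
    using dim_IF_step[of m t] zero_case[OF t] True unfolding dim_F_IF by simp
qed

text \<open>Without a lift \<open>IF (Suc m) (t + 3)\<close> is no larger than
  \<open>IF m t\<close>, so \<open>VV\<close> has dimension at most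
  \<open>dim (IF m t) + n * ((m + 1) choose 2)\<close>. By \<open>ind\<close> this is the dimension
  of the multiples of \<open>F\<close>, which leaves no room for a section.\<close>

lemma has_section_lifts:
  assumes t: "3 * (t + 3) = n * Suc m" and ind: "lin.dim (IF m t) + n * ((m + 1) choose 2) = (t + 2) choose 2"
    and "has_section (Suc m) (t + 3)"
  shows "lifts (Suc m) (t + 3)"
proof (rule ccontr)
  assume nl: "\<not> lifts (Suc m) (t + 3)"
  obtain A where A: "A \<in> VV {1..n} (\<lambda>_. Suc m) (t + 3)" "\<not> F dvd A" using assms(3) unfolding has_section_def by metis
  let ?V = "VV {1..n} (\<lambda>_. Suc m) (t + 3)"
  have "A \<notin> F_forms t" using A(2) by auto
  then have ne: "F_forms t \<noteq> ?V" using A(1) by blast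
  have "lin.dim (F_forms t) < lin.dim ?V"
    using lin.fin_dim_subspace_eq[OF fin_dim_VV subspace_VV[OF order_refl] subspace_F_forms F_forms_VV[OF order_refl]] ne
    by (metis not_le)
  then have "(t + 2) choose 2 < lin.dim ?V" by (simp add: dim_F_forms)
  moreover have "lin.dim ?V \<le> lin.dim (IF (Suc m) (t + 3)) + n * (Suc m choose 2)" by (rule dim_VV_le_IF)
  ultimately show False using dim_IF_zero[OF t] nl ind by simp
qed

text \<open>\<open>A\<close> is a nonzerodivisor modulo \<open>F\<close>, so none of its powers is
  divisible by \<open>F\<close>, whether or not the cubic is irreducible.\<close>

lemma lifts_power:
  assumes t: "3 * t = n * m" and "lifts m t" shows "lifts (k * m) (k * t)"
proof -
  obtain A where A: "A \<in> IF m t" "\<not> F dvd A" using assms(2) unfolding lifts_def by metis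
  have nz: "nonzerodiv_on F A" by (rule zero_case_nonzerodiv[OF t subsetD[OF IF_VV A(1)] A(2)])
  have "\<not> F dvd A ^ k"
  proof
    assume "F dvd A ^ k"
    then have "F dvd A ^ k * A" by (rule dvd_mult2)
    then have "F dvd A" using nonzerodiv_onD[OF nonzerodiv_on_power[OF nz]] by metis
    then show False using A(2) by metis
  qed
  moreover have "A ^ k \<in> IF (k * m) (k * t)"
  proof (induction k)
    case 0 then show ?case by (simp add: IF_0)
  next
    case (Suc k)
    then show ?case using A(1) form_mult[of t A "k * t" "A ^ k"] ipow_mult[of A _ m "A ^ k" "k * m"]
      by (simp add: IF_iff)
  qed
  ultimately show ?thesis unfolding lifts_def by metis
qed

text \<open>With \<open>n > 9\<close> the residual degree is positive, so the residual system has
  the expected dimension and a section lifts. The only possible defect is thus one section.\<close>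

lemma dim_IF_zero_large:
  assumes n: "n > 9" and t: "3 * t = n * m" and m: "m > 0"
  shows "lin.dim (IF m t) + n * ((m + 1) choose 2) = ((t + 2) choose 2) + (if has_section m t then 1 else 0)"
proof -
  obtain m' where m': "m = Suc m'" using m gr0_implies_Suc by blast
  have "n * 1 \<le> n * m" using m by (intro mult_le_mono2) simp
  then have "t \<ge> 3" using t n by linarith
  then obtain s where s: "t = s + 3" by (metis le_add_diff_inverse2)
  have "n * m' < 3 * s" using t n unfolding s m' by simp
  then have ind: "lin.dim (IF m' s) + n * ((m' + 1) choose 2) = (s + 2) choose 2" by (rule dim_IF_positive)
  have t': "3 * (s + 3) = n * Suc m'" using t unfolding s m' .
  have "lifts m t \<longleftrightarrow> has_section m t"
    using lifts_has_section has_section_lifts[OF t' ind] unfolding s m' by blast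
  moreover have "n * ((m + 1) choose 2) = n * ((m' + 1) choose 2) + n * Suc m'"
    unfolding m' by (simp add: numeral_2_eq_2 algebra_simps)
  ultimately show ?thesis
    using dim_IF_zero[OF t'] ind choose_shift[of s] t' unfolding s m' by simp
qed

text \<open>From \<open>(3 m, m)\<close> one descends to \<open>(3 (m - 1), m - 1)\<close>, so the
  dimension is one more than the number of \<open>j\<close> with \<open>1 \<le> j \<le> m\<close>
  that have a lift. Below \<open>l\<close> there are no sections and the dimension stays at the
  expected value \<open>1\<close>; therefore the section at \<open>j = l\<close> lifts, and its
  powers serve all multiples of \<open>l\<close>. The value \<open>l = 0\<close> stands for infinite
  order: it divides no positive \<open>j\<close>, and \<open>m div 0 = 0\<close>.\<close>

lemma dim_IF_nine:
  assumes n: "n = 9" and ord: "\<And>j. j > 0 \<Longrightarrow> has_section j (3 * j) \<longleftrightarrow> l dvd j"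
  shows "lin.dim (IF m (3 * m)) = 1 + m div l"
proof -
  have t: "3 * (3 * m + 3) = n * Suc m" for m using n by simp
  have step: "lin.dim (IF (Suc m) (3 * Suc m)) = lin.dim (IF m (3 * m)) + (if lifts (Suc m) (3 * Suc m) then 1 else 0)" for m
    using dim_IF_zero[OF t[of m]] by (simp add: add.commute)
  have base: "lin.dim (IF 0 (3 * 0)) = 1" by (simp add: IF_0 dim_forms numeral_2_eq_2)
  have nolift: "\<not> lifts j (3 * j)" if "j > 0" "\<not> l dvd j" for j
    using lifts_has_section ord[OF that(1)] that(2) by metis
  have small: "lin.dim (IF j (3 * j)) = 1" if "j < l" for j
    using that
  proof (induction j)
    case 0 then show ?case using base by simp
  next
    case (Suc j)
    then have "\<not> l dvd Suc j" by (metis dvd_imp_le not_le zero_less_Suc)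
    then show ?case using step[of j] Suc nolift[of "Suc j"] by simp
  qed
  have liftl: "lifts l (3 * l)" if l: "l > 0"
  proof -
    obtain l' where l': "l = Suc l'" using l gr0_implies_Suc by blast
    \<comment> \<open>The expected dimension for nine points in degree \<open>3 l'\<close> is
      \<open>1\<close>, the value found in \<open>small\<close>.\<close>
    have "real ((3 * l' + 2) choose 2) = real (1 + 9 * ((l' + 1) choose 2))"
    proof -
      have c: "real ((a + 2) choose 2) = (real a + 2) * (real a + 1) / 2" for a
        by (induction a) (auto simp: numeral_2_eq_2 field_simps)
      have c': "real ((a + 1) choose 2) = (real a + 1) * real a / 2" for a
        by (induction a) (auto simp: numeral_2_eq_2 field_simps)
      show ?thesis unfolding of_nat_add of_nat_mult c c' by (simp add: field_simps)
    qed
    then have "lin.dim (IF l' (3 * l')) + n * ((l' + 1) choose 2) = (3 * l' + 2) choose 2"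
      using small[of l'] n l' by (simp only: of_nat_eq_iff lessI)
    moreover have "has_section (Suc l') (3 * l' + 3)" using ord[of l] l l' by (simp add: add.commute)
    ultimately have "lifts (Suc l') (3 * l' + 3)" by (rule has_section_lifts[OF t])
    then show ?thesis using l' by (simp add: add.commute)
  qed
  have lifts_iff: "lifts j (3 * j) \<longleftrightarrow> l dvd j" if j: "j > 0" for j
  proof
    show "lifts j (3 * j) \<Longrightarrow> l dvd j" using nolift[OF j] by metis
    assume "l dvd j"
    then obtain k where k: "j = k * l" by (metis dvdE mult.commute)
    then have "l > 0" using j by simp
    then have "lifts (k * l) (k * (3 * l))" using lifts_power[of "3 * l" l k] liftl n by simp
    then show "lifts j (3 * j)" using k by (simp add: mult_ac)
  qed
  have step': "lin.dim (IF (Suc m) (3 * Suc m)) = lin.dim (IF m (3 * m)) + (if l dvd Suc m then 1 else 0)" for m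
    unfolding step lifts_iff[OF zero_less_Suc] ..
  show ?thesis
  proof (induction m)
    case 0 then show ?case using base by simp
  next
    case (Suc m)
    have "Suc m div l = m div l + (if l dvd Suc m then 1 else 0)"
      by (cases "l = 0") (auto simp: div_Suc dvd_eq_mod_eq_0)
    then show ?case using Suc step'[of m] by simp
  qed
qed

text \<open>The inequality \<open>t < 3 m\<close> survives the removal of the cubic, and with
  \<open>n \<ge> 9\<close> it implies negative degree. So the degree is exhausted while the
  multiplicity is still positive.\<close>

lemma dim_IF_below:
  assumes "t < 3 * m" shows "lin.dim (IF m t) = 0"
  using assms
proof (induction m arbitrary: t)
  case (Suc m)
  have "3 * t < 9 * Suc m" using Suc.prems by simp
  also have "\<dots> \<le> n * Suc m" using n9 by (intro mult_le_mono1)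
  finally have neg: "3 * t < n * Suc m" .
  show ?case
  proof (cases "t < 3")
    case True then show ?thesis using dim_IF_negative_small[OF neg] by simp
  next
    case False
    then obtain s where s: "t = s + 3" by (metis le_add_diff_inverse2 not_less)
    then show ?thesis using dim_IF_negative[of s m] neg Suc.IH[of s] Suc.prems by simp
  qed
qed simp

lemma dim_IF_peel:
  assumes "r \<le> m" "3 * r \<le> t" "\<And>j. j < r \<Longrightarrow> 3 * (t - 3 * j) < n * (m - j)"
  shows "lin.dim (IF m t) = lin.dim (IF (m - r) (t - 3 * r))"
  using assms
proof (induction r)
  case (Suc r)
  obtain m' t' where m': "m - r = Suc m'" "m - Suc r = m'" and t': "t - 3 * r = t' + 3" "t - 3 * Suc r = t'"
  proof
    show "m - r = Suc (m - Suc r)" "m - Suc r = m - Suc r" using Suc.prems(1) by simp_all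
    show "t - 3 * r = (t - 3 * Suc r) + 3" "t - 3 * Suc r = t - 3 * Suc r" using Suc.prems(2) by simp_all
  qed
  have "3 * (t' + 3) < n * Suc m'" using Suc.prems(3)[of r] m'(1) t'(1) by simp
  then have "lin.dim (IF (Suc m') (t' + 3)) = lin.dim (IF m' t')" by (rule dim_IF_negative)
  moreover have "lin.dim (IF m t) = lin.dim (IF (m - r) (t - 3 * r))"
    using Suc.prems by (intro Suc.IH) simp_all
  ultimately show ?case using m' t' by simp
qed simp

lemma hilbert_function_fat_ideal:
  assumes "m > 0" shows "hilbert_function (fat_ideal p n m) t + lin.dim (IF m t) = (t + 2) choose 2"
proof -
  have id: "ideal (fat_ideal p n m) PR"
    unfolding fat_ideal_ipow ideal_PR_iff using ideal_ipow[of _ m] unfolding ideal_PR_iff by auto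
  have one: "1 \<notin> fat_ideal p n m"
    using one_notin_ipow[OF point_nonzero[of 1] assms] n9 by (auto simp: fat_ideal_ipow)
  show ?thesis
    using hilbert_function_eq[OF id one, of t] lin.fin_dim_mono[OF fin_dim_forms IF_forms[of m t]]
    by (simp add: IF_def dim_forms)
qed

end

subsection \<open>Homogeneous ideals and primes\<close>

lemma primeideal_PR_dest:
  assumes "primeideal P (PR :: 'k::field poly3 ring)"
  shows "ideal P PR" "P \<noteq> UNIV" "a * b \<in> P \<Longrightarrow> a \<in> P \<or> b \<in> P"
proof -
  interpret primeideal P "PR :: 'k poly3 ring" by (rule assms)
  show "ideal P PR" by (rule ideal_axioms)
  show "P \<noteq> UNIV" using I_notcarr by auto
  show "a * b \<in> P \<Longrightarrow> a \<in> P \<or> b \<in> P" using I_prime[of a b] by simp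
qed

lemma ideal_PR_closed:
  assumes "ideal P (PR :: 'k::field poly3 ring)"
  shows "0 \<in> P" "a \<in> P \<Longrightarrow> b \<in> P \<Longrightarrow> a + b \<in> P" "a \<in> P \<Longrightarrow> b \<in> P \<Longrightarrow> a - b \<in> P"
    "a \<in> P \<Longrightarrow> r * a \<in> P" "a \<in> P \<Longrightarrow> a * r \<in> P"
proof -
  have I: "0 \<in> P" "\<And>a b. a \<in> P \<Longrightarrow> b \<in> P \<Longrightarrow> a + b \<in> P" "\<And>a r. a \<in> P \<Longrightarrow> r * a \<in> P"
    using assms unfolding ideal_PR_iff by auto
  show "0 \<in> P" "a \<in> P \<Longrightarrow> b \<in> P \<Longrightarrow> a + b \<in> P" "a \<in> P \<Longrightarrow> r * a \<in> P" using I by auto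
  show "a \<in> P \<Longrightarrow> a * r \<in> P" using I(3)[of a r] by (simp add: mult.commute)
  show "a \<in> P \<Longrightarrow> b \<in> P \<Longrightarrow> a - b \<in> P" using I(2)[of a "- 1 * b"] I(3)[of b "- 1"] by simp
qed

definition homogeneous :: "'k::field poly3 set \<Rightarrow> bool" where
  "homogeneous J \<longleftrightarrow> (\<forall>A\<in>J. \<forall>d. hcomp d A \<in> J)"

lemma homogeneousD: "homogeneous J \<Longrightarrow> A \<in> J \<Longrightarrow> hcomp d A \<in> J"
  unfolding homogeneous_def by blast

text \<open>Modulo \<open>J\<close> the highest components of \<open>a\<close> and \<open>b\<close>
  outside \<open>J\<close> multiply to a component of \<open>a * b\<close>, so primality needs
  testing on forms only.\<close>

lemma homogeneous_prime:
  fixes J :: "'k::field poly3 set"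
  assumes id: "ideal J PR" and hom: "homogeneous J" and proper: "J \<noteq> UNIV"
    and prime: "\<And>a b d e. form d a \<Longrightarrow> form e b \<Longrightarrow> a * b \<in> J \<Longrightarrow> a \<in> J \<or> b \<in> J"
  shows "primeideal J PR"
proof (rule primeidealI[OF id cring_PR])
  show "carrier PR \<noteq> J" using proper by auto
  fix a b assume "a \<otimes>\<^bsub>PR\<^esub> b \<in> J"
  then have ab: "a * b \<in> J" by simp
  have top: "\<exists>d. hcomp d a \<notin> J \<and> (\<forall>i>d. hcomp i a \<in> J)" if a: "a \<notin> J" for a
  proof -
    let ?S = "{d. hcomp d a \<notin> J}"
    have "?S \<noteq> {}"
    proof
      assume "?S = {}"
      then have "(\<Sum>d\<le>degree (homg a). hcomp d a) \<in> J" by (intro ideal_PR_sum[OF id]) auto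
      then show False using a sum_hcomp[of a] by simp
    qed
    moreover have fin: "finite ?S"
    proof (rule finite_subset)
      show "?S \<subseteq> {..degree (homg a)}"
      proof
        fix d assume d: "d \<in> ?S"
        show "d \<in> {..degree (homg a)}"
        proof (rule ccontr)
          assume "d \<notin> {..degree (homg a)}"
          then have "hcomp d a = 0" unfolding hcomp_def by (intro coeff_eq_0) auto
          then show False using d ideal_PR_closed(1)[OF id] by simp
        qed
      qed
    qed simp
    ultimately have "Max ?S \<in> ?S" by (intro Max_in)
    then have m1: "hcomp (Max ?S) a \<notin> J" by blast
    have m2: "hcomp i a \<in> J" if "i > Max ?S" for i
    proof (rule ccontr)
      assume "hcomp i a \<notin> J"
      then have "i \<le> Max ?S" using fin by (intro Max_ge) auto
      then show False using that by simp
    qed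
    show ?thesis by (intro exI conjI allI impI, rule m1, rule m2)
  qed
  show "a \<in> J \<or> b \<in> J"
  proof (rule ccontr)
    assume "\<not> (a \<in> J \<or> b \<in> J)"
    then have ab': "a \<notin> J" "b \<notin> J" by simp_all
    from top[OF ab'(1)] obtain d where d: "hcomp d a \<notin> J" "\<And>i. i > d \<Longrightarrow> hcomp i a \<in> J" by blast
    from top[OF ab'(2)] obtain e where e: "hcomp e b \<notin> J" "\<And>i. i > e \<Longrightarrow> hcomp i b \<in> J" by blast
    have 1: "hcomp (d + e) (a * b) = hcomp d a * hcomp e b + (\<Sum>i\<in>{..d + e} - {d}. hcomp i a * hcomp (d + e - i) b)"
      unfolding hcomp_mult using sum.remove[of "{..d + e}" d "\<lambda>i. hcomp i a * hcomp (d + e - i) b"] by simp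
    have 2: "(\<Sum>i\<in>{..d + e} - {d}. hcomp i a * hcomp (d + e - i) b) \<in> J"
    proof (rule ideal_PR_sum[OF id])
      fix i assume i: "i \<in> {..d + e} - {d}"
      show "hcomp i a * hcomp (d + e - i) b \<in> J"
      proof (cases "i > d")
        case True then show ?thesis using d(2) ideal_PR_closed(5)[OF id] by simp
      next
        case False
        then have "d + e - i > e" using i by auto
        then show ?thesis using e(2) ideal_PR_closed(4)[OF id] by simp
      qed
    qed
    have 3: "hcomp (d + e) (a * b) \<in> J" using homogeneousD[OF hom ab] .
    have "hcomp d a * hcomp e b \<in> J" using ideal_PR_closed(3)[OF id 3 2] unfolding 1 by simp
    from prime[OF form_hcomp form_hcomp this] show False using d(1) e(1) by (elim disjE) simp_all
  qed
qed

text \<open>Graded form of Krull's argument: an ideal maximal among the homogeneous ones that avoid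
  all powers of the variable is prime. The prime need not belong to a rational point, so the
  argument works over every field.\<close>

lemma homogeneous_prime_avoiding_powers:
  fixes I :: "'k::field poly3 set"
  assumes id: "ideal I PR" and hom: "homogeneous I" and x: "\<And>N. Var i ^ N \<notin> I"
  obtains P where "I \<subseteq> P" "primeideal P PR" "homogeneous P" "Var i \<notin> P"
proof -
  let ?A = "{J. ideal J (PR :: 'k poly3 ring) \<and> homogeneous J \<and> I \<subseteq> J \<and> (\<forall>N. Var i ^ N \<notin> J)}"
  have "\<exists>M\<in>?A. \<forall>X\<in>?A. M \<subseteq> X \<longrightarrow> X = M"
  proof (rule subset_Zorn_nonempty)
    have "I \<in> ?A" using assms by simp
    then show "?A \<noteq> {}" by (metis empty_iff)
    fix Ch assume ne: "Ch \<noteq> {}" and ch: "subset.chain ?A Ch"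
    have mem: "J \<in> ?A" if "J \<in> Ch" for J using ch that unfolding subset_chain_def by (elim conjE) (rule subsetD)
    have cc: "\<forall>X\<in>Ch. \<forall>Y\<in>Ch. X \<subseteq> Y \<or> Y \<subseteq> X"
      using ch unfolding subset_chain_def by (rule conjunct2)
    have idC: "ideal J PR" and homC: "homogeneous J" and IC: "I \<subseteq> J" and xC: "Var i ^ N \<notin> J" if "J \<in> Ch" for J N
      using mem[OF that] by simp_all
    obtain J0 where J0: "J0 \<in> Ch" using ne by (metis all_not_in_conv)
    have "ideal (\<Union>Ch) (PR :: 'k poly3 ring)"
      unfolding ideal_PR_iff
    proof (intro conjI ballI allI)
      show "0 \<in> \<Union>Ch" using J0 ideal_PR_closed(1)[OF idC[OF J0]] by (rule UnionI)
      fix a assume "a \<in> \<Union>Ch"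
      then obtain J where J: "J \<in> Ch" "a \<in> J" by (elim UnionE)
      show "r * a \<in> \<Union>Ch" for r using J(1) ideal_PR_closed(4)[OF idC[OF J(1)] J(2)] by (rule UnionI)
      fix b assume "b \<in> \<Union>Ch"
      then obtain J' where J': "J' \<in> Ch" "b \<in> J'" by (elim UnionE)
      show "a + b \<in> \<Union>Ch"
      proof (cases "J \<subseteq> J'")
        case True
        show ?thesis using J'(1) ideal_PR_closed(2)[OF idC[OF J'(1)] subsetD[OF True J(2)] J'(2)] by (rule UnionI)
      next
        case False
        then have "J' \<subseteq> J" using bspec[OF bspec[OF cc J(1)] J'(1)] by simp
        then show ?thesis using J(1) ideal_PR_closed(2)[OF idC[OF J(1)] J(2) subsetD[OF _ J'(2)]] by (intro UnionI)
      qed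
    qed
    moreover have "homogeneous (\<Union>Ch)"
      unfolding homogeneous_def
    proof (intro ballI allI)
      fix a d assume "a \<in> \<Union>Ch"
      then obtain J where J: "J \<in> Ch" "a \<in> J" by (elim UnionE)
      show "hcomp d a \<in> \<Union>Ch" using J(1) homogeneousD[OF homC[OF J(1)] J(2)] by (rule UnionI)
    qed
    moreover have "I \<subseteq> \<Union>Ch" using IC[OF J0] Union_upper[OF J0] by (rule order_trans)
    moreover have "Var i ^ N \<notin> \<Union>Ch" for N using xC by (metis UnionE)
    ultimately show "\<Union>Ch \<in> ?A" by simp
  qed
  then obtain M where M: "M \<in> ?A" and max': "\<forall>X\<in>?A. M \<subseteq> X \<longrightarrow> X = M" by (elim bexE)
  have max: "X = M" if "X \<in> ?A" "M \<subseteq> X" for X using mp[OF bspec[OF max' that(1)] that(2)] .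
  have idM: "ideal M PR" and homM: "homogeneous M" and IM: "I \<subseteq> M" and xM: "Var i ^ N \<notin> M" for N using M by simp_all
  have ext: "\<exists>N j r. Var i ^ N = j + r * a \<and> j \<in> M" if a: "form d a" "a \<notin> M" for a d
  proof (rule ccontr)
    assume no: "\<not> ?thesis"
    let ?X = "{j + r * a |j r. j \<in> M}"
    have "ideal ?X (PR :: 'k poly3 ring)"
      unfolding ideal_PR_iff
    proof (intro conjI ballI allI)
      show "0 \<in> ?X" using ideal_PR_closed(1)[OF idM] by (intro CollectI exI[of _ 0]) simp
      fix y assume "y \<in> ?X"
      then obtain j r where y: "y = j + r * a" "j \<in> M" by blast
      show "s * y \<in> ?X" for s
        using ideal_PR_closed(4)[OF idM y(2), of s] y(1)
        by (intro CollectI exI[of _ "s * j"] exI[of _ "s * r"]) (simp add: algebra_simps)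
      fix z assume "z \<in> ?X"
      then obtain j' r' where z: "z = j' + r' * a" "j' \<in> M" by blast
      show "y + z \<in> ?X"
        using ideal_PR_closed(2)[OF idM y(2) z(2)] y(1) z(1)
        by (intro CollectI exI[of _ "j + j'"] exI[of _ "r + r'"]) (simp add: algebra_simps)
    qed
    moreover have "homogeneous ?X"
      unfolding homogeneous_def
    proof (intro ballI allI)
      fix y e assume "y \<in> ?X"
      then obtain j r where y: "y = j + r * a" "j \<in> M" by blast
      have "hcomp e y = hcomp e j + (if e < d then 0 else hcomp (e - d) r) * a"
        unfolding y(1) hcomp_add using hcomp_mult_form'[OF a(1), of e r] by (simp add: mult.commute)
      moreover have "hcomp e j \<in> M" using homogeneousD[OF homM y(2)] .
      ultimately show "hcomp e y \<in> ?X" by blast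
    qed
    moreover have MX: "M \<subseteq> ?X"
    proof
      fix j assume "j \<in> M"
      then show "j \<in> ?X" by (intro CollectI exI[of _ j] exI[of _ 0]) simp
    qed
    moreover have "Var i ^ N \<notin> ?X" for N using no by blast
    ultimately have "?X \<in> ?A" using IM by (intro CollectI conjI allI order_trans[OF IM MX]) assumption+
    then have "?X = M" using MX by (rule max)
    moreover have "a \<in> ?X" using ideal_PR_closed(1)[OF idM] by (intro CollectI exI[of _ 0] exI[of _ 1]) simp
    ultimately show False using a(2) by simp
  qed
  have "primeideal M PR"
  proof (rule homogeneous_prime[OF idM homM])
    show "M \<noteq> UNIV" using xM[of 0] by (metis UNIV_I)
    fix a b d e assume fa: "form d a" and fb: "form e b" and ab: "a * b \<in> M"
    show "a \<in> M \<or> b \<in> M"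
    proof (rule ccontr)
      assume n: "\<not> (a \<in> M \<or> b \<in> M)"
      obtain N j r where 1: "Var i ^ N = j + r * a" "j \<in> M" using ext[OF fa] n by metis
      obtain N' j' r' where 2: "Var i ^ N' = j' + r' * b" "j' \<in> M" using ext[OF fb] n by metis
      have "Var i ^ (N + N') = j * (j' + r' * b) + (r * a * j' + r * r' * (a * b))"
        unfolding power_add 1 2 by (simp add: algebra_simps)
      also have "\<dots> \<in> M" using ideal_PR_closed[OF idM] 1(2) 2(2) ab by metis
      finally show False using xM by metis
    qed
  qed
  moreover have "Var i \<notin> M" using xM[of 1] by simp
  ultimately show ?thesis using that IM homM by metis
qed

lemma homogeneous_eq_genideal:
  fixes P :: "'k::field poly3 set"
  assumes id: "ideal P PR" and hom: "homogeneous P"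
  shows "P = Idl\<^bsub>PR\<^esub> {G \<in> P. \<exists>d. form d G}"
proof
  let ?I = "Idl\<^bsub>PR\<^esub> {G \<in> P. \<exists>d. form d G}"
  have idI: "ideal ?I PR" by (rule PRr.genideal_ideal) simp
  show "?I \<subseteq> P" by (rule PRr.genideal_minimal[OF id]) blast
  show "P \<subseteq> ?I"
  proof
    fix A assume A: "A \<in> P"
    have "hcomp d A \<in> ?I" for d
      using homogeneousD[OF hom A, of d] form_hcomp[of d A]
      by (intro subsetD[OF PRr.genideal_self]) auto
    then have "(\<Sum>d\<le>degree (homg A). hcomp d A) \<in> ?I" by (intro ideal_PR_sum[OF idI])
    then show "A \<in> ?I" using sum_hcomp[of A] by simp
  qed
qed

text \<open>Pigeonhole: in a monomial of this degree some exponent reaches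
  \<open>N i\<close>.\<close>

lemma form_power_of_variables:
  fixes I :: "'k::field poly3 set"
  assumes id: "ideal I PR" and N: "\<And>i. Var i ^ N i \<in> I" and M: "form (N 1 + N 2 + N 3) M"
  shows "M \<in> I"
proof -
  have "Poly_Mapping.single e c \<in> I" if e: "mdeg e = N 1 + N 2 + N 3" for e and c :: 'k
  proof -
    have "\<exists>i. N i \<le> Poly_Mapping.lookup e i"
    proof (rule ccontr)
      assume "\<nexists>i. N i \<le> Poly_Mapping.lookup e i"
      then have "Poly_Mapping.lookup e i < N i" for i by (simp add: not_le)
      from this[of 1] this[of 2] this[of 3] show False using e by (simp add: mdeg_def sum_3)
    qed
    then obtain i where i: "N i \<le> Poly_Mapping.lookup e i" by blast
    have "Var i ^ Poly_Mapping.lookup e i = Var i ^ N i * (Var i :: 'k poly3) ^ (Poly_Mapping.lookup e i - N i)"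
      using i by (simp flip: power_add)
    then have "Var i ^ Poly_Mapping.lookup e i \<in> I" using ideal_PR_closed(5)[OF id N] by simp
    moreover have "Poly_Mapping.single e c = Var i ^ Poly_Mapping.lookup e i * (Const c * (\<Prod>l\<in>UNIV - {i}. Var l ^ Poly_Mapping.lookup e l))"
      unfolding single_eq_prod_Var using prod.remove[of UNIV i "\<lambda>l. (Var l :: 'k poly3) ^ Poly_Mapping.lookup e l"]
      by (simp add: mult_ac)
    ultimately show ?thesis using ideal_PR_closed(5)[OF id] by simp
  qed
  then have "(\<Sum>e\<in>Poly_Mapping.keys M. Poly_Mapping.single e (Poly_Mapping.lookup M e)) \<in> I"
    using M by (intro ideal_PR_sum[OF id]) (simp add: form_iff_mdeg)
  then show ?thesis using poly3_expand[of M] by simp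
qed

subsection \<open>The Picard group\<close>

lemma Fract_power: "Fract a b ^ n = Fract (a ^ n) (b ^ n :: 'a::idom)"
  by (induction n) (simp_all add: One_fract_def)

context marked_cubic
begin

abbreviation nzd :: "'k poly3 \<Rightarrow> bool" where
  "nzd \<equiv> nonzerodiv_on F"

lemma nzd_nonzero: "nzd G \<Longrightarrow> G \<noteq> 0"
proof
  assume "nzd G" "G = 0"
  then have "F dvd 1" using nonzerodiv_onD[of F G 1] by simp
  then show False using form_not_unit[OF form_F] by simp
qed

lemma curve_point_props:
  assumes "P \<in> curve_points F"
  shows "ideal P PR" "P \<noteq> UNIV" "a * b \<in> P \<Longrightarrow> a \<in> P \<or> b \<in> P" "F \<in> P"
    "P = Idl\<^bsub>PR\<^esub> {G \<in> P. \<exists>d. form d G}" "\<exists>i. Var i \<notin> P" "F dvd A \<Longrightarrow> A \<in> P"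
proof -
  have P: "primeideal P PR" "P = Idl\<^bsub>PR\<^esub> {G \<in> P. \<exists>d. form d G}" "F \<in> P" "\<exists>i. Var i \<notin> P"
    using assms by (simp_all add: curve_points_def)
  show "ideal P PR" "P \<noteq> UNIV" "a * b \<in> P \<Longrightarrow> a \<in> P \<or> b \<in> P" using primeideal_PR_dest[OF P(1)] by metis+
  show "F \<in> P" "P = Idl\<^bsub>PR\<^esub> {G \<in> P. \<exists>d. form d G}" "\<exists>i. Var i \<notin> P" using P by simp_all
  show "F dvd A \<Longrightarrow> A \<in> P" using ideal_PR_closed(5)[OF primeideal_PR_dest(1)[OF P(1)] P(3)] by (metis dvdE)
qed

lemma one_notin: "P \<in> curve_points F \<Longrightarrow> 1 \<notin> P"
proof
  assume P: "P \<in> curve_points F" "1 \<in> P"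
  have "a \<in> P" for a using ideal_PR_closed(4)[OF curve_point_props(1)[OF P(1)] P(2), of a] by simp
  then show False using curve_point_props(2)[OF P(1)] by blast
qed

lemma mult_notin: "P \<in> curve_points F \<Longrightarrow> a \<notin> P \<Longrightarrow> b \<notin> P \<Longrightarrow> a * b \<notin> P"
  using curve_point_props(3) by metis

lemma power_notin: "P \<in> curve_points F \<Longrightarrow> a \<notin> P \<Longrightarrow> a ^ j \<notin> P"
  by (induction j) (auto simp: one_notin mult_notin)

lemma notin_left: "P \<in> curve_points F \<Longrightarrow> a * b \<notin> P \<Longrightarrow> a \<notin> P"
  using ideal_PR_closed(5)[OF curve_point_props(1)] by metis

lemma notin_right: "P \<in> curve_points F \<Longrightarrow> a * b \<notin> P \<Longrightarrow> b \<notin> P"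
  using ideal_PR_closed(4)[OF curve_point_props(1)] by metis

lemma congruent_notin: "P \<in> curve_points F \<Longrightarrow> F dvd a - b \<Longrightarrow> a \<notin> P \<Longrightarrow> b \<notin> P"
  using ideal_PR_closed(2)[OF curve_point_props(1), of P "a - b" b] curve_point_props(7)[of P "a - b"] by auto

lemma rat_unitsI: "form d G \<Longrightarrow> form d H \<Longrightarrow> nzd G \<Longrightarrow> nzd H \<Longrightarrow> Fract G H \<in> rat_units F"
  unfolding rat_units_def by blast

lemma rat_unitsE:
  assumes "\<phi> \<in> rat_units F"
  obtains d G H where "form d G" "form d H" "nzd G" "nzd H" "G \<noteq> 0" "H \<noteq> 0" "\<phi> = Fract G H"
  using assms nzd_nonzero unfolding rat_units_def by (auto)

lemma rat_units_1: "1 \<in> rat_units F"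
  unfolding One_fract_def by (rule rat_unitsI[OF form_1 form_1]) (simp_all add: nonzerodiv_on_1)

lemma rat_units_mult: assumes "\<phi> \<in> rat_units F" "\<psi> \<in> rat_units F" shows "\<phi> * \<psi> \<in> rat_units F"
proof -
  obtain d G H where 1: "form d G" "form d H" "nzd G" "nzd H" "\<phi> = Fract G H" using rat_unitsE[OF assms(1)] by metis
  obtain e G' H' where 2: "form e G'" "form e H'" "nzd G'" "nzd H'" "\<psi> = Fract G' H'" using rat_unitsE[OF assms(2)] by metis
  show ?thesis unfolding 1(5) 2(5) mult_fract
    by (rule rat_unitsI[OF form_mult[OF 1(1) 2(1)] form_mult[OF 1(2) 2(2)] nonzerodiv_on_mult[OF 1(3) 2(3)] nonzerodiv_on_mult[OF 1(4) 2(4)]])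
qed

lemma rat_units_inverse: assumes "\<phi> \<in> rat_units F" shows "inverse \<phi> \<in> rat_units F"
proof -
  obtain d G H where 1: "form d G" "form d H" "nzd G" "nzd H" "\<phi> = Fract G H" using rat_unitsE[OF assms(1)] by metis
  show ?thesis unfolding 1(5) inverse_fract using 1 by (intro rat_unitsI)
qed

lemma rat_units_divide: "\<phi> \<in> rat_units F \<Longrightarrow> \<psi> \<in> rat_units F \<Longrightarrow> \<phi> / \<psi> \<in> rat_units F"
  unfolding divide_inverse by (intro rat_units_mult rat_units_inverse)

lemma rat_units_nonzero: assumes "\<phi> \<in> rat_units F" shows "\<phi> \<noteq> 0"
proof -
  obtain d G H where 1: "G \<noteq> 0" "H \<noteq> 0" "\<phi> = Fract G H" using rat_unitsE[OF assms(1)] by metis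
  then show ?thesis by (simp add: Zero_fract_def eq_fract)
qed

lemma stalk_unitI:
  "form d G \<Longrightarrow> form d H \<Longrightarrow> nzd H \<Longrightarrow> form e A \<Longrightarrow> form e B \<Longrightarrow> A \<notin> P \<Longrightarrow> B \<notin> P \<Longrightarrow> F dvd G * B - A * H \<Longrightarrow>
   stalk_unit F P (Fract G H)"
  unfolding stalk_unit_def by blast

text \<open>The definition provides the congruence for some representation of the fraction;
  cancelling the nonzerodivisor \<open>H'\<close> transfers it to the given one.\<close>

lemma stalk_unitD:
  assumes "stalk_unit F P (Fract G H)" "H \<noteq> 0"
  obtains e A B where "form e A" "form e B" "A \<notin> P" "B \<notin> P" "F dvd G * B - A * H"
proof -
  obtain d G' H' e A B where *: "Fract G H = Fract G' H'" "nzd H'" "form e A" "form e B" "A \<notin> P" "B \<notin> P"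
    "F dvd G' * B - A * H'" using assms(1) unfolding stalk_unit_def by metis
  have eq: "G * H' = G' * H" using *(1) assms(2) nzd_nonzero[OF *(2)] by (simp add: eq_fract)
  have "H' * (G * B - A * H) = (G * H') * B - H * (A * H')" by (simp add: algebra_simps)
  also have "\<dots> = H * (G' * B - A * H')" unfolding eq by (simp add: algebra_simps)
  finally have "F dvd H' * (G * B - A * H)" using *(7) by simp
  then have "F dvd G * B - A * H" by (rule nonzerodiv_onD[OF *(2)])
  then show ?thesis using that *(3-6) by metis
qed

lemma stalk_unit_1: "P \<in> curve_points F \<Longrightarrow> stalk_unit F P 1"
  unfolding One_fract_def
  by (rule stalk_unitI[OF form_1 form_1 nonzerodiv_on_1 form_1 form_1]) (auto simp: one_notin)

lemma stalk_unit_mult: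
  assumes P: "P \<in> curve_points F" and "\<phi> \<in> rat_units F" "\<psi> \<in> rat_units F" "stalk_unit F P \<phi>" "stalk_unit F P \<psi>"
  shows "stalk_unit F P (\<phi> * \<psi>)"
proof -
  obtain d G H where 1: "form d G" "form d H" "nzd H" "H \<noteq> 0" "\<phi> = Fract G H" using rat_unitsE[OF assms(2)] by metis
  obtain d' G' H' where 2: "form d' G'" "form d' H'" "nzd H'" "H' \<noteq> 0" "\<psi> = Fract G' H'" using rat_unitsE[OF assms(3)] by metis
  obtain e A B where A: "form e A" "form e B" "A \<notin> P" "B \<notin> P" "F dvd G * B - A * H"
    using stalk_unitD[OF assms(4)[unfolded 1(5)] 1(4)] .
  obtain e' A' B' where A': "form e' A'" "form e' B'" "A' \<notin> P" "B' \<notin> P" "F dvd G' * B' - A' * H'"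
    using stalk_unitD[OF assms(5)[unfolded 2(5)] 2(4)] .
  have "(G * G') * (B * B') - (A * A') * (H * H') = (G * B - A * H) * (G' * B') + (G' * B' - A' * H') * (A * H)"
    by (simp add: algebra_simps)
  then have "F dvd (G * G') * (B * B') - (A * A') * (H * H')" using A(5) A'(5) by (simp add: dvd_add dvd_mult2)
  then show ?thesis unfolding 1(5) 2(5) mult_fract
    by (rule stalk_unitI[OF form_mult[OF 1(1) 2(1)] form_mult[OF 1(2) 2(2)] nonzerodiv_on_mult[OF 1(3) 2(3)]
       form_mult[OF A(1) A'(1)] form_mult[OF A(2) A'(2)] mult_notin[OF P A(3) A'(3)] mult_notin[OF P A(4) A'(4)]])
qed

lemma stalk_unit_inverse:
  assumes "\<phi> \<in> rat_units F" "stalk_unit F P \<phi>" shows "stalk_unit F P (inverse \<phi>)"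
proof -
  obtain d G H where 1: "form d G" "form d H" "nzd G" "H \<noteq> 0" "\<phi> = Fract G H" using rat_unitsE[OF assms(1)] by metis
  obtain e A B where A: "form e A" "form e B" "A \<notin> P" "B \<notin> P" "F dvd G * B - A * H"
    using stalk_unitD[OF assms(2)[unfolded 1(5)] 1(4)] .
  have "H * A - B * G = - (G * B - A * H)" by (simp add: algebra_simps)
  then have "F dvd H * A - B * G" using A(5) by (simp only: dvd_minus_iff)
  then show ?thesis unfolding 1(5) inverse_fract
    by (rule stalk_unitI[OF 1(2) 1(1) 1(3) A(2) A(1) A(4) A(3)])
qed

abbreviation cdat :: "('k poly3 set \<Rightarrow> 'k poly3 fract) monoid" where
  "cdat \<equiv> cartier_data F"

lemma cdat_simps:
  "monoid.mult cdat \<phi> \<psi> = (\<lambda>P. \<phi> P * \<psi> P)" "monoid.one cdat = (\<lambda>P. 1)"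
  by (simp_all add: cartier_data_def)

lemma cdat_iff:
  "\<phi> \<in> carrier cdat \<longleftrightarrow> (\<forall>P\<in>curve_points F. \<phi> P \<in> rat_units F) \<and> (\<forall>P. P \<notin> curve_points F \<longrightarrow> \<phi> P = 1) \<and>
     (\<forall>P\<in>curve_points F. \<exists>d U. form d U \<and> U \<notin> P \<and>
       (\<forall>Q\<in>curve_points F. U \<notin> Q \<longrightarrow> stalk_unit F Q (\<phi> P / \<phi> Q)))"
  by (simp add: cartier_data_def)

lemma cdat_rat: "\<phi> \<in> carrier cdat \<Longrightarrow> P \<in> curve_points F \<Longrightarrow> \<phi> P \<in> rat_units F"
  by (simp add: cdat_iff)

lemma cdat_nonzero: "\<phi> \<in> carrier cdat \<Longrightarrow> \<phi> P \<noteq> 0"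
  using rat_units_nonzero by (cases "P \<in> curve_points F") (auto simp: cdat_iff)

lemma cdat_1: "(\<lambda>P. 1) \<in> carrier cdat"
  unfolding cdat_iff
proof (intro conjI ballI allI impI)
  fix P assume P: "P \<in> curve_points F"
  show "\<exists>d U. form d U \<and> U \<notin> P \<and> (\<forall>Q\<in>curve_points F. U \<notin> Q \<longrightarrow> stalk_unit F Q (1 / 1))"
    using one_notin[OF P] stalk_unit_1 by (intro exI[of _ 0] exI[of _ 1]) simp
qed (simp_all add: rat_units_1)

lemma cdat_mult:
  assumes "\<phi> \<in> carrier cdat" "\<psi> \<in> carrier cdat" shows "(\<lambda>P. \<phi> P * \<psi> P) \<in> carrier cdat"
  unfolding cdat_iff
proof (intro conjI ballI allI impI)
  fix P assume P: "P \<in> curve_points F"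
  show "\<phi> P * \<psi> P \<in> rat_units F" using rat_units_mult cdat_rat assms P by blast
  obtain d U where U: "form d U" "U \<notin> P" "\<And>Q. Q \<in> curve_points F \<Longrightarrow> U \<notin> Q \<Longrightarrow> stalk_unit F Q (\<phi> P / \<phi> Q)"
    using assms(1) P unfolding cdat_iff by metis
  obtain e V where V: "form e V" "V \<notin> P" "\<And>Q. Q \<in> curve_points F \<Longrightarrow> V \<notin> Q \<Longrightarrow> stalk_unit F Q (\<psi> P / \<psi> Q)"
    using assms(2) P unfolding cdat_iff by metis
  show "\<exists>d U. form d U \<and> U \<notin> P \<and> (\<forall>Q\<in>curve_points F. U \<notin> Q \<longrightarrow> stalk_unit F Q (\<phi> P * \<psi> P / (\<phi> Q * \<psi> Q)))"
  proof (intro exI conjI ballI impI)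
    show "form (d + e) (U * V)" using U(1) V(1) by (rule form_mult)
    show "U * V \<notin> P" using mult_notin[OF P U(2) V(2)] .
    fix Q assume Q: "Q \<in> curve_points F" "U * V \<notin> Q"
    have "stalk_unit F Q ((\<phi> P / \<phi> Q) * (\<psi> P / \<psi> Q))"
      using U(3)[OF Q(1) notin_left[OF Q]] V(3)[OF Q(1) notin_right[OF Q]] Q(1) P assms
      by (intro stalk_unit_mult rat_units_divide cdat_rat)
    then show "stalk_unit F Q (\<phi> P * \<psi> P / (\<phi> Q * \<psi> Q))" by simp
  qed
qed (use assms in \<open>simp add: cdat_iff\<close>)

lemma cdat_inverse:
  assumes "\<phi> \<in> carrier cdat" shows "(\<lambda>P. inverse (\<phi> P)) \<in> carrier cdat"
  unfolding cdat_iff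
proof (intro conjI ballI allI impI)
  fix P assume P: "P \<in> curve_points F"
  show "inverse (\<phi> P) \<in> rat_units F" using rat_units_inverse cdat_rat assms P by blast
  obtain d U where U: "form d U" "U \<notin> P" "\<And>Q. Q \<in> curve_points F \<Longrightarrow> U \<notin> Q \<Longrightarrow> stalk_unit F Q (\<phi> P / \<phi> Q)"
    using assms(1) P unfolding cdat_iff by metis
  show "\<exists>d U. form d U \<and> U \<notin> P \<and> (\<forall>Q\<in>curve_points F. U \<notin> Q \<longrightarrow> stalk_unit F Q (inverse (\<phi> P) / inverse (\<phi> Q)))"
  proof (intro exI conjI ballI impI)
    show "form d U" "U \<notin> P" using U by simp_all
    fix Q assume Q: "Q \<in> curve_points F" "U \<notin> Q"
    have "stalk_unit F Q (inverse (\<phi> P / \<phi> Q))"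
      using U(3)[OF Q] Q(1) P assms by (intro stalk_unit_inverse rat_units_divide cdat_rat)
    then show "stalk_unit F Q (inverse (\<phi> P) / inverse (\<phi> Q))" by (simp add: divide_inverse mult.commute)
  qed
qed (use assms in \<open>simp add: cdat_iff\<close>)

lemma comm_group_cdat: "comm_group cdat"
proof (rule comm_groupI)
  fix \<phi> assume \<phi>: "\<phi> \<in> carrier cdat"
  show "\<exists>\<psi>\<in>carrier cdat. \<psi> \<otimes>\<^bsub>cdat\<^esub> \<phi> = \<one>\<^bsub>cdat\<^esub>"
    using cdat_nonzero[OF \<phi>] by (intro bexI[OF _ cdat_inverse[OF \<phi>]]) (simp add: cdat_simps)
qed (simp_all add: cdat_simps cdat_1 cdat_mult mult_ac)

lemma inv_cdat: "\<phi> \<in> carrier cdat \<Longrightarrow> inv\<^bsub>cdat\<^esub> \<phi> = (\<lambda>P. inverse (\<phi> P))"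
  using cdat_nonzero
  by (intro group.inv_equality[OF comm_group.axioms(2)[OF comm_group_cdat]]) (auto simp: cdat_simps cdat_inverse)

lemma principal_iff:
  "\<phi> \<in> principal_data F \<longleftrightarrow> \<phi> \<in> carrier cdat \<and> (\<exists>f\<in>rat_units F. \<forall>P\<in>curve_points F. stalk_unit F P (\<phi> P / f))"
  by (simp add: principal_data_def)

lemma principalI:
  "\<phi> \<in> carrier cdat \<Longrightarrow> f \<in> rat_units F \<Longrightarrow> (\<And>P. P \<in> curve_points F \<Longrightarrow> stalk_unit F P (\<phi> P / f)) \<Longrightarrow> \<phi> \<in> principal_data F"
  unfolding principal_iff by blast

lemma subgroup_principal: "subgroup (principal_data F) cdat"
proof (rule group.subgroupI[OF comm_group.axioms(2)[OF comm_group_cdat]])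
  show "principal_data F \<subseteq> carrier cdat" by (auto simp: principal_iff)
  have "(\<lambda>P. 1) \<in> principal_data F"
    by (rule principalI[OF cdat_1 rat_units_1]) (simp add: stalk_unit_1)
  then show "principal_data F \<noteq> {}" by blast
next
  fix \<phi> assume "\<phi> \<in> principal_data F"
  then obtain f where f: "\<phi> \<in> carrier cdat" "f \<in> rat_units F" "\<And>P. P \<in> curve_points F \<Longrightarrow> stalk_unit F P (\<phi> P / f)"
    unfolding principal_iff by blast
  have "(\<lambda>P. inverse (\<phi> P)) \<in> principal_data F"
  proof (rule principalI[OF cdat_inverse[OF f(1)] rat_units_inverse[OF f(2)]])
    fix P assume P: "P \<in> curve_points F"
    have "stalk_unit F P (inverse (\<phi> P / f))"
      by (rule stalk_unit_inverse[OF rat_units_divide[OF cdat_rat[OF f(1) P] f(2)] f(3)[OF P]])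
    then show "stalk_unit F P (inverse (\<phi> P) / inverse f)" by (simp add: divide_inverse mult.commute)
  qed
  then show "inv\<^bsub>cdat\<^esub> \<phi> \<in> principal_data F" using inv_cdat[OF f(1)] by simp
  fix \<psi> assume "\<psi> \<in> principal_data F"
  then obtain g where g: "\<psi> \<in> carrier cdat" "g \<in> rat_units F" "\<And>P. P \<in> curve_points F \<Longrightarrow> stalk_unit F P (\<psi> P / g)"
    unfolding principal_iff by blast
  show "\<phi> \<otimes>\<^bsub>cdat\<^esub> \<psi> \<in> principal_data F"
    unfolding cdat_simps
  proof (rule principalI[OF cdat_mult[OF f(1) g(1)] rat_units_mult[OF f(2) g(2)]])
    fix P assume P: "P \<in> curve_points F"
    have "stalk_unit F P ((\<phi> P / f) * (\<psi> P / g))"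
      by (rule stalk_unit_mult[OF P rat_units_divide[OF cdat_rat[OF f(1) P] f(2)]
          rat_units_divide[OF cdat_rat[OF g(1) P] g(2)] f(3)[OF P] g(3)[OF P]])
    then show "stalk_unit F P (\<phi> P * \<psi> P / (f * g))" by simp
  qed
qed

lemma normal_principal: "principal_data F \<lhd> cdat"
  by (rule comm_group.subgroup_imp_normal[OF comm_group_cdat subgroup_principal])

lemma group_Pic: "group (Pic F)"
  unfolding Pic_def by (rule normal.factorgroup_is_group[OF normal_principal])

definition cls :: "('k poly3 set \<Rightarrow> 'k poly3 fract) \<Rightarrow> ('k poly3 set \<Rightarrow> 'k poly3 fract) set" where
  "cls \<phi> = principal_data F #>\<^bsub>cdat\<^esub> \<phi>"

lemma carrier_Pic: "carrier (Pic F) = cls ` carrier cdat"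
  by (auto simp: Pic_def carrier_FactGroup cls_def)

lemma cls_carrier: "\<phi> \<in> carrier cdat \<Longrightarrow> cls \<phi> \<in> carrier (Pic F)"
  by (simp add: carrier_Pic)

lemma cls_mult:
  "\<phi> \<in> carrier cdat \<Longrightarrow> \<psi> \<in> carrier cdat \<Longrightarrow> cls \<phi> \<otimes>\<^bsub>Pic F\<^esub> cls \<psi> = cls (\<lambda>P. \<phi> P * \<psi> P)"
  using normal.rcos_sum[OF normal_principal, of \<phi> \<psi>] by (simp add: Pic_def cls_def cdat_simps)

lemma cls_eq_one_iff: "\<phi> \<in> carrier cdat \<Longrightarrow> cls \<phi> = \<one>\<^bsub>Pic F\<^esub> \<longleftrightarrow> \<phi> \<in> principal_data F"
  using group.coset_join1[OF comm_group.axioms(2)[OF comm_group_cdat] _ _ subgroup_principal]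
    group.coset_join2[OF comm_group.axioms(2)[OF comm_group_cdat] _ subgroup_principal]
  by (auto simp: Pic_def cls_def)

lemma cls_1: "cls (\<lambda>P. 1) = \<one>\<^bsub>Pic F\<^esub>"
  using subgroup.one_closed[OF subgroup_principal] by (simp add: cls_eq_one_iff[OF cdat_1] cdat_simps)

lemma comm_group_Pic: "comm_group (Pic F)"
proof (rule group.group_comm_groupI[OF group_Pic])
  fix x y assume "x \<in> carrier (Pic F)" "y \<in> carrier (Pic F)"
  then obtain \<phi> \<psi> where xy: "x = cls \<phi>" "\<phi> \<in> carrier cdat" "y = cls \<psi>" "\<psi> \<in> carrier cdat" unfolding carrier_Pic by blast
  show "x \<otimes>\<^bsub>Pic F\<^esub> y = y \<otimes>\<^bsub>Pic F\<^esub> x"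
    unfolding xy(1,3) cls_mult[OF xy(2,4)] cls_mult[OF xy(4,2)] by (simp add: mult.commute)
qed

lemma cls_inv: assumes "\<phi> \<in> carrier cdat" shows "inv\<^bsub>Pic F\<^esub> (cls \<phi>) = cls (\<lambda>P. inverse (\<phi> P))"
proof (rule group.inv_equality[OF group_Pic])
  show "cls (\<lambda>P. inverse (\<phi> P)) \<otimes>\<^bsub>Pic F\<^esub> cls \<phi> = \<one>\<^bsub>Pic F\<^esub>"
    using cdat_nonzero[OF assms] by (simp add: cls_mult[OF cdat_inverse[OF assms] assms] cls_1)
qed (use assms cls_carrier cdat_inverse in auto)

lemma cdat_power: "\<phi> \<in> carrier cdat \<Longrightarrow> (\<lambda>P. \<phi> P ^ k) \<in> carrier cdat"
  by (induction k) (simp_all add: cdat_1 cdat_mult)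

lemma cls_power: "\<phi> \<in> carrier cdat \<Longrightarrow> cls \<phi> [^]\<^bsub>Pic F\<^esub> (k::nat) = cls (\<lambda>P. \<phi> P ^ k)"
proof (induction k)
  case 0 then show ?case by (simp add: cls_1 nat_pow_def)
next
  case (Suc k)
  then show ?case using cls_mult[OF cdat_power[OF Suc.prems, of k] Suc.prems]
    by (simp add: nat_pow_def mult.commute)
qed

lemma cdat_prod: "(\<And>i. i \<in> S \<Longrightarrow> \<phi> i \<in> carrier cdat) \<Longrightarrow> (\<lambda>P. \<Prod>i\<in>S. \<phi> i P) \<in> carrier cdat"
  by (induction S rule: infinite_finite_induct) (simp_all add: cdat_1 cdat_mult)

lemma cls_finprod:
  assumes "finite S" "\<And>i. i \<in> S \<Longrightarrow> \<phi> i \<in> carrier cdat"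
  shows "(\<Otimes>\<^bsub>Pic F\<^esub>i\<in>S. cls (\<phi> i)) = cls (\<lambda>P. \<Prod>i\<in>S. \<phi> i P)"
  using assms
proof (induction S rule: finite_induct)
  case empty
  then show ?case using comm_monoid.finprod_empty[OF comm_group.axioms(1)[OF comm_group_Pic]] by (simp add: cls_1)
next
  case (insert i S)
  have "(\<Otimes>\<^bsub>Pic F\<^esub>i\<in>insert i S. cls (\<phi> i)) = cls (\<phi> i) \<otimes>\<^bsub>Pic F\<^esub> (\<Otimes>\<^bsub>Pic F\<^esub>i\<in>S. cls (\<phi> i))"
    using insert.hyps insert.prems cls_carrier
    by (intro comm_monoid.finprod_insert[OF comm_group.axioms(1)[OF comm_group_Pic]]) auto
  then show ?case using insert cls_mult[OF _ cdat_prod, of "\<phi> i" S \<phi>] by simp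
qed

end

section \<open>Divisor classes of lines and of marked points\<close>

context marked_cubic
begin

lemma Const_notin:
  assumes "P \<in> curve_points F" "x \<noteq> 0" shows "Const x \<notin> P"
proof
  assume "Const x \<in> P"
  then have "Const (inverse x) * Const x \<in> P" by (rule ideal_PR_closed(4)[OF curve_point_props(1)[OF assms(1)]])
  then have "1 \<in> P" using Const_inverse[OF assms(2)] by (simp add: mult.commute)
  then show False using one_notin[OF assms(1)] by simp
qed

text \<open>A finite field may have no general line, so three linear forms outside \<open>P\<close>
  are written down: \<open>Var k\<close> and, for each other variable, \<open>Var l\<close> or
  \<open>Var l + Var k\<close>. They are pairwise coprime. If all divided the cubic, it would be a
  scalar multiple of their product and lie outside \<open>P\<close>; so one of them is a
  nonzerodivisor.\<close>

lemma linear_form_avoiding: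
  assumes P: "P \<in> curve_points F"
  shows "\<exists>h. form 1 h \<and> nzd h \<and> h \<notin> P"
proof -
  note id = curve_point_props(1)[OF P]
  obtain k where k: "Var k \<notin> P" using curve_point_props(6)[OF P] by metis
  obtain i j where ij: "i \<noteq> j" "i \<noteq> k" "j \<noteq> k" "UNIV = {k, i, j}" using other_coordinates[of k] .
  define s where "s l = (if Var l \<in> P then 1 else 0 :: 'k)" for l
  define h where "h l = Var l + Const (s l) * Var k" for l
  have fh: "form 1 (h l)" for l unfolding h_def by (intro form_add form_Const_mult form_Var)
  have hP: "h l \<notin> P" for l
  proof (cases "Var l \<in> P")
    case True
    have "Var k \<in> P" if "h l \<in> P" using ideal_PR_closed(3)[OF id that True] True by (simp add: h_def s_def)
    then show ?thesis using k by metis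
  next
    case False then show ?thesis by (simp add: h_def s_def)
  qed
  have nz: "x \<noteq> 0" if "x \<notin> P" for x using that ideal_PR_closed(1)[OF id] by metis
  have sep: "\<not> a dvd b" if "eval3 a v = 0" "eval3 b v \<noteq> 0" for a b and v :: "'k ^ 3"
    using eval3_dvd_0[of a b v] that by metis
  \<comment> \<open>A zero of \<open>h l\<close> with \<open>k\<close>-th coordinate
    \<open>1\<close>. Together with the unit vectors these points tell the three linear forms
    apart.\<close>
  let ?v = "\<lambda>l. (\<chi> x. if x = k then 1 else if x = l then - s l else 0) :: 'k ^ 3"
  have nd: "\<not> Var k dvd h i" "\<not> Var k dvd h j" "\<not> h i dvd h j" "\<not> h j dvd h i" "\<not> h i dvd Var k" "\<not> h j dvd Var k"
    using ij(1-3) by (intro sep[of _ "axis i 1"] sep[of _ "axis j 1"] sep[of _ "?v i"] sep[of _ "?v j"];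
      simp add: h_def axis_def)+
  let ?C = "{Var k, h i, h j}"
  have "\<exists>x\<in>?C. \<not> x dvd F"
  proof (rule ccontr)
    assume no: "\<not> ?thesis"
    have pr: "prime_elem x" if "x \<in> ?C" for x
      using that linear_form_prime[OF form_Var nz[OF k]] linear_form_prime[OF fh nz[OF hP]] by (elim insertE) auto
    have "\<Prod>?C dvd F"
    proof (rule prime_prod_dvd)
      show "\<And>q. q \<in> ?C \<Longrightarrow> q dvd F" using no by metis
      show "\<not> q dvd r" if "q \<in> ?C" "r \<in> ?C" "q \<noteq> r" for q r
        using that nd by (elim insertE) auto
    qed (use pr in auto)
    moreover have "Var k \<noteq> h i" "Var k \<noteq> h j" "h i \<noteq> h j" using nd dvd_refl by metis+
    ultimately have "Var k * (h i * h j) dvd F" by simp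
    then obtain x where x: "F = Var k * (h i * h j) * x" by (metis dvdE)
    have notin: "Var k * (h i * h j) \<notin> P" using mult_notin[OF P k mult_notin[OF P hP hP]] .
    have "form (3 - 3) x"
    proof (rule form_quotient[of 3 "Var k * (h i * h j)"])
      show "form 3 (Var k * (h i * h j))" using form_mult[OF form_Var[of k] form_mult[OF fh[of i] fh[of j]]]
        by (simp add: numeral_3_eq_3)
      show "Var k * (h i * h j) \<noteq> 0" using nz[OF notin] .
      show "form 3 (Var k * (h i * h j) * x)" using form_F x by simp
    qed simp
    then obtain y where y: "x = Const y" using form_0_eq_Const by auto
    then have "y \<noteq> 0" using x F_nonzero by auto
    then have "F \<notin> P" unfolding x y by (rule mult_notin[OF P notin Const_notin[OF P]])
    then show False using curve_point_props(4)[OF P] by metis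
  qed
  then obtain x where x: "x \<in> ?C" "\<not> x dvd F" by metis
  then have "form 1 x" "x \<notin> P" using fh hP k form_Var[of k] by auto
  then show ?thesis using nonzerodiv_on_prime[OF linear_form_prime x(2)] nz by metis
qed

text \<open>The standard denominator at \<open>P\<close>: division by its powers turns forms into
  functions near \<open>P\<close>.\<close>

definition lP :: "'k poly3 set \<Rightarrow> 'k poly3" where
  "lP P = (SOME h. form 1 h \<and> nzd h \<and> h \<notin> P)"

lemma lP: assumes "P \<in> curve_points F" shows "form 1 (lP P)" "nzd (lP P)" "lP P \<notin> P"
  using someI_ex[OF linear_form_avoiding[OF assms]] unfolding lP_def by auto

lemma stalk_unit_units:
  "form d G \<Longrightarrow> form d H \<Longrightarrow> nzd H \<Longrightarrow> G \<notin> P \<Longrightarrow> H \<notin> P \<Longrightarrow> stalk_unit F P (Fract G H)"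
  by (rule stalk_unitI[of d G H d G H]) simp_all

text \<open>Each numerator is locally a multiple of the other: on the curve
  \<open>S U G = V G'\<close> and \<open>S' U' G' = V' G\<close>. Combining the two and cancelling
  \<open>G\<close> shows that \<open>V\<close> is outside \<open>P\<close>, so the quotient is a
  unit.\<close>

lemma local_equation_unique:
  assumes P: "P \<in> curve_points F" and "\<phi> \<in> rat_units F" "\<psi> \<in> rat_units F"
    and "local_equation F J P \<phi>" "local_equation F J P \<psi>"
    and hJ: "ideal J PR"
  shows "stalk_unit F P (\<phi> / \<psi>)"
proof -
  have nzd_num: "nzd G" if GH: "Fract G H \<in> rat_units F" "nzd H" for G H
  proof -
    obtain d G1 H1 where 1: "nzd G1" "H1 \<noteq> 0" "Fract G H = Fract G1 H1" using rat_unitsE[OF GH(1)] by metis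
    have eq: "G * H1 = G1 * H" using 1 nzd_nonzero[OF GH(2)] by (simp add: eq_fract)
    show ?thesis unfolding nonzerodiv_on_def
    proof (intro allI impI)
      fix A assume "F dvd G * A"
      then have "F dvd H1 * (G * A)" by (rule dvd_mult)
      moreover have "H1 * (G * A) = (G1 * H) * A" by (simp add: mult_ac flip: eq)
      ultimately show "F dvd A" using nonzerodiv_onD[OF nonzerodiv_on_mult[OF 1(1) GH(2)]] by metis
    qed
  qed
  obtain d G H e U where 1: "form d G" "form d H" "\<phi> = Fract G H" "nzd H" "H \<notin> P" "form e U" "U \<notin> P" "U * G \<in> J"
    and loc1: "\<And>c A. form c A \<Longrightarrow> A \<in> J \<Longrightarrow> \<exists>a U b V. form a U \<and> form b V \<and> U \<notin> P \<and> F dvd U * A - V * G"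
    using assms(4) unfolding local_equation_def by metis
  obtain d' G' H' e' U' where 2: "form d' G'" "form d' H'" "\<psi> = Fract G' H'" "nzd H'" "H' \<notin> P" "form e' U'" "U' \<notin> P" "U' * G' \<in> J"
    and loc2: "\<And>c A. form c A \<Longrightarrow> A \<in> J \<Longrightarrow> \<exists>a U b V. form a U \<and> form b V \<and> U \<notin> P \<and> F dvd U * A - V * G'"
    using assms(5) unfolding local_equation_def by metis
  obtain a S b V where S: "form a S" "form b V" "S \<notin> P" "F dvd S * (U * G) - V * G'"
    using loc2[OF form_mult[OF 1(6,1)] 1(8)] by metis
  obtain a' S' b' V' where S': "form a' S'" "form b' V'" "S' \<notin> P" "F dvd S' * (U' * G') - V' * G"
    using loc1[OF form_mult[OF 2(6,1)] 2(8)] by metis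
  let ?S = "S * U" and ?S' = "S' * U'"
  have sP: "?S \<notin> P" "?S' \<notin> P" using mult_notin[OF P] S(3) S'(3) 1(7) 2(7) by metis+
  have nG: "nzd G" using nzd_num assms(2) 1(3,4) by metis
  have "G * (?S * ?S' - V * V') = (S * (U * G) - V * G') * ?S' + (S' * (U' * G') - V' * G) * V"
    by (simp add: algebra_simps)
  also have "F dvd \<dots>" using S(4) S'(4) by (intro dvd_add dvd_mult2)
  finally have "F dvd ?S * ?S' - V * V'" by (rule nonzerodiv_onD[OF nG])
  then have VP: "V \<notin> P" using notin_left[OF P congruent_notin[OF P _ mult_notin[OF P sP]]] by metis
  have fS: "form (a + e + d) (?S * G)" "form (b + d') (V * G')" "form (a + e) ?S"
    using form_mult[OF form_mult[OF S(1) 1(6)] 1(1)] form_mult[OF S(2) 2(1)] form_mult[OF S(1) 1(6)] by simp_all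
  have dv: "F dvd ?S * G - V * G'" using S(4) by (simp add: mult.assoc)
  \<comment> \<open>The congruence does not by itself equate the degrees. Were they different,
    comparing components would make \<open>F\<close> divide \<open>G * ?S\<close> alone, hence
    \<open>?S\<close>, which is outside \<open>P\<close>.\<close>
  have deg: "a + e + d = b + d'"
  proof (rule ccontr)
    assume ne: "a + e + d \<noteq> b + d'"
    obtain x where x: "?S * G - V * G' = F * x" using dv by (metis dvdE)
    have "hcomp (a + e + d) (?S * G - V * G') = ?S * G"
      unfolding hcomp_diff using hcomp_form[OF fS(1), of "a + e + d"] hcomp_form[OF fS(2), of "a + e + d"] ne by simp
    moreover have "F dvd hcomp (a + e + d) (F * x)" unfolding hcomp_mult_form'[OF form_F] by simp
    ultimately have "F dvd G * ?S" unfolding x by (simp add: mult.commute)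
    then have "F dvd ?S" by (rule nonzerodiv_onD[OF nG])
    then show False using curve_point_props(7)[OF P] sP(1) by metis
  qed
  have "\<phi> / \<psi> = Fract (G * H') (H * G')" unfolding 1(3) 2(3) by simp
  moreover have "stalk_unit F P (Fract (G * H') (H * G'))"
  proof (rule stalk_unitI[OF form_mult[OF 1(1) 2(2)] form_mult[OF 1(2) 2(1)]])
    show "nzd (H * G')" using nonzerodiv_on_mult[OF 1(4)] nzd_num assms(3) 2(3,4) by metis
    show "form (b + d') (V * H')" using form_mult[OF S(2) 2(2)] .
    show "form (b + d') (?S * H)" using form_mult[OF fS(3) 1(2)] unfolding deg .
    show "V * H' \<notin> P" "?S * H \<notin> P" using mult_notin[OF P VP 2(5)] mult_notin[OF P sP(1) 1(5)] .
    have "(G * H') * (?S * H) - (V * H') * (H * G') = (?S * G - V * G') * (H * H')" by (simp add: algebra_simps)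
    then show "F dvd (G * H') * (?S * H) - (V * H') * (H * G')" using dv by (simp only: dvd_mult2)
  qed
  ultimately show ?thesis by simp
qed

text \<open>Local equations are unique up to units, so all solutions lie in a single coset and the
  definite description denotes it.\<close>

lemma bundle_of_eq:
  assumes \<phi>: "\<phi> \<in> carrier cdat" and loc: "\<And>P. P \<in> curve_points F \<Longrightarrow> local_equation F J P (\<phi> P)"
    and J: "ideal J PR"
  shows "bundle_of F J = cls \<phi>"
  unfolding bundle_of_def
proof (rule the_equality)
  have grp: "group cdat" by (rule comm_group.axioms(2)[OF comm_group_cdat])
  have "\<phi> \<in> cls \<phi>" unfolding cls_def by (rule group.rcos_self[OF grp \<phi> subgroup_principal])
  then show "cls \<phi> \<in> carrier (Pic F) \<and> (\<exists>\<phi>\<in>cls \<phi>. \<forall>P\<in>curve_points F. local_equation F J P (\<phi> P))"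
    using cls_carrier[OF \<phi>] loc by metis
  fix c assume c: "c \<in> carrier (Pic F) \<and> (\<exists>\<phi>\<in>c. \<forall>P\<in>curve_points F. local_equation F J P (\<phi> P))"
  then obtain \<rho> where \<rho>: "c = cls \<rho>" "\<rho> \<in> carrier cdat" unfolding carrier_Pic by blast
  obtain \<psi> where \<psi>: "\<psi> \<in> cls \<rho>" "\<And>P. P \<in> curve_points F \<Longrightarrow> local_equation F J P (\<psi> P)"
    using c unfolding \<rho>(1) by metis
  have \<psi>c: "\<psi> \<in> carrier cdat"
    using subgroup.elemrcos_carrier[OF subgroup_principal grp \<rho>(2)] \<psi>(1) unfolding cls_def .
  have eq: "cls \<rho> = cls \<psi>"
    using group.repr_independence[OF grp _ \<rho>(2) subgroup_principal] \<psi>(1) unfolding cls_def .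
  let ?r = "\<lambda>P. \<psi> P * inverse (\<phi> P)"
  have r: "?r \<in> carrier cdat" using cdat_mult[OF \<psi>c cdat_inverse[OF \<phi>]] .
  have "?r \<in> principal_data F"
  proof (rule principalI[OF r rat_units_1])
    fix P assume P: "P \<in> curve_points F"
    show "stalk_unit F P (?r P / 1)"
      using local_equation_unique[OF P cdat_rat[OF \<psi>c P] cdat_rat[OF \<phi> P] \<psi>(2)[OF P] loc[OF P] J]
      by (simp add: divide_inverse)
  qed
  then have one: "cls ?r = \<one>\<^bsub>Pic F\<^esub>" using cls_eq_one_iff[OF r] by simp
  have "cls \<psi> = cls (\<lambda>P. ?r P * \<phi> P)" using cdat_nonzero[OF \<phi>] by (simp add: mult.assoc)
  also have "\<dots> = cls \<phi>"
    using cls_mult[OF r \<phi>] cls_carrier[OF \<phi>] group_Pic one by (simp add: group.is_monoid monoid.l_one)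
  finally show "c = cls \<phi>" using \<rho>(1) eq by simp
qed

definition ldata :: "'k poly3 \<Rightarrow> 'k poly3 set \<Rightarrow> 'k poly3 fract" where
  "ldata l P = (if P \<in> curve_points F then Fract l (lP P) else 1)"

lemma ldata_cdat:
  assumes l: "form 1 l" "nzd l" shows "ldata l \<in> carrier cdat"
  unfolding cdat_iff
proof (intro conjI ballI allI impI)
  fix P assume P: "P \<in> curve_points F"
  show "ldata l P \<in> rat_units F" using P lP[OF P] l by (simp add: ldata_def rat_unitsI[of 1] del: One_nat_def)
  show "\<exists>d U. form d U \<and> U \<notin> P \<and> (\<forall>Q\<in>curve_points F. U \<notin> Q \<longrightarrow> stalk_unit F Q (ldata l P / ldata l Q))"
  proof (intro exI conjI ballI impI)
    show "form 1 (lP P)" "lP P \<notin> P" using lP[OF P] by simp_all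
    fix Q assume Q: "Q \<in> curve_points F" "lP P \<notin> Q"
    have "ldata l P / ldata l Q = Fract (l * lP Q) (l * lP P)" using P Q(1) by (simp add: ldata_def mult.commute)
    also have "\<dots> = Fract (lP Q) (lP P)" using nzd_nonzero[OF l(2)] by (rule mult_fract_cancel)
    finally show "stalk_unit F Q (ldata l P / ldata l Q)"
      using stalk_unit_units[OF lP(1)[OF Q(1)] lP(1)[OF P] lP(2)[OF P] lP(3)[OF Q(1)] Q(2)] by simp
  qed
qed (simp add: ldata_def)

lemma ideal_two: "ideal (Idl\<^bsub>PR\<^esub> {l, F}) PR"
  by (rule PRr.genideal_ideal) simp

lemma ldata_local:
  assumes l: "form 1 l" "nzd l" and P: "P \<in> curve_points F"
  shows "local_equation F (Idl\<^bsub>PR\<^esub> {l, F}) P (ldata l P)"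
proof -
  let ?J = "Idl\<^bsub>PR\<^esub> {l, F}"
  have self: "{l, F} \<subseteq> ?J" by (rule PRr.genideal_self) simp
  have sub: "?J \<subseteq> {l * a + F * b |a b. True}"
  proof (rule PRr.genideal_minimal)
    show "ideal {l * a + F * b |a b. True} PR"
      unfolding ideal_PR_iff
    proof (intro conjI ballI allI)
      show "0 \<in> {l * a + F * b |a b. True}" by (intro CollectI exI[of _ 0]) simp
      fix x assume "x \<in> {l * a + F * b |a b. True}"
      then obtain a b where x: "x = l * a + F * b" by blast
      show "r * x \<in> {l * a + F * b |a b. True}" for r
        unfolding x by (intro CollectI exI[of _ "r * a"] exI[of _ "r * b"]) (simp add: algebra_simps)
      fix y assume "y \<in> {l * a + F * b |a b. True}"
      then obtain a' b' where y: "y = l * a' + F * b'" by blast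
      show "x + y \<in> {l * a + F * b |a b. True}"
        unfolding x y by (intro CollectI exI[of _ "a + a'"] exI[of _ "b + b'"]) (simp add: algebra_simps)
    qed
    have "l = l * 1 + F * 0" "F = l * 0 + F * 1" by simp_all
    then show "{l, F} \<subseteq> {l * a + F * b |a b. True}" by blast
  qed
  show ?thesis
    unfolding local_equation_def
  proof (rule exI[of _ 1], rule exI[of _ l], rule exI[of _ "lP P"], intro conjI allI impI)
    show "form 1 l" "form 1 (lP P)" "nzd (lP P)" "lP P \<notin> P" using l lP[OF P] by simp_all
    show "ldata l P = Fract l (lP P)" using P by (simp add: ldata_def)
    show "\<exists>e U. form e U \<and> U \<notin> P \<and> U * l \<in> ?J"
      using one_notin[OF P] self by (intro exI[of _ 0] exI[of _ 1]) simp
    fix c A assume A: "form c A \<and> A \<in> ?J"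
    then obtain a b where ab: "A = l * a + F * b" using sub by blast
    have "hcomp c A = (if c < 1 then 0 else l * hcomp (c - 1) a) + hcomp c (F * b)"
      unfolding ab hcomp_add hcomp_mult_form'[OF l(1)] ..
    also have "hcomp c A = A" using A hcomp_form[of c A c] by simp
    finally have eq: "A = (if c < 1 then 0 else l * hcomp (c - 1) a) + hcomp c (F * b)" .
    have dv: "F dvd hcomp c (F * b)" unfolding hcomp_mult_form'[OF form_F] by simp
    have "1 * A - (if c < 1 then 0 else hcomp (c - 1) a) * l = hcomp c (F * b)"
      by (subst eq) (simp add: mult.commute)
    then have "F dvd 1 * A - (if c < 1 then 0 else hcomp (c - 1) a) * l" using dv by (simp only:)
    moreover have "form (c - 1) (if c < 1 then 0 else hcomp (c - 1) a)" by (auto intro: form_hcomp)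
    ultimately show "\<exists>a U b V. form a U \<and> form b V \<and> U \<notin> P \<and> F dvd U * A - V * l"
      using one_notin[OF P] form_1 by metis
  qed
qed

lemma bundle_of_line: "form 1 l \<Longrightarrow> nzd l \<Longrightarrow> bundle_of F (Idl\<^bsub>PR\<^esub> {l, F}) = cls (ldata l)"
  by (rule bundle_of_eq[OF ldata_cdat ldata_local ideal_two])

text \<open>The two families differ by the global function \<open>l / l'\<close>.\<close>

lemma ldata_cls_eq:
  assumes l: "form 1 l" "nzd l" and l': "form 1 l'" "nzd l'"
  shows "cls (ldata l) = cls (ldata l')"
proof -
  let ?r = "\<lambda>P. ldata l P * inverse (ldata l' P)"
  have r: "?r \<in> carrier cdat" using cdat_mult[OF ldata_cdat[OF l] cdat_inverse[OF ldata_cdat[OF l']]] .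
  have f: "Fract l l' \<in> rat_units F" using rat_unitsI[OF l(1) l'(1) l(2) l'(2)] .
  have "?r \<in> principal_data F"
  proof (rule principalI[OF r f])
    fix P assume P: "P \<in> curve_points F"
    have "?r P = Fract (lP P * l) (lP P * l')" using P by (simp add: ldata_def mult.commute)
    also have "\<dots> = Fract l l'" using nzd_nonzero[OF lP(2)[OF P]] by (rule mult_fract_cancel)
    finally show "stalk_unit F P (?r P / Fract l l')" using stalk_unit_1[OF P] rat_units_nonzero[OF f] by simp
  qed
  then have one: "cls ?r = \<one>\<^bsub>Pic F\<^esub>" using cls_eq_one_iff[OF r] by simp
  have "cls (ldata l) = cls (\<lambda>P. ?r P * ldata l' P)" using cdat_nonzero[OF ldata_cdat[OF l']] by (simp add: mult.assoc)
  also have "\<dots> = cls (ldata l')"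
    using cls_mult[OF r ldata_cdat[OF l']] cls_carrier[OF ldata_cdat[OF l']] group_Pic one
    by (simp add: group.is_monoid monoid.l_one)
  finally show ?thesis .
qed

lemma line_class_eq: assumes l: "form 1 l" "nzd l" shows "line_class F = cls (ldata l)"
  unfolding line_class_def
proof (rule the_equality)
  show "\<exists>l'. form 1 l' \<and> nzd l' \<and> cls (ldata l) = bundle_of F (Idl\<^bsub>PR\<^esub> {l', F})"
    using l bundle_of_line[OF l] by metis
  show "c = cls (ldata l)" if "\<exists>l'. form 1 l' \<and> nzd l' \<and> c = bundle_of F (Idl\<^bsub>PR\<^esub> {l', F})" for c
    using that bundle_of_line ldata_cls_eq[OF _ _ l] by metis
qed

lemma point_form_iff: "i \<in> {1..n} \<Longrightarrow> form d G \<Longrightarrow> G \<in> point_ideal (p i) \<longleftrightarrow> eval3 G (p i) = 0"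
  using point_ideal_form_iff[OF point_nonzero] .

lemma point_curve_point:
  assumes i: "i \<in> {1..n}" shows "point_ideal (p i) \<in> curve_points F"
proof -
  let ?P = "point_ideal (p i)"
  have nz: "p i \<noteq> 0" using point_nonzero[OF i] .
  have eq: "?P = {G. coeff (theta (p i) G) 0 = 0}"
    unfolding ipow_1[symmetric] ipow_eq[OF nz] by (simp add: monom_1_dvd_iff')
  have "primeideal ?P PR"
  proof (rule primeidealI[OF ideal_point_ideal cring_PR])
    show "carrier PR \<noteq> ?P" using one_notin_ipow[OF nz, of 1] unfolding ipow_1 by auto
    show "a \<in> ?P \<or> b \<in> ?P" if "a \<otimes>\<^bsub>PR\<^esub> b \<in> ?P" for a b
      using that unfolding eq by (simp add: theta_simps(5) coeff_mult)
  qed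
  moreover have "?P = Idl\<^bsub>PR\<^esub> {G \<in> ?P. \<exists>d. form d G}"
  proof
    show "Idl\<^bsub>PR\<^esub> {G \<in> ?P. \<exists>d. form d G} \<subseteq> ?P" by (rule PRr.genideal_minimal[OF ideal_point_ideal]) auto
    have "{G. (\<exists>d. form d G) \<and> eval3 G (p i) = 0} \<subseteq> {G \<in> ?P. \<exists>d. form d G}"
      using point_form_iff[OF i] by auto
    then show "?P \<subseteq> Idl\<^bsub>PR\<^esub> {G \<in> ?P. \<exists>d. form d G}"
      unfolding point_ideal_def by (intro PRr.genideal_minimal PRr.genideal_ideal order_trans[OF _ PRr.genideal_self]) auto
  qed
  moreover have "F \<in> ?P" using point_ideal_form[OF form_F on_curve[OF i]] .
  moreover have "Var (piv (p i)) \<notin> ?P" using point_form_iff[OF i form_Var] piv[OF nz] by simp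
  ultimately show ?thesis unfolding curve_points_def by blast
qed

text \<open>Modulo forms vanishing at the point, a form \<open>G\<close> of degree \<open>d\<close>
  is its value there times \<open>h ^ d\<close>. Since \<open>h\<close> is outside the relevant
  prime \<open>P\<close>, a form in \<open>P\<close> must have value zero.\<close>

lemma point_ideal_maximal:
  assumes i: "i \<in> {1..n}" and P: "P \<in> curve_points F"
    and sub: "\<And>d G. form d G \<Longrightarrow> eval3 G (p i) = 0 \<Longrightarrow> G \<in> P"
  shows "P = point_ideal (p i)"
proof
  note id = curve_point_props(1)[OF P]
  have nz: "p i \<noteq> 0" using point_nonzero[OF i] .
  show "point_ideal (p i) \<subseteq> P"
    unfolding point_ideal_def using sub by (intro PRr.genideal_minimal[OF id]) auto
  have hP: "hh (p i) \<notin> P"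
  proof
    assume h: "hh (p i) \<in> P"
    obtain l where l: "Var l \<notin> P" using curve_point_props(6)[OF P] by metis
    have "LL (p i) l + Const (p i $ l) * hh (p i) \<in> P"
      using sub[OF form_LL eval_LL[OF nz]] ideal_PR_closed(2,4)[OF id] h by metis
    then show False using l by (simp add: LL_def)
  qed
  have "G \<in> point_ideal (p i)" if G: "G \<in> P" "form d G" for G d
  proof (rule ccontr)
    assume "G \<notin> point_ideal (p i)"
    then have ne: "eval3 G (p i) \<noteq> 0" using point_form_iff[OF i G(2)] by simp
    let ?H = "Const (eval3 G (p i)) * hh (p i) ^ d"
    have fH: "form d ?H" using form_Const_mult[OF form_power[OF form_hh[of "p i"], of d]] by simp
    have "G - ?H \<in> P" by (rule sub[OF form_diff[OF G(2) fH]]) (simp add: eval_hh[OF nz])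
    then have "G - (G - ?H) \<in> P" using ideal_PR_closed(3)[OF id G(1)] by metis
    then have "?H \<in> P" by simp
    then show False using mult_notin[OF P Const_notin[OF P ne] power_notin[OF P hP]] by metis
  qed
  then have "{G \<in> P. \<exists>d. form d G} \<subseteq> point_ideal (p i)" by auto
  then have "Idl\<^bsub>PR\<^esub> {G \<in> P. \<exists>d. form d G} \<subseteq> point_ideal (p i)" by (rule PRr.genideal_minimal[OF ideal_point_ideal])
  then show "P \<subseteq> point_ideal (p i)" using curve_point_props(5)[OF P] by metis
qed

lemma form_separating_point:
  assumes i: "i \<in> {1..n}" and P: "P \<in> curve_points F" "P \<noteq> point_ideal (p i)"
  shows "\<exists>d G. form d G \<and> eval3 G (p i) = 0 \<and> G \<notin> P"
  using point_ideal_maximal[OF i P(1)] P(2) by metis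

text \<open>The line \<open>par i\<close> may meet the curve again, so it is used as a local
  equation at \<open>p i\<close> only.\<close>

definition pdata :: "nat \<Rightarrow> 'k poly3 set \<Rightarrow> 'k poly3 fract" where
  "pdata i P = (if P = point_ideal (p i) then Fract (par i) (lP P) else 1)"

lemma par_nzd: "i \<in> {1..n} \<Longrightarrow> nzd (par i)"
  using par unfolding local_param_def by metis

lemma par_E:
  "i \<in> {1..n} \<Longrightarrow> \<exists>e E. form (Suc e) E \<and> eval3 E (p i) \<noteq> 0 \<and>
    (\<forall>t A. form t A \<and> eval3 A (p i) = 0 \<longrightarrow> (\<exists>a. form (e + t) a \<and> F dvd E * A - par i * a))"
  using par unfolding local_param_def by metis

lemma pdata_rat:
  assumes i: "i \<in> {1..n}" and P: "P \<in> curve_points F" shows "pdata i P \<in> rat_units F"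
proof (cases "P = point_ideal (p i)")
  case True
  show ?thesis unfolding pdata_def if_P[OF True]
    by (rule rat_unitsI[OF form_par[OF i] lP(1)[OF P] par_nzd[OF i] lP(2)[OF P]])
next
  case False
  show ?thesis unfolding pdata_def if_not_P[OF False] by (rule rat_units_1)
qed

lemma pdata_cdat:
  assumes i: "i \<in> {1..n}" shows "pdata i \<in> carrier cdat"
  unfolding cdat_iff
proof (intro conjI ballI allI impI)
  let ?Pi = "point_ideal (p i)"
  have Pi: "?Pi \<in> curve_points F" using point_curve_point[OF i] .
  fix P assume P: "P \<in> curve_points F"
  show "pdata i P \<in> rat_units F" using pdata_rat[OF i P] .
  have same: "stalk_unit F Q (pdata i P / pdata i Q)" if "Q \<in> curve_points F" "pdata i P = pdata i Q" for Q
    using stalk_unit_1[OF that(1)] that(2) rat_units_nonzero[OF pdata_rat[OF i that(1)]] by simp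
  show "\<exists>d U. form d U \<and> U \<notin> P \<and> (\<forall>Q\<in>curve_points F. U \<notin> Q \<longrightarrow> stalk_unit F Q (pdata i P / pdata i Q))"
  proof (cases "P = ?Pi")
    case True
    obtain e E where E: "form (Suc e) E" "eval3 E (p i) \<noteq> 0"
      "\<forall>t A. form t A \<and> eval3 A (p i) = 0 \<longrightarrow> (\<exists>a. form (e + t) a \<and> F dvd E * A - par i * a)"
      using par_E[OF i] by metis
    have EP: "E \<notin> P" using point_form_iff[OF i E(1)] E(2) True by simp
    show ?thesis
    proof (intro exI conjI ballI impI)
      show "form (Suc e + 1) (E * lP P)" by (rule form_mult[OF E(1) lP(1)[OF P]])
      show "E * lP P \<notin> P" using mult_notin[OF P EP lP(3)[OF P]] .
      fix Q assume Q: "Q \<in> curve_points F" "E * lP P \<notin> Q"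
      show "stalk_unit F Q (pdata i P / pdata i Q)"
      proof (cases "Q = ?Pi")
        case True
        with \<open>P = ?Pi\<close> show ?thesis using same[OF Q(1)] by simp
      next
        case False
        have EQ: "E \<notin> Q" "lP P \<notin> Q" using notin_left[OF Q] notin_right[OF Q] .
        \<comment> \<open>On this neighbourhood the parameter has no other zero: for every form
          \<open>A\<close> vanishing at \<open>p i\<close>, \<open>E * A\<close> is congruent to a
          multiple of \<open>par i\<close>, and some such \<open>A\<close> is outside
          \<open>Q\<close>.\<close>
        have uQ: "par i \<notin> Q"
        proof
          assume u: "par i \<in> Q"
          obtain t A where A: "form t A" "eval3 A (p i) = 0" "A \<notin> Q" using form_separating_point[OF i Q(1) False] by metis
          obtain a where a: "F dvd E * A - par i * a" using E(3) A(1,2) by metis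
          have "par i * a \<notin> Q" using congruent_notin[OF Q(1) a mult_notin[OF Q(1) EQ(1) A(3)]] .
          then show False using u notin_left[OF Q(1)] by metis
        qed
        have "pdata i P / pdata i Q = Fract (par i) (lP P)" using False True by (simp add: pdata_def)
        then show ?thesis
          using stalk_unit_units[OF form_par[OF i] lP(1)[OF P] lP(2)[OF P] uQ EQ(2)] by simp
      qed
    qed
  next
    case False
    obtain d G where G: "form d G" "eval3 G (p i) = 0" "G \<notin> P" using form_separating_point[OF i P False] by metis
    show ?thesis
    proof (intro exI conjI ballI impI)
      show "form d G" "G \<notin> P" using G by simp_all
      fix Q assume Q: "Q \<in> curve_points F" "G \<notin> Q"
      have "Q \<noteq> ?Pi" using Q(2) point_form_iff[OF i G(1)] G(2) by metis
      then show "stalk_unit F Q (pdata i P / pdata i Q)" using same[OF Q(1)] False by (simp add: pdata_def)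
    qed
  qed
next
  fix P assume "P \<notin> curve_points F"
  then have "P \<noteq> point_ideal (p i)" using point_curve_point[OF i] by metis
  then show "pdata i P = 1" by (simp add: pdata_def)
qed

lemma pdata_local:
  assumes i: "i \<in> {1..n}" and P: "P \<in> curve_points F"
  shows "local_equation F (point_ideal (p i)) P (pdata i P)"
proof (cases "P = point_ideal (p i)")
  case True
  obtain e E where E: "form (Suc e) E" "eval3 E (p i) \<noteq> 0"
    "\<forall>t A. form t A \<and> eval3 A (p i) = 0 \<longrightarrow> (\<exists>a. form (e + t) a \<and> F dvd E * A - par i * a)"
    using par_E[OF i] by metis
  have EP: "E \<notin> P" using point_form_iff[OF i E(1)] E(2) True by simp
  show ?thesis
    unfolding local_equation_def
  proof (rule exI[of _ 1], rule exI[of _ "par i"], rule exI[of _ "lP P"], intro conjI allI impI)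
    show "form 1 (par i)" "form 1 (lP P)" "nzd (lP P)" "lP P \<notin> P" using form_par[OF i] lP[OF P] by simp_all
    show "pdata i P = Fract (par i) (lP P)" using True by (simp add: pdata_def)
    have "par i \<in> point_ideal (p i)" using par[OF i] point_form_iff[OF i form_par[OF i]] unfolding local_param_def by metis
    then show "\<exists>e U. form e U \<and> U \<notin> P \<and> U * par i \<in> point_ideal (p i)"
      using one_notin[OF P] by (intro exI[of _ 0] exI[of _ 1]) simp
    fix c A assume A: "form c A \<and> A \<in> point_ideal (p i)"
    then obtain a where "form (e + c) a" "F dvd E * A - par i * a" using E(3) point_form_iff[OF i] by metis
    then show "\<exists>a U b V. form a U \<and> form b V \<and> U \<notin> P \<and> F dvd U * A - V * par i"
      using E(1) EP mult.commute[of "par i" a] by metis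
  qed
next
  case False
  obtain d G where G: "form d G" "eval3 G (p i) = 0" "G \<notin> P" using form_separating_point[OF i P False] by metis
  show ?thesis
    unfolding local_equation_def
  proof (rule exI[of _ 0], rule exI[of _ 1], rule exI[of _ 1], intro conjI allI impI)
    show "pdata i P = Fract 1 1" using False by (simp add: pdata_def One_fract_def)
    show "1 \<notin> P" using one_notin[OF P] .
    have "G * 1 \<in> point_ideal (p i)" using point_form_iff[OF i G(1)] G(2) by simp
    then show "\<exists>e U. form e U \<and> U \<notin> P \<and> U * 1 \<in> point_ideal (p i)" using G by metis
    fix c A assume "form c A \<and> A \<in> point_ideal (p i)"
    then show "\<exists>a U b V. form a U \<and> form b V \<and> U \<notin> P \<and> F dvd U * A - V * 1"
      using one_notin[OF P] by (intro exI[of _ 0] exI[of _ 1] exI[of _ c] exI[of _ A]) simp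
  qed (simp_all add: nonzerodiv_on_1)
qed

lemma bundle_of_point: "i \<in> {1..n} \<Longrightarrow> bundle_of F (point_ideal (p i)) = cls (pdata i)"
  by (rule bundle_of_eq[OF pdata_cdat pdata_local ideal_point_ideal])

definition tdata :: "'k poly3 \<Rightarrow> nat \<Rightarrow> nat \<Rightarrow> 'k poly3 set \<Rightarrow> 'k poly3 fract" where
  "tdata l t m P = ldata l P ^ t * (\<Prod>i\<in>{1..n}. inverse (pdata i P) ^ m)"

lemma tdata_cdat: "form 1 l \<Longrightarrow> nzd l \<Longrightarrow> tdata l t m \<in> carrier cdat"
  unfolding tdata_def[abs_def]
  by (intro cdat_mult cdat_power cdat_prod cdat_inverse ldata_cdat pdata_cdat)

lemma twist_class_eq:
  assumes l: "form 1 l" "nzd l" shows "twist_class F p t n m = cls (tdata l t m)"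
proof -
  have pw: "inv\<^bsub>Pic F\<^esub> (bundle_of F (point_ideal (p i))) [^]\<^bsub>Pic F\<^esub> m = cls (\<lambda>P. inverse (pdata i P) ^ m)"
    if i: "i \<in> {1..n}" for i
    unfolding bundle_of_point[OF i] cls_inv[OF pdata_cdat[OF i]] cls_power[OF cdat_inverse[OF pdata_cdat[OF i]]] ..
  have c: "(\<lambda>P. inverse (pdata i P) ^ m) \<in> carrier cdat" if "i \<in> {1..n}" for i
    using cdat_power[OF cdat_inverse[OF pdata_cdat[OF that]]] .
  have "(\<Otimes>\<^bsub>Pic F\<^esub>i\<in>{1..n}. inv\<^bsub>Pic F\<^esub> (bundle_of F (point_ideal (p i))) [^]\<^bsub>Pic F\<^esub> m)
      = (\<Otimes>\<^bsub>Pic F\<^esub>i\<in>{1..n}. cls (\<lambda>P. inverse (pdata i P) ^ m))"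
  proof (rule comm_monoid.finprod_cong'[OF comm_group.axioms(1)[OF comm_group_Pic] refl])
    show "(\<lambda>i. cls (\<lambda>P. inverse (pdata i P) ^ m)) \<in> {1..n} \<rightarrow> carrier (Pic F)" using cls_carrier[OF c] by blast
  qed (rule pw)
  also have "\<dots> = cls (\<lambda>P. \<Prod>i\<in>{1..n}. inverse (pdata i P) ^ m)" by (rule cls_finprod[OF _ c]) simp
  finally have eq: "(\<Otimes>\<^bsub>Pic F\<^esub>i\<in>{1..n}. inv\<^bsub>Pic F\<^esub> (bundle_of F (point_ideal (p i))) [^]\<^bsub>Pic F\<^esub> m)
      = cls (\<lambda>P. \<Prod>i\<in>{1..n}. inverse (pdata i P) ^ m)" .
  have mm: "cls (\<lambda>P. ldata l P ^ t) \<otimes>\<^bsub>Pic F\<^esub> cls (\<lambda>P. \<Prod>i\<in>{1..n}. inverse (pdata i P) ^ m)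
      = cls (\<lambda>P. ldata l P ^ t * (\<Prod>i\<in>{1..n}. inverse (pdata i P) ^ m))"
    by (rule cls_mult[OF cdat_power[OF ldata_cdat[OF l]] cdat_prod[OF c]])
  show ?thesis
    unfolding twist_class_def line_class_eq[OF l] cls_power[OF ldata_cdat[OF l]] tdata_def[abs_def] eq
    by (rule mm)
qed

lemma point_ideal_inj:
  assumes "i \<in> {1..n}" "j \<in> {1..n}" "point_ideal (p i) = point_ideal (p j)" shows "i = j"
proof (rule ccontr)
  assume ne: "i \<noteq> j"
  obtain l where l: "form 1 l" "eval3 l (p i) = 0" "eval3 l (p j) \<noteq> 0"
    using separating_line[OF point_nonzero[OF assms(1)] point_nonzero[OF assms(2)] distinct[OF assms(1,2) ne]] .
  then show False using point_form_iff[OF assms(1) l(1)] point_form_iff[OF assms(2) l(1)] assms(3) by simp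
qed

lemma tdata_at_point:
  assumes k: "k \<in> {1..n}" and P: "P = point_ideal (p k)"
  shows "tdata l t m P = Fract (l ^ t * lP P ^ m) (lP P ^ t * par k ^ m)"
proof -
  have cp: "P \<in> curve_points F" using point_curve_point[OF k] P by simp
  have "(\<Prod>i\<in>{1..n}. inverse (pdata i P) ^ m) = inverse (pdata k P) ^ m * (\<Prod>i\<in>{1..n} - {k}. inverse (pdata i P) ^ m)"
    using k by (intro prod.remove) simp_all
  also have "(\<Prod>i\<in>{1..n} - {k}. inverse (pdata i P) ^ m) = 1"
    using point_ideal_inj[OF k] P by (intro prod.neutral ballI) (auto simp: pdata_def)
  finally show ?thesis using P cp by (simp add: tdata_def pdata_def ldata_def Fract_power)
qed

lemma tdata_off_points:
  assumes "P \<in> curve_points F" "\<And>k. k \<in> {1..n} \<Longrightarrow> P \<noteq> point_ideal (p k)"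
  shows "tdata l t m P = Fract (l ^ t) (lP P ^ t)"
proof -
  have "(\<Prod>i\<in>{1..n}. inverse (pdata i P) ^ m) = 1"
    using assms(2) by (intro prod.neutral ballI) (simp add: pdata_def)
  then show ?thesis using assms(1) by (simp add: tdata_def ldata_def Fract_power)
qed

end

section \<open>Trivial class and existence of a section\<close>

lemma vord_power_form:
  assumes "local_param F q u" "form d w" "eval3 w q = 0" shows "w ^ j \<in> vord F q u j (j * d)"
proof (induction j)
  case 0 then show ?case by (simp add: vord_0)
next
  case (Suc j) then show ?case using vord_mult[OF vord_1[OF assms] Suc.IH] by simp
qed

text \<open>Rounding the quotient up finds the least natural \<open>r\<close> with
  \<open>a \<le> r * b\<close>; its minimality is what keeps the degree negative at every earlier
  step.\<close>

lemma nat_ceiling_quotient: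
  fixes a b :: int
  assumes "b > 0" "a \<ge> 0" and r: "r = nat \<lceil>real_of_int a / real_of_int b\<rceil>"
  shows "a \<le> int r * b" and "\<And>j. j < r \<Longrightarrow> int j * b < a"
proof -
  have "real_of_int a / real_of_int b \<le> real r"
    unfolding r using of_nat_ceiling[of "real_of_int a / real_of_int b"] by simp
  then have "real_of_int a \<le> real_of_int (int r * b)" using assms(1) by (simp add: pos_divide_le_eq)
  then show "a \<le> int r * b" by (simp only: of_int_le_iff)
  fix j assume "j < r"
  then have "int j < \<lceil>real_of_int a / real_of_int b\<rceil>" unfolding r by linarith
  then have "real_of_int (int j) < real_of_int a / real_of_int b" unfolding less_ceiling_iff .
  then have "real_of_int (int j * b) < real_of_int a" using assms(1) by (simp add: pos_less_divide_eq)
  then show "int j * b < a" by (simp only: of_int_less_iff)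
qed

context cubic
begin

text \<open>The function \<open>l ^ t / A\<close> trivialises the class, because the divisor of
  \<open>A\<close> on the curve is exactly \<open>m X\<close>: the order is \<open>m\<close> at the
  marked points, and there are no other zeros.\<close>

lemma section_imp_twist_trivial:
  assumes t: "3 * t = n * m" and l: "form 1 l" "nzd l" and sec: "has_section m t"
  shows "tdata l t m \<in> principal_data F"
proof -
  obtain A where A: "A \<in> VV {1..n} (\<lambda>_. m) t" "\<not> F dvd A" using sec unfolding has_section_def by metis
  have nzA: "nzd A" using zero_case_nonzerodiv[OF t A] .
  have fA: "form t A" using A(1) by (simp add: VV_iff)
  have flt: "form t (l ^ t)" using form_power[OF l(1), of t] by simp
  have lt0: "l ^ t \<noteq> 0" using nzd_nonzero[OF l(2)] by simp
  have f: "Fract (l ^ t) A \<in> rat_units F" using rat_unitsI[OF flt fA nonzerodiv_on_power[OF l(2)] nzA] .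
  show ?thesis
  proof (rule principalI[OF tdata_cdat[OF l] f])
    fix P assume P: "P \<in> curve_points F"
    have flP: "form j (lP P ^ j)" for j using form_power[OF lP(1)[OF P], of j] by simp
    show "stalk_unit F P (tdata l t m P / Fract (l ^ t) A)"
    proof (cases "\<exists>k\<in>{1..n}. P = point_ideal (p k)")
      case True
      then obtain k where k: "k \<in> {1..n}" "P = point_ideal (p k)" by (elim bexE)
      let ?u = "par k"
      have "tdata l t m P / Fract (l ^ t) A = Fract (l ^ t * (lP P ^ m * A)) (l ^ t * (lP P ^ t * ?u ^ m))"
        unfolding tdata_at_point[OF k] by (simp add: mult_ac)
      also have "\<dots> = Fract (lP P ^ m * A) (lP P ^ t * ?u ^ m)" using lt0 by (rule mult_fract_cancel)
      finally have eq: "tdata l t m P / Fract (l ^ t) A = Fract (lP P ^ m * A) (lP P ^ t * ?u ^ m)" .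
      obtain d e U a where U: "form d U" "eval3 U (p k) \<noteq> 0" "form e a" "e + m = d + t" "F dvd U * A - ?u ^ m * a"
        using vordE[OF VV_D[OF A(1) k(1)]] by metis
      \<comment> \<open>An order above \<open>m\<close> at \<open>p k\<close> would make the degree
        negative on the component through this point.\<close>
      have a: "eval3 a (p k) \<noteq> 0"
      proof
        assume a0: "eval3 a (p k) = 0"
        obtain x where x: "U * A - ?u ^ m * a = F * x" using U(5) by (metis dvdE)
        have fUA: "form (d + t) (U * A)" using form_mult[OF U(1) fA] .
        have u0: "eval3 ?u (p k) = 0" using par[OF k(1)] unfolding local_param_def by metis
        have "?u ^ m * a \<in> vord F (p k) ?u (m + 1) (m + e)"
          using vord_mult[OF vord_power[OF par[OF k(1)] form_par[OF k(1)] u0] vord_1[OF par[OF k(1)] U(3) a0]] .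
        then have 1: "?u ^ m * a \<in> vord F (p k) ?u (Suc m) (d + t)" using U(4) by (simp add: add.commute)
        have "form (d + t) (F * x)" unfolding x[symmetric] using form_diff[OF fUA vord_form[OF 1]] .
        then have "F * x \<in> vord F (p k) ?u (Suc m) (d + t)" using vord_multiple[OF point_nonzero[OF k(1)]] by metis
        then have "?u ^ m * a + F * x \<in> vord F (p k) ?u (Suc m) (d + t)"
          using lin.subspace_add[OF subspace_vord[OF point_nonzero[OF k(1)]] 1] by metis
        then have "U * A \<in> vord F (p k) ?u (Suc m) (d + t)" unfolding x[symmetric] by simp
        then have "A \<in> vord F (p k) ?u (Suc m) t" by (rule vord_cancel[OF U(1,2) fA])
        then have "A \<in> VV {1..n} ((\<lambda>_. m)(k := Suc m)) t" using A(1) unfolding VV_iff by simp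
        then have "F dvd A"
          using dvd_if_excess_point[where D = "\<lambda>_. m" and i = k and t = t] sum_const_zero[OF t] k(1) by simp
        with A(2) show False ..
      qed
      show ?thesis unfolding eq
      proof (rule stalk_unitI[OF form_mult[OF flP fA] _ _ form_mult[OF U(3) flP] _])
        show "form (m + t) (lP P ^ t * ?u ^ m)"
          using form_mult[OF flP[of t] form_power[OF form_par[OF k(1)], of m]] by (simp add: add.commute)
        show "nzd (lP P ^ t * ?u ^ m)"
          using nonzerodiv_on_mult[OF nonzerodiv_on_power[OF lP(2)[OF P]] nonzerodiv_on_power[OF par_nzd[OF k(1)]]] .
        show "form (e + m) (U * lP P ^ t)" using form_mult[OF U(1) flP[of t]] U(4) by simp
        have "a \<notin> P" "U \<notin> P" using point_form_iff[OF k(1) U(3)] a point_form_iff[OF k(1) U(1)] U(2) k(2) by simp_all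
        then show "a * lP P ^ m \<notin> P" "U * lP P ^ t \<notin> P"
          using mult_notin[OF P] power_notin[OF P lP(3)[OF P]] by metis+
        have "(lP P ^ m * A) * (U * lP P ^ t) - (a * lP P ^ m) * (lP P ^ t * ?u ^ m) =
            (U * A - ?u ^ m * a) * (lP P ^ m * lP P ^ t)" by (simp add: algebra_simps)
        then show "F dvd (lP P ^ m * A) * (U * lP P ^ t) - (a * lP P ^ m) * (lP P ^ t * ?u ^ m)"
          using U(5) by (simp only: dvd_mult2)
      qed
    next
      case False
      then have off: "\<And>k. k \<in> {1..n} \<Longrightarrow> P \<noteq> point_ideal (p k)" by metis
      have td: "tdata l t m P = Fract (l ^ t) (lP P ^ t)" by (rule tdata_off_points[OF P]) (rule off)
      have "tdata l t m P / Fract (l ^ t) A = Fract (l ^ t * A) (l ^ t * lP P ^ t)"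
        unfolding td by (simp add: mult_ac)
      also have "\<dots> = Fract A (lP P ^ t)" using lt0 by (rule mult_fract_cancel)
      finally have eq: "tdata l t m P / Fract (l ^ t) A = Fract A (lP P ^ t)" .
      have "A \<notin> P"
      proof
        assume AP: "A \<in> P"
        have "\<forall>i\<in>{1..n}. \<exists>w. (\<exists>d. form d w) \<and> eval3 w (p i) = 0 \<and> w \<notin> P"
          using form_separating_point[OF _ P off] by metis
        from bchoice[OF this] obtain w where w: "\<And>i. i \<in> {1..n} \<Longrightarrow> (\<exists>d. form d (w i)) \<and> eval3 (w i) (p i) = 0 \<and> w i \<notin> P"
          by metis
        then have "\<forall>i\<in>{1..n}. \<exists>d. form d (w i)" by metis
        from bchoice[OF this] obtain d where d: "\<And>i. i \<in> {1..n} \<Longrightarrow> form (d i) (w i)" by metis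
        let ?B = "\<Prod>i\<in>{1..n}. w i ^ m" and ?s = "\<Sum>i\<in>{1..n}. m * d i"
        have fp: "form (\<Sum>i\<in>S. m * d i) (\<Prod>i\<in>S. w i ^ m)" if "S \<subseteq> {1..n}" for S
          using d that by (intro form_prod form_power) (rule d, erule (1) subsetD)
        have "?B \<in> vord F (p k) (par k) m ?s" if k: "k \<in> {1..n}" for k
        proof -
          have "w k ^ m * (\<Prod>i\<in>{1..n} - {k}. w i ^ m) \<in> vord F (p k) (par k) (m + 0) (m * d k + (\<Sum>i\<in>{1..n} - {k}. m * d i))"
            using w[OF k] by (intro vord_mult vord_power_form[OF par[OF k] d[OF k]] vord_0 fp) auto
          moreover have "?B = w k ^ m * (\<Prod>i\<in>{1..n} - {k}. w i ^ m)" using k by (intro prod.remove) simp_all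
          moreover have "?s = m * d k + (\<Sum>i\<in>{1..n} - {k}. m * d i)" using k by (intro sum.remove) simp_all
          ultimately show ?thesis by simp
        qed
        then have B: "?B \<in> VV {1..n} (\<lambda>_. m) ?s" unfolding VV_iff using fp[OF order_refl] by metis
        have sum: "sum (\<lambda>_. m) {1..n} = 3 * t" using t by simp
        obtain r b where rb: "?B = r * F + b * A"
          using noether[OF order_refl A(1) nzd_nonzero[OF nzA] nzA sum B] by metis
        have "?B \<in> P" unfolding rb
          using ideal_PR_closed(2,4)[OF curve_point_props(1)[OF P]] curve_point_props(4)[OF P] AP by metis
        moreover have "(\<Prod>i\<in>S. w i ^ m) \<notin> P" if "finite S" "S \<subseteq> {1..n}" for S
          using that
        proof (induction S rule: finite_induct)
          case empty then show ?case using one_notin[OF P] by simp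
        next
          case (insert i S)
          then have "w i ^ m \<notin> P" using power_notin[OF P] w[of i] by simp
          then show ?case using insert mult_notin[OF P] by simp
        qed
        ultimately show False by simp
      qed
      then show ?thesis unfolding eq
        by (rule stalk_unit_units[OF fA flP nonzerodiv_on_power[OF lP(2)[OF P]] _ power_notin[OF P lP(3)[OF P]]])
    qed
  qed
qed

text \<open>The ideal \<open>{B. B l\<^sup>t H \<in> (F, G)}\<close> is contained in no point of the curve, hence contains a
  power of the irrelevant ideal; saturation of \<open>(F, G)\<close> turns the local sections into a form.\<close>

lemma twist_trivial_imp_section:
  assumes l: "form 1 l" "nzd l" and pr: "tdata l t m \<in> principal_data F"
  shows "has_section m t"
proof -
  obtain f where f: "f \<in> rat_units F" "\<And>P. P \<in> curve_points F \<Longrightarrow> stalk_unit F P (tdata l t m P / f)"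
    using pr unfolding principal_iff by metis
  obtain d G H where GH: "form d G" "form d H" "nzd G" "nzd H" "G \<noteq> 0" "H \<noteq> 0" "f = Fract G H"
    using rat_unitsE[OF f(1)] .
  have flt: "form t (l ^ t)" using form_power[OF l(1), of t] by simp
  let ?L = "l ^ t * H"
  have fL: "form (t + d) ?L" using form_mult[OF flt GH(2)] .
  have nzL: "nzd ?L" using nonzerodiv_on_mult[OF nonzerodiv_on_power[OF l(2)] GH(4)] .
  \<comment> \<open>The denominators of the rational section \<open>l ^ t * H / G\<close> on the
    curve.\<close>
  define I where "I = {B. \<exists>r s. B * ?L = r * F + s * G}"
  have idI: "ideal I PR"
    unfolding ideal_PR_iff I_def
  proof (intro conjI ballI allI)
    show "0 \<in> {B. \<exists>r s. B * ?L = r * F + s * G}" by (intro CollectI exI[of _ 0]) simp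
    fix x assume "x \<in> {B. \<exists>r s. B * ?L = r * F + s * G}"
    then obtain r s where x: "x * ?L = r * F + s * G" by blast
    show "c * x \<in> {B. \<exists>r s. B * ?L = r * F + s * G}" for c
    proof (intro CollectI exI)
      have "c * x * ?L = c * (x * ?L)" by (rule mult.assoc)
      also have "\<dots> = (c * r) * F + (c * s) * G" unfolding x by (simp add: algebra_simps)
      finally show "c * x * ?L = (c * r) * F + (c * s) * G" .
    qed
    fix y assume "y \<in> {B. \<exists>r s. B * ?L = r * F + s * G}"
    then obtain r' s' where y: "y * ?L = r' * F + s' * G" by blast
    show "x + y \<in> {B. \<exists>r s. B * ?L = r * F + s * G}"
    proof (intro CollectI exI)
      have "(x + y) * ?L = x * ?L + y * ?L" by (rule distrib_right)
      also have "\<dots> = (r + r') * F + (s + s') * G" unfolding x y by (simp add: algebra_simps)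
      finally show "(x + y) * ?L = (r + r') * F + (s + s') * G" .
    qed
  qed
  have homI: "homogeneous I"
    unfolding homogeneous_def
  proof (intro ballI allI)
    fix x j assume "x \<in> I"
    then obtain r s where x: "?L * x = F * r + G * s" unfolding I_def by (auto simp: mult.commute)
    have "?L * hcomp j x = hcomp (t + d + j) (?L * x)" using hcomp_mult_form[OF fL] by simp
    also have "\<dots> = F * (if t + d + j < 3 then 0 else hcomp (t + d + j - 3) r) + G * (if t + d + j < d then 0 else hcomp (t + d + j - d) s)"
      (is "_ = F * ?X + G * ?Y") unfolding x hcomp_add hcomp_mult_form'[OF form_F] hcomp_mult_form'[OF GH(1)] by simp
    also have "\<dots> = ?X * F + ?Y * G" by (rule arg_cong2[where f = "(+)", OF mult.commute mult.commute])
    finally have "hcomp j x * ?L = ?X * F + ?Y * G" unfolding mult.commute[of "hcomp j x" ?L] .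
    then show "hcomp j x \<in> I" unfolding I_def by (intro CollectI exI)
  qed
  have fd: "stalk_unit F P (Fract (l ^ t * N * H) (lP P ^ t * M * G))"
    if "P \<in> curve_points F" "tdata l t m P = Fract (l ^ t * N) (lP P ^ t * M)" for P N M
    using f(2)[OF that(1)] unfolding that(2) GH(7) by simp
  have at_point: "\<exists>e A B. form e A \<and> form e B \<and> A \<notin> P \<and> B \<notin> P \<and>
      F dvd (l ^ t * lP P ^ m * H) * B - A * (lP P ^ t * par k ^ m * G)"
    if k: "k \<in> {1..n}" "P = point_ideal (p k)" for k P
  proof -
    have P: "P \<in> curve_points F" using point_curve_point[OF k(1)] k(2) by simp
    have nz: "lP P ^ t * par k ^ m * G \<noteq> 0"
      using nzd_nonzero[OF lP(2)[OF P]] nzd_nonzero[OF par_nzd[OF k(1)]] GH(5) by simp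
    show ?thesis using stalk_unitD[OF fd[OF P tdata_at_point[OF k]] nz] by metis
  qed
  \<comment> \<open>At each point of the curve the local triviality supplies a denominator that does
    not vanish there.\<close>
  have W: "\<exists>W\<in>I. W \<notin> P" if P: "P \<in> curve_points F" for P
  proof (cases "\<exists>k\<in>{1..n}. P = point_ideal (p k)")
    case True
    then obtain k where k: "k \<in> {1..n}" "P = point_ideal (p k)" by (elim bexE)
    obtain e A B where AB: "B \<notin> P" "F dvd (l ^ t * lP P ^ m * H) * B - A * (lP P ^ t * par k ^ m * G)"
      using at_point[OF k] by metis
    obtain x where x: "(l ^ t * lP P ^ m * H) * B - A * (lP P ^ t * par k ^ m * G) = F * x" using AB(2) by (metis dvdE)
    have "(lP P ^ m * B) * ?L = x * F + (A * (lP P ^ t * par k ^ m)) * G"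
      using x by (simp add: algebra_simps)
    then have "lP P ^ m * B \<in> I" unfolding I_def by blast
    moreover have "lP P ^ m * B \<notin> P" using mult_notin[OF P power_notin[OF P lP(3)[OF P]] AB(1)] .
    ultimately show ?thesis by metis
  next
    case False
    then have off: "\<And>k. k \<in> {1..n} \<Longrightarrow> P \<noteq> point_ideal (p k)" by metis
    have nz: "lP P ^ t * 1 * G \<noteq> 0" using nzd_nonzero[OF lP(2)[OF P]] GH(5) by simp
    have td: "tdata l t m P = Fract (l ^ t * 1) (lP P ^ t * 1)" using tdata_off_points[OF P off] by simp
    obtain e A B where AB: "B \<notin> P" "F dvd (l ^ t * 1 * H) * B - A * (lP P ^ t * 1 * G)"
      using stalk_unitD[OF fd[OF P td] nz] by metis
    obtain x where x: "(l ^ t * 1 * H) * B - A * (lP P ^ t * 1 * G) = F * x" using AB(2) by (metis dvdE)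
    have "B * ?L = x * F + (A * lP P ^ t) * G" using x by (simp add: algebra_simps)
    then have "B \<in> I" unfolding I_def by blast
    then show ?thesis using AB(1) by metis
  qed
  have "\<exists>N. Var i ^ N \<in> I" for i
  proof (rule ccontr)
    assume "\<nexists>N. Var i ^ N \<in> I"
    then have x: "\<And>N. Var i ^ N \<notin> I" by metis
    obtain P where P: "I \<subseteq> P" "primeideal P PR" "homogeneous P" "Var i \<notin> P"
      using homogeneous_prime_avoiding_powers[OF idI homI x] by metis
    have "F * ?L = ?L * F + 0 * G" by (simp add: mult.commute)
    then have "F \<in> I" unfolding I_def by blast
    then have "P \<in> curve_points F"
      unfolding curve_points_def using P homogeneous_eq_genideal[OF primeideal_PR_dest(1)[OF P(2)] P(3)] by blast
    from W[OF this] show False using P(1) by blast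
  qed
  then obtain N where N: "\<And>i. Var i ^ N i \<in> I" by metis
  have "\<exists>r s. ?L = r * F + s * G"
  proof (rule complete_intersection_saturated[OF GH(3) F_nonzero GH(5)])
    show "\<exists>r s. M * ?L = r * F + s * G" if "form (N 1 + N 2 + N 3) M" for M
      using form_power_of_variables[OF idI N that] unfolding I_def by blast
  qed
  then obtain r s where rs: "?L = F * r + G * s" by (metis mult.commute)
  \<comment> \<open>The section itself: modulo \<open>F\<close> it equals
    \<open>l ^ t * H / G\<close>, of degree \<open>t + d - d\<close>.\<close>
  define A where "A = hcomp t s"
  have fA: "form t A" unfolding A_def by (rule form_hcomp)
  have "?L = hcomp (d + t) ?L" using hcomp_form[OF fL, of "d + t"] by (simp add: add.commute)
  also have "\<dots> = hcomp (d + t) (F * r) + G * A"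
    unfolding A_def hcomp_mult_form[OF GH(1), symmetric] hcomp_add[symmetric] rs[symmetric] ..
  finally have eq: "?L - G * A = hcomp (d + t) (F * r)" by (metis add_diff_cancel_right')
  have dv: "F dvd ?L - G * A" unfolding eq hcomp_mult_form'[OF form_F] by simp
  have "A \<in> vord F (p k) (par k) m t" if k: "k \<in> {1..n}" for k
  proof -
    let ?P = "point_ideal (p k)"
    have P: "?P \<in> curve_points F" using point_curve_point[OF k] .
    have flP: "form j (lP ?P ^ j)" for j using form_power[OF lP(1)[OF P], of j] by simp
    obtain e A' B where AB: "form e A'" "form e B" "B \<notin> ?P"
      "F dvd (l ^ t * lP ?P ^ m * H) * B - A' * (lP ?P ^ t * par k ^ m * G)"
      using at_point[OF k refl] by metis
    let ?U = "B * lP ?P ^ m" and ?a = "A' * lP ?P ^ t"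
    have "G * (?U * A - par k ^ m * ?a) =
      ((l ^ t * lP ?P ^ m * H) * B - A' * (lP ?P ^ t * par k ^ m * G)) - (?L - G * A) * ?U"
      by (simp add: algebra_simps)
    also have "F dvd \<dots>" by (rule dvd_diff[OF AB(4) dvd_mult2[OF dv]])
    finally have "F dvd ?U * A - par k ^ m * ?a" by (rule nonzerodiv_onD[OF GH(3)])
    moreover have fU: "form (e + m) ?U" using form_mult[OF AB(2) flP] .
    moreover have "?U \<notin> ?P" using mult_notin[OF P AB(3) power_notin[OF P lP(3)[OF P]]] .
    then have "eval3 ?U (p k) \<noteq> 0" using point_form_iff[OF k fU] by simp
    ultimately show ?thesis using vordI[OF fA fU _ form_mult[OF AB(1) flP[of t]], of "p k" m F "par k"] by simp
  qed
  then have "A \<in> VV {1..n} (\<lambda>_. m) t" using fA unfolding VV_iff by metis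
  moreover have "\<not> F dvd A"
  proof
    assume "F dvd A"
    then have "F dvd (?L - G * A) + G * A" using dv by (intro dvd_add dvd_mult)
    then have "F dvd ?L * 1" by simp
    then have "F dvd 1" by (rule nonzerodiv_onD[OF nzL])
    then show False using form_not_unit[OF form_F] by simp
  qed
  ultimately show ?thesis unfolding has_section_def by metis
qed

lemma line_exists: obtains l where "form 1 l" "nzd l"
proof -
  have "1 \<in> {1..n}" using n9 by simp
  from linear_form_avoiding[OF point_curve_point[OF this]] show ?thesis using that by metis
qed

lemma twist_trivial_iff:
  assumes t: "3 * t = n * m"
  shows "twist_class F p t n m = \<one>\<^bsub>Pic F\<^esub> \<longleftrightarrow> has_section m t"
proof -
  obtain l where l: "form 1 l" "nzd l" using line_exists .
  show ?thesis
    unfolding twist_class_eq[OF l] cls_eq_one_iff[OF tdata_cdat[OF l]]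
    using section_imp_twist_trivial[OF t l] twist_trivial_imp_section[OF l] by metis
qed

text \<open>Cartier data for \<open>(3, 1)\<close> raised to the power \<open>j\<close> are those
  for \<open>(3 j, j)\<close>, so a section at \<open>j\<close> means that the \<open>j\<close>-th
  power of the class is trivial. Since \<open>ord\<close> is \<open>0\<close> for infinite order,
  divisibility covers that case as well.\<close>

lemma twist_power:
  assumes n: "n = 9"
  shows "has_section j (3 * j) \<longleftrightarrow> group.ord (Pic F) (twist_class F p 3 9 1) dvd j"
proof -
  obtain l where l: "form 1 l" "nzd l" using line_exists .
  have tw: "twist_class F p t 9 k = cls (tdata l t k)" for t k using twist_class_eq[OF l, of t k] n by simp
  have fn: "(\<lambda>P. tdata l 3 1 P ^ j) = tdata l (3 * j) j"
    by (rule ext) (simp add: tdata_def power_mult_distrib power_mult prod_power_distrib)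
  have "twist_class F p 3 9 1 [^]\<^bsub>Pic F\<^esub> j = twist_class F p (3 * j) 9 j"
    unfolding tw cls_power[OF tdata_cdat[OF l]] fn ..
  moreover have "twist_class F p 3 9 1 \<in> carrier (Pic F)" unfolding tw using cls_carrier[OF tdata_cdat[OF l]] .
  ultimately have "twist_class F p (3 * j) 9 j = \<one>\<^bsub>Pic F\<^esub> \<longleftrightarrow> group.ord (Pic F) (twist_class F p 3 9 1) dvd j"
    using group.pow_eq_id[OF group_Pic] by metis
  then show ?thesis using twist_trivial_iff[of "3 * j" j] n by simp
qed

section \<open>Assembly of the three cases\<close>

lemma nine_points_identity: "(3 * m + 2) choose 2 = 1 + 9 * ((m + 1) choose 2)"
proof -
  have c: "real ((a + 2) choose 2) = (real a + 2) * (real a + 1) / 2" for a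
    by (induction a) (auto simp: numeral_2_eq_2 field_simps)
  have c': "real ((a + 1) choose 2) = (real a + 1) * real a / 2" for a
    by (induction a) (auto simp: numeral_2_eq_2 field_simps)
  have "real ((3 * m + 2) choose 2) = real (1 + 9 * ((m + 1) choose 2))"
    unfolding of_nat_add of_nat_mult c c' by (simp add: field_simps)
  then show ?thesis by (simp only: of_nat_eq_iff)
qed

lemma dim_IF_s_defect:
  assumes "n * m \<le> 3 * t" "n > 9 \<or> m > 0"
  shows "lin.dim (IF m t) + n * ((m + 1) choose 2) = ((t + 2) choose 2) + s_defect F p t n m"
proof (cases "n * m < 3 * t")
  case True
  then have "real (n * m) < real (3 * t)" by (simp only: of_nat_less_iff)
  then have "s_defect F p t n m = 0" using n9 unfolding s_defect_def by auto
  then show ?thesis using dim_IF_positive[OF True] by simp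
next
  case False
  then have t: "3 * t = n * m" using assms(1) by simp
  then have "real (3 * t) = real (n * m)" by (simp only: of_nat_eq_iff)
  then have real: "real t = real (n * m) / 3" by simp
  show ?thesis
  proof (cases "n = 9")
    case True
    have t3: "t = 3 * m" using t True by simp
    have s: "s_defect F p t n m = m div group.ord (Pic F) (twist_class F p 3 9 1)"
      using True real unfolding s_defect_def by simp
    show ?thesis
      unfolding s unfolding t3 using dim_IF_nine[OF True twist_power[OF True], of m] nine_points_identity[of m] True by simp
  next
    case False
    then have n: "n > 9" using n9 by simp
    have s: "s_defect F p t n m = (if m > 0 \<and> has_section m t then 1 else 0)"
      using n real twist_trivial_iff[OF t] unfolding s_defect_def by simp
    show ?thesis
    proof (cases "m = 0")
      case True
      \<comment> \<open>Occurs when the removals have used up all multiplicity; then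
        \<open>t = 0\<close> and the forms are the constants.\<close>
      then show ?thesis unfolding s using t by (simp add: IF_0 dim_forms numeral_2_eq_2)
    next
      case False
      then show ?thesis unfolding s using dim_IF_zero_large[OF n t] by simp
    qed
  qed
qed

lemma hilbert_function_cases:
  assumes m: "m \<ge> 1"
  shows "(t < 3 * m \<longrightarrow> hilbert_function (fat_ideal p n m) t = (t + 2) choose 2) \<and>
     (real t \<ge> real (n * m) / 3 \<longrightarrow>
        int (hilbert_function (fat_ideal p n m) t) =
          int (n * ((m + 1) choose 2)) - int (s_defect F p t n m)) \<and>
     (n > 9 \<and> 3 * m \<le> t \<and> real t < real (m * n) / 3 \<longrightarrow>
        (let r = nat \<lceil>(real (m * n) - 3 * real t) / (real n - 9)\<rceil> in
          int (hilbert_function (fat_ideal p n m) t) =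
            int ((t + 2) choose 2) - int ((t - 3 * r + 2) choose 2)
            + int (n * ((m - r + 1) choose 2)) - int (s_defect F p (t - 3 * r) n (m - r))))"
proof (intro conjI impI)
  have h: "hilbert_function (fat_ideal p n m) t + lin.dim (IF m t) = (t + 2) choose 2"
    using hilbert_function_fat_ideal[of m t] m by simp
  show "hilbert_function (fat_ideal p n m) t = (t + 2) choose 2" if "t < 3 * m"
    using h dim_IF_below[OF that] by simp
  show "int (hilbert_function (fat_ideal p n m) t) = int (n * ((m + 1) choose 2)) - int (s_defect F p t n m)"
    if "real t \<ge> real (n * m) / 3"
  proof -
    have "real (n * m) \<le> real (3 * t)" using that by simp
    then have "n * m \<le> 3 * t" by (simp only: of_nat_le_iff)
    then have "lin.dim (IF m t) + n * ((m + 1) choose 2) = ((t + 2) choose 2) + s_defect F p t n m"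
      by (rule dim_IF_s_defect) (use m in simp)
    with h show ?thesis by linarith
  qed
  assume a: "n > 9 \<and> 3 * m \<le> t \<and> real t < real (m * n) / 3"
  define r where "r = nat \<lceil>(real (m * n) - 3 * real t) / (real n - 9)\<rceil>"
  have "3 * real t < real (m * n)" using a by simp
  then have "real (3 * t) < real (m * n)" by simp
  then have lt: "3 * t < m * n" by (simp only: of_nat_less_iff)
  let ?a = "int (m * n) - 3 * int t" and ?b = "int n - 9"
  have "real_of_int ?a / real_of_int ?b = (real (m * n) - 3 * real t) / (real n - 9)" by simp
  then have r: "r = nat \<lceil>real_of_int ?a / real_of_int ?b\<rceil>" unfolding r_def by simp
  have b: "?b > 0" and a0: "?a \<ge> 0" using a lt by linarith+
  note q = nat_ceiling_quotient[OF b a0 r]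
  \<comment> \<open>From \<open>3 m \<le> t\<close> follows
    \<open>m n - 3 t \<le> m (n - 9)\<close>, so \<open>m\<close> removals are always
    enough.\<close>
  have rm: "r \<le> m"
  proof (rule ccontr)
    assume "\<not> r \<le> m"
    then have "int m * ?b < ?a" using q(2)[of m] by simp
    moreover have "9 * int m \<le> 3 * int t" using a by linarith
    ultimately show False by (simp add: algebra_simps)
  qed
  have rt: "3 * r \<le> t" using rm a by linarith
  \<comment> \<open>The deficit \<open>n (m - j) - 3 (t - 3 j)\<close> equals
    \<open>?a - j * ?b\<close>; it is positive for \<open>j < r\<close> and no longer positive at
    \<open>j = r\<close>.\<close>
  have steps: "3 * (t - 3 * j) < n * (m - j)" if "j < r" for j
  proof -
    have "int j * ?b < ?a" using q(2)[OF that] .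
    then have "3 * (int t - 3 * int j) < int n * (int m - int j)" by (simp add: algebra_simps)
    moreover have "int (3 * (t - 3 * j)) = 3 * (int t - 3 * int j)" using that rt by (simp add: of_nat_diff)
    moreover have "int (n * (m - j)) = int n * (int m - int j)" using that rm by (simp add: of_nat_diff)
    ultimately have "int (3 * (t - 3 * j)) < int (n * (m - j))" by metis
    then show ?thesis by (simp only: of_nat_less_iff)
  qed
  have end_ineq: "n * (m - r) \<le> 3 * (t - 3 * r)"
  proof -
    have "int n * (int m - int r) \<le> 3 * (int t - 3 * int r)" using q(1) by (simp add: algebra_simps)
    moreover have "int (3 * (t - 3 * r)) = 3 * (int t - 3 * int r)" using rt by (simp add: of_nat_diff)
    moreover have "int (n * (m - r)) = int n * (int m - int r)" using rm by (simp add: of_nat_diff)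
    ultimately have "int (n * (m - r)) \<le> int (3 * (t - 3 * r))" by metis
    then show ?thesis by (simp only: of_nat_le_iff)
  qed
  have "lin.dim (IF m t) = lin.dim (IF (m - r) (t - 3 * r))" by (rule dim_IF_peel[OF rm rt steps])
  moreover have "lin.dim (IF (m - r) (t - 3 * r)) + n * ((m - r + 1) choose 2)
      = ((t - 3 * r + 2) choose 2) + s_defect F p (t - 3 * r) n (m - r)"
    by (rule dim_IF_s_defect[OF end_ineq]) (use a in simp)
  ultimately show "let r = nat \<lceil>(real (m * n) - 3 * real t) / (real n - 9)\<rceil> in
          int (hilbert_function (fat_ideal p n m) t) =
            int ((t + 2) choose 2) - int ((t - 3 * r + 2) choose 2)
            + int (n * ((m - r + 1) choose 2)) - int (s_defect F p (t - 3 * r) n (m - r))"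
    unfolding Let_def r_def[symmetric] using h by linarith
qed

end

theorem theorem4p2:
  fixes F :: "'k::field poly3" and p :: "nat \<Rightarrow> 'k ^ 3" and n m t :: nat
  assumes "reduced_cubic F"
    and "n \<ge> 9" and "m \<ge> 1"
    and "\<forall>i\<in>{1..n}. smooth_point F (p i)"
    and "\<forall>i\<in>{1..n}. \<forall>j\<in>{1..n}. i \<noteq> j \<longrightarrow> \<not> same_point (p i) (p j)"
    and "evenly_distributed F p n"
  shows
    "(t < 3 * m \<longrightarrow> hilbert_function (fat_ideal p n m) t = (t + 2) choose 2) \<and>
     (real t \<ge> real (n * m) / 3 \<longrightarrow>
        int (hilbert_function (fat_ideal p n m) t) =
          int (n * ((m + 1) choose 2)) - int (s_defect F p t n m)) \<and>
     (n > 9 \<and> 3 * m \<le> t \<and> real t < real (m * n) / 3 \<longrightarrow>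
        (let r = nat \<lceil>(real (m * n) - 3 * real t) / (real n - 9)\<rceil> in
          int (hilbert_function (fat_ideal p n m) t) =
            int ((t + 2) choose 2) - int ((t - 3 * r + 2) choose 2)
            + int (n * ((m - r + 1) choose 2)) - int (s_defect F p (t - 3 * r) n (m - r))))"
proof -
  have F: "form 3 F" "F \<noteq> 0" "squarefree F" using assms(1) by (simp_all add: reduced_cubic_def)
  obtain C c where C: "finite C" "c \<noteq> 0" "F = Const c * \<Prod>C"
    "\<forall>\<Phi>\<in>C. irreducible \<Phi> \<and> (\<exists>e>0. form e \<Phi>)" "\<forall>\<Phi>\<in>C. \<forall>\<Psi>\<in>C. \<Phi> \<noteq> \<Psi> \<longrightarrow> \<not> \<Phi> dvd \<Psi>"
    using squarefree_form_factorization[OF F] by metis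
  define dg where "dg \<Phi> = (SOME e. e > 0 \<and> form e \<Phi>)" for \<Phi> :: "'k poly3"
  have dg: "dg \<Phi> > 0 \<and> form (dg \<Phi>) \<Phi>" if "\<Phi> \<in> C" for \<Phi>
  proof -
    have "\<exists>e. e > 0 \<and> form e \<Phi>" using bspec[OF C(4) that] by (rule conjunct2)
    from someI_ex[OF this] show ?thesis unfolding dg_def .
  qed
  have even: "3 * card {i \<in> {1..n}. eval3 \<Phi> (p i) = 0} = n * dg \<Phi>" if "\<Phi> \<in> C" for \<Phi>
  proof -
    have "\<Phi> dvd \<Prod>C" using C(1) that by (rule dvd_prodI)
    then have "\<Phi> dvd F" unfolding C(3) by (rule dvd_mult)
    then have "real (card {i \<in> {1..n}. eval3 \<Phi> (p i) = 0}) = real n * real (dg \<Phi>) / 3"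
      using assms(6) C(4) dg[OF that] that unfolding evenly_distributed_def by metis
    then have "real (3 * card {i \<in> {1..n}. eval3 \<Phi> (p i) = 0}) = real (n * dg \<Phi>)" by simp
    then show ?thesis by (simp only: of_nat_eq_iff)
  qed
  interpret cubic F p n C c dg
  proof
    show "form 3 F" "F \<noteq> 0" "finite C" "c \<noteq> 0" "F = Const c * \<Prod>C" "n \<ge> 9" using F C assms(2) by simp_all
    show "smooth_point F (p i)" if "i \<in> {1..n}" for i using assms(4) that by metis
    show "\<not> same_point (p i) (p j)" if "i \<in> {1..n}" "j \<in> {1..n}" "i \<noteq> j" for i j using assms(5) that by metis
    show "irreducible \<Phi>" "form (dg \<Phi>) \<Phi>" "dg \<Phi> > 0" if "\<Phi> \<in> C" for \<Phi> using C(4) dg[OF that] that by metis+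
    show "\<not> \<Phi> dvd \<Psi>" if "\<Phi> \<in> C" "\<Psi> \<in> C" "\<Phi> \<noteq> \<Psi>" for \<Phi> \<Psi> using C(5) that by metis
  qed (rule even)
  show ?thesis using hilbert_function_cases[OF assms(3)] .
qed

end
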